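(* Suppose that Assumptions (A1), (A2), (A3) and (A4) listed in the context hold. Suppose that the quantization density $\rho\in(0,1)$ and the threshold parameter $\sigma\in(0,\sigma_0]$ satisfy $$\frac{\Gamma L_{\mathrm{op}}(1-\rho)}{1+\rho}<\sigma<\frac{2c\rho}{\alpha L_{\mathrm{cl}}(1+\rho)}=:\sigma_1 .$$ Then, for every initial state $x_0\in\mathbf{B}_{\mathrm{cl}}(R/L_{\mathrm{cl}})$ and every $\tau_{\max}\in\mathbb{R}_{>0}$, the closed-loop system with logarithmic quantization and the self-triggering mechanism (STM) described in the context has the following properties. (i) The inter-sampling times satisfy $t_{k+1}-t_k\ge\min\{\tau_{\max},\tau_{\min},\widetilde\tau_{\min}\}>0$ for all $k\in\mathbb{Z}_{\ge0}$. (ii) There exists a unique solution $x$ of the closed-loop system with this STM on $\mathbb{R}_{\ge0}$. (iii) The solution $x$ satisfies $\|x(t)\|_{\mathrm{cl}}\le e^{-\gamma t}\|x_0\|_{\mathrm{cl}}$ for all $t\in\mathbb{R}_{\ge0}$, where $$\gamma:=\frac{-1}{\tau_{\max}}\log\Big(e^{-c\tau_{\max}}\Big(1-\frac{\sigma}{\sigma_1}\Big)+\frac{\sigma}{\sigma_1}\Big)>0 .$$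
   Context: **System.** $f:\mathbb{R}^n\times\mathbb{R}^m\to\mathbb{R}^n$ and $g:\mathbb{R}^n\to\mathbb{R}^m$ are continuous with $f(0,g(0))=0$. Put $F(x,e):=f(x,g(x+e))$, $F_0(x):=F(x,0)$, and, for $q\in\mathbb{R}^n$, $f_q(x):=f(x,g(q))$. $Dh$ denotes the Jacobian of $h$. **Notation.** For a norm $\|\cdot\|_*$ on $\mathbb{R}^n$ (and its induced matrix norm), the logarithmic norm is $\mu_*(A):=\lim_{\varepsilon\to0+}(\|I+\varepsilon A\|_*-1)/\varepsilon$; $\mathbf{B}_*(r)$ is the open ball $\{x\in\mathbb{R}^n:\|x\|_*<r\}$ for $0<r<\infty$, and $\mathbf{B}_*(\infty):=\mathbb{R}^n$. For $\theta\in\mathbb{R}^n_{>0}$, $[\theta]$ is the diagonal matrix with diagonal $\theta$, and $\|x\|_{r,[\theta]}:=\|[\theta]x\|_r$ for $r\in[1,\infty]$. **(A1)** There are a norm $\|\cdot\|_{\mathrm{cl}}$ on $\mathbb{R}^n$, $c\in\mathbb{R}_{>0}$ and $R_1\in\mathbb{R}_{>0}\cup\{\infty\}$ such that $F_0$ is locally Lipschitz on $\mathbf{B}_{\mathrm{cl}}(R_1)$ and $\mu_{\mathrm{cl}}(DF_0(x))\le -c$ for almost all $x\in\mathbf{B}_{\mathrm{cl}}(R_1)$. **(A2)** There are a norm $\|\cdot\|_{\mathrm{op}}$ on $\mathbb{R}^n$, $d_1\in\mathbb{R}_{\ge0}$, $d_2\in\mathbb{R}_{>0}$ and $R_2\in\mathbb{R}_{>0}\cup\{\infty\}$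 such that: $f_q$ is continuously differentiable on $\mathbf{B}_{\mathrm{op}}(R_2)$ for all $q\in\mathbf{B}_{\mathrm{op}}(R_2)$; $\mu_{\mathrm{op}}(Df_q(x))\le d_1$ for all $x,q\in\mathbf{B}_{\mathrm{op}}(R_2)$; and $\|f_q(q)\|_{\mathrm{op}}\le d_2\|q\|_{\mathrm{op}}$ for all $q\in\mathbf{B}_{\mathrm{op}}(R_2)$. $\Gamma\in\mathbb{R}_{>0}$ is a constant with $\|x\|_{\mathrm{op}}\le\Gamma\|x\|_{\mathrm{cl}}$ for all $x\in\mathbb{R}^n$, and $R:=\min\{R_1,R_2/\Gamma\}$. **(A3)** There are $\alpha,\sigma_0\in\mathbb{R}_{>0}$ such that $\|F(x,e)-F(x,0)\|_{\mathrm{cl}}\le\alpha\|e\|_{\mathrm{op}}$ for all $x\in\mathbf{B}_{\mathrm{cl}}(R)$ and $e\in\mathbf{B}_{\mathrm{op}}(\sigma_0R)$. **Norm comparison constants.** Fix arbitrary $\theta_{\mathrm{cl}},\theta_{\mathrm{op}}\in\mathbb{R}^n_{>0}$ and $r\in[1,\infty]$, and constants $L_{\mathrm{cl},1},L_{\mathrm{cl},2},L_{\mathrm{op},1},L_{\mathrm{op},2}\in\mathbb{R}_{>0}$ such that, for all $x\in\mathbb{R}^n$, $L_{\mathrm{cl},1}\|x\|_{\infty,[\theta_{\mathrm{cl}}]}\le\|x\|_{\mathrm{cl}}\le L_{\mathrm{cl},2}\|x\|_{\infty,[\theta_{\mathrm{cl}}]}$ and $L_{\mathrm{op},1}\|x\|_{r,[\theta_{\mathrm{op}}]}\le\|x\|_{\mathrm{op}}\le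 L_{\mathrm{op},2}\|x\|_{r,[\theta_{\mathrm{op}}]}$. Put $L_{\mathrm{cl}}:=L_{\mathrm{cl},2}/L_{\mathrm{cl},1}$ and $L_{\mathrm{op}}:=L_{\mathrm{op},2}/L_{\mathrm{op},1}$. **Logarithmic quantizer.** Let $\rho\in(0,1)$, $\chi_{i,0}\in\mathbb{R}_{>0}$ and $\chi_{i,j}:=\rho^j\chi_{i,0}$ for $i=1,\dots,n$, $j\in\mathbb{Z}$. Define $Q_{\log,i}(z):=(\chi_{i,j}+\chi_{i,j+1})/2$ if $\chi_{i,j+1}\le z<\chi_{i,j}$, $Q_{\log,i}(0):=0$, and $Q_{\log,i}(z):=-Q_{\log,i}(-z)$ if $z<0$. Then $Q_{\log}(z):=[Q_{\log,1}(z_1)\ \cdots\ Q_{\log,n}(z_n)]^\top$ for $z\in\mathbb{R}^n$. **(A4)** $R$ is finite and $\chi_{i,0}=\chi_0/\theta_{\mathrm{cl},i}$ for $i=1,\dots,n$, where $\theta_{\mathrm{cl},i}$ is the $i$-th entry of $\theta_{\mathrm{cl}}$ and $\chi_0\in\mathbb{R}_{>0}$ satisfies $\frac{R}{L_{\mathrm{cl},2}}\le\chi_0<\frac{2R}{L_{\mathrm{cl},2}(1+\rho)}$. **Closed-loop system.** With $t_0:=0$ and sampling times $t_0<t_1<t_2<\cdots$: $\dot x(t)=f(x(t),u(t))$ for $t\ge0$, $x(0)=x_0$; $u(t)=g(q_k)$ for $t\in[t_k,t_{k+1})$; $q_k=Q_{\log}(x(t_k))$, $k\in\mathbb{Z}_{\ge0}$.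 **STM.** For $q\in\mathbb{R}^n$ let $x_q$ be the solution of $\dot x_q(t)=f_q(x_q(t))$, $x_q(0)=q$. For $\tau\ge0$ and $q\in\mathbf{B}_{\mathrm{cl}}(R)$ such that $x_q$ exists uniquely on $[0,\tau]$, put $$\psi_{\log}(\tau,q):=\frac{L_{\mathrm{op}}(1-\rho)}{1+\rho}e^{d_1\tau}\|q\|_{\mathrm{op}}+\|x_q(\tau)-q\|_{\mathrm{op}} .$$ Given $\tau_{\max},\sigma>0$, the sampling times are $t_{k+1}:=t_k+\tau_k$, where - $\widetilde\tau_k:=\tau_{\max}$ if $\|x_{q_k}(\tau)\|_{\mathrm{op}}<R_2$ for all $\tau\in(0,\tau_{\max})$, and otherwise $\widetilde\tau_k:=\inf\{\tau\in\mathbb{R}_{>0}:\|x_{q_k}(\tau)\|_{\mathrm{op}}\ge R_2\}$; - $\tau_k:=\widetilde\tau_k$ if $\psi_{\log}(\tau,q_k)\le\sigma\|q_k\|_{\mathrm{cl}}$ for all $\tau\in(0,\widetilde\tau_k)$, and otherwise $\tau_k:=\inf\{\tau\in\mathbb{R}_{>0}:\psi_{\log}(\tau,q_k)>\sigma\|q_k\|_{\mathrm{cl}}\}$. **Constants $\tau_{\min},\widetilde\tau_{\min}$.** Let $\nu(t):=d_2\int_0^te^{d_1s}\,ds$ for $t\ge0$. $\tau_{\min}$ is the unique solution $t\in\mathbb{R}_{>0}$ of $\frac{L_{\mathrm{op}}(1-\rho)}{1+\rho}e^{d_1t}+\nu(t)=\frac{\sigma}{\Gamma}$ (it exists iff $\frac{\Gamma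 L_{\mathrm{op}}(1-\rho)}{1+\rho}<\sigma$). Let $\lambda_0:=\frac{(1+\rho)L_{\mathrm{cl},2}\chi_0}{2R}$ $(<1)$ and fix any $\lambda\in(\lambda_0,1)$; $\widetilde\tau_{\min}$ is the solution of $\lambda(1+\nu(t))=1$, i.e. $\widetilde\tau_{\min}=\frac1{d_1}\log\big(1+\frac{d_1(1-\lambda)}{d_2\lambda}\big)$ if $d_1\ne0$ and $\widetilde\tau_{\min}=\frac{1-\lambda}{d_2\lambda}$ if $d_1=0$. *)

theory Defs
  imports "HOL-Analysis.Analysis"
begin

text \<open>Norms on \<open>\<real>\<^sup>n\<close> other than the Euclidean norm of the type are functions satisfying the
  following predicate.\<close>

definition is_norm :: "('a::real_vector \<Rightarrow> real) \<Rightarrow> bool" where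
  "is_norm N \<longleftrightarrow>
     (\<forall>x. 0 \<le> N x) \<and> (\<forall>x. N x = 0 \<longleftrightarrow> x = 0) \<and>
     (\<forall>a x. N (a *\<^sub>R x) = \<bar>a\<bar> * N x) \<and> (\<forall>x y. N (x + y) \<le> N x + N y)"

definition norm_ball :: "('a \<Rightarrow> real) \<Rightarrow> ereal \<Rightarrow> 'a set" where
  "norm_ball N r = {x. ereal (N x) < r}"

definition matrix_norm :: "(real^'n \<Rightarrow> real) \<Rightarrow> real^'n^'n \<Rightarrow> real" where
  "matrix_norm N A = (SUP x\<in>{x. N x = 1}. N (A *v x))"

definition log_norm :: "(real^'n \<Rightarrow> real) \<Rightarrow> real^'n^'n \<Rightarrow> real" where
  "log_norm N A = Lim (at_right 0) (\<lambda>\<epsilon>. (matrix_norm N (mat 1 + \<epsilon> *\<^sub>R A) - 1) / \<epsilon>)"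

definition p_norm :: "ereal \<Rightarrow> real^'n \<Rightarrow> real" where
  "p_norm r x =
     (if r = \<infinity> then infnorm x
      else (\<Sum>i\<in>UNIV. \<bar>x $ i\<bar> powr real_of_ereal r) powr (1 / real_of_ereal r))"

definition diag_matrix :: "real^'n \<Rightarrow> real^'n^'n" where
  "diag_matrix \<theta> = (\<chi> i j. if i = j then \<theta> $ i else 0)"

definition weighted_norm :: "ereal \<Rightarrow> real^'n \<Rightarrow> real^'n \<Rightarrow> real" where
  "weighted_norm r \<theta> x = p_norm r (diag_matrix \<theta> *v x)"

definition cont_differentiable_on :: "(real^'n) set \<Rightarrow> (real^'n \<Rightarrow> real^'m) \<Rightarrow> bool" where
  "cont_differentiable_on S h \<longleftrightarrow>
     (\<forall>x\<in>S. h differentiable (at x)) \<and> continuous_on S (\<lambda>x. jacobian h (at x))"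


subsection \<open>The control system\<close>

definition pert_field ::
  "((real^'n) \<times> (real^'m) \<Rightarrow> real^'n) \<Rightarrow> (real^'n \<Rightarrow> real^'m) \<Rightarrow> real^'n \<Rightarrow> real^'n \<Rightarrow> real^'n" where
  "pert_field f g x e = f (x, g (x + e))"

definition held_field ::
  "((real^'n) \<times> (real^'m) \<Rightarrow> real^'n) \<Rightarrow> (real^'n \<Rightarrow> real^'m) \<Rightarrow> real^'n \<Rightarrow> real^'n \<Rightarrow> real^'n" where
  "held_field f g q x = f (x, g q)"


subsection \<open>The logarithmic quantizer\<close>

definition quant_level :: "real \<Rightarrow> real \<Rightarrow> int \<Rightarrow> real" where
  "quant_level \<rho> \<chi>\<^sub>0 j = \<rho> powi j * \<chi>\<^sub>0"

definition log_quant_pos :: "real \<Rightarrow> real \<Rightarrow> real \<Rightarrow> real" where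
  "log_quant_pos \<rho> \<chi>\<^sub>0 z =
     (let j = (THE j. quant_level \<rho> \<chi>\<^sub>0 (j + 1) \<le> z \<and> z < quant_level \<rho> \<chi>\<^sub>0 j)
      in (quant_level \<rho> \<chi>\<^sub>0 j + quant_level \<rho> \<chi>\<^sub>0 (j + 1)) / 2)"

definition log_quant_scalar :: "real \<Rightarrow> real \<Rightarrow> real \<Rightarrow> real" where
  "log_quant_scalar \<rho> \<chi>\<^sub>0 z =
     (if z = 0 then 0 else if 0 < z then log_quant_pos \<rho> \<chi>\<^sub>0 z else - log_quant_pos \<rho> \<chi>\<^sub>0 (- z))"

definition log_quant :: "real \<Rightarrow> real^'n \<Rightarrow> real^'n \<Rightarrow> real^'n" where
  "log_quant \<rho> X\<^sub>0 z = (\<chi> i. log_quant_scalar \<rho> (X\<^sub>0 $ i) (z $ i))"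


subsection \<open>Initial value problems\<close>

definition ivp_solution :: "('a::real_normed_vector \<Rightarrow> 'a) \<Rightarrow> 'a \<Rightarrow> real \<Rightarrow> (real \<Rightarrow> 'a) \<Rightarrow> bool" where
  "ivp_solution h q T y \<longleftrightarrow>
     y 0 = q \<and> (\<forall>s\<in>{0..T}. (y has_vector_derivative h (y s)) (at s within {0..T}))"

definition ivp_exists_uniquely :: "('a::real_normed_vector \<Rightarrow> 'a) \<Rightarrow> 'a \<Rightarrow> real \<Rightarrow> bool" where
  "ivp_exists_uniquely h q T \<longleftrightarrow>
     (\<exists>y. ivp_solution h q T y \<and> (\<forall>z. ivp_solution h q T z \<longrightarrow> (\<forall>s\<in>{0..T}. z s = y s)))"

text \<open>The value at time \<open>T\<close> of the solution on \<open>[0,T]\<close>; it is meaningful whenever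
  \<^const>\<open>ivp_exists_uniquely\<close> holds on \<open>[0,T]\<close>.\<close>

definition ivp_value :: "('a::real_normed_vector \<Rightarrow> 'a) \<Rightarrow> 'a \<Rightarrow> real \<Rightarrow> 'a" where
  "ivp_value h q T = (THE v. \<exists>y. ivp_solution h q T y \<and> y T = v)"


subsection \<open>The self-triggering mechanism\<close>

definition pred_state ::
  "((real^'n) \<times> (real^'m) \<Rightarrow> real^'n) \<Rightarrow> (real^'n \<Rightarrow> real^'m) \<Rightarrow> real^'n \<Rightarrow> real \<Rightarrow> real^'n" where
  "pred_state f g q \<tau> = ivp_value (held_field f g q) q \<tau>"

definition psi_log ::
  "((real^'n) \<times> (real^'m) \<Rightarrow> real^'n) \<Rightarrow> (real^'n \<Rightarrow> real^'m) \<Rightarrow> (real^'n \<Rightarrow> real) \<Rightarrow>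
   real \<Rightarrow> real \<Rightarrow> real \<Rightarrow> real \<Rightarrow> real^'n \<Rightarrow> real" where
  "psi_log f g N\<^sub>o\<^sub>p L\<^sub>o\<^sub>p \<rho> d\<^sub>1 \<tau> q =
     L\<^sub>o\<^sub>p * (1 - \<rho>) / (1 + \<rho>) * exp (d\<^sub>1 * \<tau>) * N\<^sub>o\<^sub>p q + N\<^sub>o\<^sub>p (pred_state f g q \<tau> - q)"

text \<open>For \<open>q\<close> in the open \<open>R\<^sub>2\<close>-ball the predicted state exists uniquely up to and including its
  first exit time from that ball, so the value of the infimum does not depend on the (possibly
  meaningless) values of \<^const>\<open>pred_state\<close> at later times. The same remark applies to the second
  infimum, because there the trigger condition is violated before the first exit.\<close>

definition tau_tilde ::
  "((real^'n) \<times> (real^'m) \<Rightarrow> real^'n) \<Rightarrow> (real^'n \<Rightarrow> real^'m) \<Rightarrow> (real^'n \<Rightarrow> real) \<Rightarrow>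
   ereal \<Rightarrow> real \<Rightarrow> real^'n \<Rightarrow> real" where
  "tau_tilde f g N\<^sub>o\<^sub>p R\<^sub>2 \<tau>\<^sub>m\<^sub>a\<^sub>x q =
     (if \<forall>\<tau>\<in>{0<..<\<tau>\<^sub>m\<^sub>a\<^sub>x}. ereal (N\<^sub>o\<^sub>p (pred_state f g q \<tau>)) < R\<^sub>2 then \<tau>\<^sub>m\<^sub>a\<^sub>x
      else Inf {\<tau>. 0 < \<tau> \<and> ereal (N\<^sub>o\<^sub>p (pred_state f g q \<tau>)) \<ge> R\<^sub>2})"

definition stm_interval ::
  "((real^'n) \<times> (real^'m) \<Rightarrow> real^'n) \<Rightarrow> (real^'n \<Rightarrow> real^'m) \<Rightarrow>
   (real^'n \<Rightarrow> real) \<Rightarrow> (real^'n \<Rightarrow> real) \<Rightarrow>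
   ereal \<Rightarrow> real \<Rightarrow> real \<Rightarrow> real \<Rightarrow> real \<Rightarrow> real \<Rightarrow> real^'n \<Rightarrow> real" where
  "stm_interval f g N\<^sub>c\<^sub>l N\<^sub>o\<^sub>p R\<^sub>2 d\<^sub>1 L\<^sub>o\<^sub>p \<rho> \<sigma> \<tau>\<^sub>m\<^sub>a\<^sub>x q =
     (if \<forall>\<tau>\<in>{0<..<tau_tilde f g N\<^sub>o\<^sub>p R\<^sub>2 \<tau>\<^sub>m\<^sub>a\<^sub>x q}. psi_log f g N\<^sub>o\<^sub>p L\<^sub>o\<^sub>p \<rho> d\<^sub>1 \<tau> q \<le> \<sigma> * N\<^sub>c\<^sub>l q
      then tau_tilde f g N\<^sub>o\<^sub>p R\<^sub>2 \<tau>\<^sub>m\<^sub>a\<^sub>x q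
      else Inf {\<tau>. 0 < \<tau> \<and> psi_log f g N\<^sub>o\<^sub>p L\<^sub>o\<^sub>p \<rho> d\<^sub>1 \<tau> q > \<sigma> * N\<^sub>c\<^sub>l q})"

definition nu :: "real \<Rightarrow> real \<Rightarrow> real \<Rightarrow> real" where
  "nu d\<^sub>1 d\<^sub>2 t = d\<^sub>2 * integral {0..t} (\<lambda>s. exp (d\<^sub>1 * s))"

definition tau_min :: "real \<Rightarrow> real \<Rightarrow> real \<Rightarrow> real \<Rightarrow> real \<Rightarrow> real \<Rightarrow> real" where
  "tau_min d\<^sub>1 d\<^sub>2 L\<^sub>o\<^sub>p \<rho> \<Gamma> \<sigma> =
     (THE t. 0 < t \<and> L\<^sub>o\<^sub>p * (1 - \<rho>) / (1 + \<rho>) * exp (d\<^sub>1 * t) + nu d\<^sub>1 d\<^sub>2 t = \<sigma> / \<Gamma>)"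

definition tau_tilde_min :: "real \<Rightarrow> real \<Rightarrow> real \<Rightarrow> real" where
  "tau_tilde_min d\<^sub>1 d\<^sub>2 \<kappa> = (THE t. 0 \<le> t \<and> \<kappa> * (1 + nu d\<^sub>1 d\<^sub>2 t) = 1)"


subsection \<open>The closed-loop system\<close>

text \<open>A trajectory consists of a state \<open>x\<close> and sampling times \<open>t\<close>, where \<open>Q\<close> is the quantizer and
  \<open>T q\<close> the inter-sampling time triggered by the quantized state \<open>q\<close>. The state is
  continuous, and on \<open>[t\<^sub>k, t\<^sub>k\<^sub>+\<^sub>1)\<close> it satisfies the differential equation with the input held
  constant (as a one-sided derivative at \<open>t\<^sub>k\<close>, where the input jumps). Neither \<open>t\<^sub>k < t\<^sub>k\<^sub>+\<^sub>1\<close> nor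
  the divergence of \<open>t\<^sub>k\<close> is part of the definition: that trajectories are non-Zeno, and hence defined
  on all of \<open>[0,\<infinity>)\<close>, has to be proved.\<close>

definition closed_loop_trajectory ::
  "((real^'n) \<times> (real^'m) \<Rightarrow> real^'n) \<Rightarrow> (real^'n \<Rightarrow> real^'m) \<Rightarrow> (real^'n \<Rightarrow> real^'n) \<Rightarrow>
   (real^'n \<Rightarrow> real) \<Rightarrow> real^'n \<Rightarrow> (nat \<Rightarrow> real) \<Rightarrow> (real \<Rightarrow> real^'n) \<Rightarrow> bool" where
  "closed_loop_trajectory f g Q T x\<^sub>0 t x \<longleftrightarrow>
     t 0 = 0 \<and> (\<forall>k. t (Suc k) = t k + T (Q (x (t k)))) \<and>
     x 0 = x\<^sub>0 \<and> continuous_on (\<Union>k. {t k..t (Suc k)}) x \<and>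
     (\<forall>k. \<forall>s\<in>{t k..<t (Suc k)}.
        (x has_vector_derivative f (x s, g (Q (x (t k))))) (at s within {t k..<t (Suc k)}))"

end

theory Submission
  imports Defs "HOL-Complex_Analysis.Great_Picard"
begin

text \<open>Let \<open>x\<close> be a state at a sampling time and \<open>q\<close> its quantization. On the next sampling
  interval the closed loop solves \<open>x' = f (x, g q)\<close>, and with the measurement error \<open>e = q - x\<close> the
  right-hand side is \<open>pert_field f g x e\<close>. For \<open>e = 0\<close> this field is contracting towards the
  equilibrium with rate \<open>c\<close>, and the error perturbs it by at most \<open>\<alpha>\<close> times the operating norm of
  \<open>e\<close>. The mechanism cannot observe \<open>e\<close>, but it keeps it below \<open>\<sigma>\<close> times the norm of \<open>q\<close>: the distance
  from \<open>x\<close> to the predicted state grows at most by the factor \<open>exp (d\<^sub>1 t)\<close> from the initial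
  quantization error, the distance from the predicted state to \<open>q\<close> is computed, and \<open>psi_log\<close> is the
  sum of the two bounds. A comparison argument then gives
  \<open>\<parallel>x(t)\<parallel> \<le> (exp (- c t) (1 - \<sigma> / \<sigma>\<^sub>1) + \<sigma> / \<sigma>\<^sub>1) \<parallel>x\<parallel>\<close>
  (\<open>held_interval_estimate\<close>), where \<open>\<sigma> / \<sigma>\<^sub>1 < 1\<close> also accounts for the growth of the norm under
  quantization. The factor is a convex combination of exponentials, so that up to the longest
  possible interval \<open>\<tau>\<^sub>m\<^sub>a\<^sub>x\<close> it lies below the exponential that agrees with it at \<open>0\<close> and
  \<open>\<tau>\<^sub>m\<^sub>a\<^sub>x\<close> (\<open>decay_le_exp\<close>). In particular the norm of the state at the next sampling time is no larger than
  before, the quantizer does not overflow, and the argument repeats.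

  The sampling intervals are bounded below because the predicted state \<open>y\<close> satisfies
  \<open>\<parallel>y(t) - q\<parallel> \<le> \<nu>(t) \<parallel>q\<parallel>\<close>; it therefore needs at least the time \<open>tau_tilde_min\<close> to leave the operating
  ball and the time \<open>tau_min\<close> to violate the trigger condition (\<open>sampling_interval\<close>). This excludes
  Zeno behaviour.

  The norms are arbitrary, hence not differentiable. All differential inequalities are expressed with
  norming functionals \<open>\<xi>\<close> of a vector \<open>v\<close>, i.e. \<open>\<xi> \<bullet> w \<le> \<parallel>w\<parallel>\<close> for all \<open>w\<close>, with equality for \<open>v\<close>. Along a
  curve \<open>u\<close>, a bound on \<open>\<xi> \<bullet> u'\<close> for the norming functionals of \<open>u\<close> bounds the growth of
  \<open>\<parallel>u\<parallel>\<close> (\<open>norm_comparison\<close>), and a bound on the logarithmic norm of the Jacobian gives a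
  one-sided Lipschitz condition \<open>\<xi> \<bullet> (h x - h y) \<le> a \<parallel>x - y\<parallel>\<close> for the norming functionals of \<open>x - y\<close>, even if
  the Jacobian is controlled only almost everywhere
  (\<open>one_sided_lipschitz_of_log_norm_ae\<close>). One-sided Lipschitz conditions also yield uniqueness of
  solutions (\<open>curve_of_unique\<close>), while existence comes from Peano's theorem (\<open>peano_existence\<close>).\<close>

section \<open>Norms, norming functionals and the logarithmic norm\<close>

lemma
  assumes "is_norm N"
  shows is_norm_ge_0: "0 \<le> N x"
    and is_norm_eq_0: "N x = 0 \<longleftrightarrow> x = 0"
    and is_norm_scale: "N (a *\<^sub>R x) = \<bar>a\<bar> * N x"
    and is_norm_triangle: "N (x + y) \<le> N x + N y"
  using assms by (auto simp: is_norm_def)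

lemma is_norm_zero: "is_norm N \<Longrightarrow> N 0 = 0"
  by (simp add: is_norm_eq_0)

lemma is_norm_minus: "is_norm N \<Longrightarrow> N (- x) = N x"
  using is_norm_scale[of N "-1" x] by simp

lemma is_norm_minus_commute: "is_norm N \<Longrightarrow> N (x - y) = N (y - x)"
  using is_norm_minus[of N "x - y"] by simp

lemma is_norm_triangle_sub: "is_norm N \<Longrightarrow> N x \<le> N y + N (x - y)"
  using is_norm_triangle[of N y "x - y"] by simp

lemma is_norm_sum:
  assumes "is_norm N" "finite A"
  shows "N (sum h A) \<le> (\<Sum>i\<in>A. N (h i))"
  using assms(2)
proof (induction A)
  case empty
  then show ?case by (simp add: is_norm_zero[OF assms(1)])
next
  case (insert i A)
  then show ?case using is_norm_triangle[OF assms(1), of "h i" "sum h A"] by simp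
qed

lemma is_norm_le_norm:
  fixes N :: "'a::euclidean_space \<Rightarrow> real"
  assumes "is_norm N"
  obtains C where "0 < C" "\<And>x. N x \<le> C * norm x"
proof -
  define C where "C = (\<Sum>b\<in>Basis. N (b::'a)) + 1"
  have ge0: "0 \<le> (\<Sum>b\<in>Basis. N (b::'a))"
    by (intro sum_nonneg is_norm_ge_0[OF assms])
  have "N x \<le> C * norm x" for x
  proof -
    have "N x = N (\<Sum>b\<in>Basis. (x \<bullet> b) *\<^sub>R b)" by (simp add: euclidean_representation)
    also have "\<dots> \<le> (\<Sum>b\<in>Basis. N ((x \<bullet> b) *\<^sub>R b))" by (rule is_norm_sum[OF assms]) simp
    also have "\<dots> = (\<Sum>b\<in>Basis. \<bar>x \<bullet> b\<bar> * N b)" by (simp add: is_norm_scale[OF assms])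
    also have "\<dots> \<le> (\<Sum>b\<in>Basis. norm x * N b)"
      by (intro sum_mono mult_right_mono Basis_le_norm is_norm_ge_0[OF assms])
    also have "\<dots> = (\<Sum>b\<in>Basis. N (b::'a)) * norm x" by (simp add: sum_distrib_left mult.commute)
    also have "\<dots> \<le> C * norm x" by (simp add: C_def mult_right_mono)
    finally show ?thesis .
  qed
  moreover have "0 < C" using ge0 by (simp add: C_def)
  ultimately show ?thesis using that by blast
qed

lemma is_norm_continuous_on:
  fixes N :: "'a::euclidean_space \<Rightarrow> real"
  assumes "is_norm N"
  shows "continuous_on S N"
proof -
  obtain C where C: "0 < C" "\<And>x. N x \<le> C * norm x" using is_norm_le_norm[OF assms] by blast
  have "\<bar>N x - N y\<bar> \<le> C * dist x y" for x y
    using is_norm_triangle_sub[OF assms, of x y] is_norm_triangle_sub[OF assms, of y x]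
      C(2)[of "x - y"] is_norm_minus_commute[OF assms, of x y] by (simp add: dist_norm)
  then have "C-lipschitz_on S N"
    using C(1) by (intro lipschitz_onI) (auto simp: dist_real_def)
  then show ?thesis by (rule lipschitz_on_continuous_on)
qed

lemma continuous_on_is_norm:
  fixes N :: "'a::euclidean_space \<Rightarrow> real"
  assumes "is_norm N" "continuous_on S h"
  shows "continuous_on S (\<lambda>x. N (h x))"
  using continuous_on_compose2[OF is_norm_continuous_on[OF assms(1), of UNIV] assms(2)] by simp

lemma norm_le_is_norm:
  fixes N :: "'a::euclidean_space \<Rightarrow> real"
  assumes "is_norm N"
  obtains C where "0 < C" "\<And>x. norm x \<le> C * N x"
proof -
  have "compact (sphere (0::'a) 1)" by simp
  moreover have "sphere (0::'a) 1 \<noteq> {}" by simp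
  ultimately obtain w where w: "w \<in> sphere 0 1" "\<And>y. y \<in> sphere 0 1 \<Longrightarrow> N w \<le> N y"
    using continuous_attains_inf[of "sphere (0::'a) 1" N] is_norm_continuous_on[OF assms] by blast
  have "w \<noteq> 0" using w(1) by auto
  then have pos: "0 < N w"
    using is_norm_ge_0[OF assms, of w] is_norm_eq_0[OF assms, of w] by linarith
  have "norm x \<le> (1 / N w) * N x" for x
  proof (cases "x = 0")
    case False
    then have "N w \<le> N ((1 / norm x) *\<^sub>R x)" by (intro w(2)) simp
    then have "N w * norm x \<le> N x"
      using False by (simp add: is_norm_scale[OF assms] pos_le_divide_eq)
    then show ?thesis using pos by (simp add: field_simps)
  qed (simp add: is_norm_zero[OF assms])
  then show ?thesis using that[of "1 / N w"] pos by simp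
qed

lemma convex_is_norm_le:
  assumes "is_norm N"
  shows "convex {x. N x \<le> r}"
  unfolding convex_alt
proof (clarsimp)
  fix x y u assume *: "N x \<le> r" "N y \<le> r" "0 \<le> u" "u \<le> (1::real)"
  have "N ((1 - u) *\<^sub>R x + u *\<^sub>R y) \<le> (1 - u) * N x + u * N y"
    using is_norm_triangle[OF assms, of "(1 - u) *\<^sub>R x" "u *\<^sub>R y"] *(3,4)
    by (simp add: is_norm_scale[OF assms])
  also have "\<dots> \<le> (1 - u) * r + u * r"
    by (intro add_mono mult_left_mono) (use * in auto)
  finally show "N ((1 - u) *\<^sub>R x + u *\<^sub>R y) \<le> r" by (simp add: algebra_simps)
qed

lemma compact_is_norm_le:
  fixes N :: "'a::euclidean_space \<Rightarrow> real"
  assumes "is_norm N"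
  shows "compact {x. N x \<le> r}"
proof -
  obtain C where C: "0 < C" "\<And>x. norm x \<le> C * N x" using norm_le_is_norm[OF assms] by blast
  have "norm x \<le> C * r" if "N x \<le> r" for x
    using C(2)[of x] mult_left_mono[OF that, of C] C(1) by linarith
  then have "bounded {x. N x \<le> r}" by (auto simp: bounded_iff)
  moreover have "closed {x. N x \<le> r}"
    by (intro closed_Collect_le is_norm_continuous_on[OF assms] continuous_on_const)
  ultimately show ?thesis by (simp add: compact_eq_bounded_closed)
qed

lemma open_norm_ball:
  fixes N :: "'a::euclidean_space \<Rightarrow> real"
  assumes "is_norm N"
  shows "open (norm_ball N r)"
proof -
  have "norm_ball N r = (\<lambda>x. ereal (N x)) -` {..<r}" by (auto simp: norm_ball_def)
  then show ?thesis
    by (simp add: open_vimage continuous_on_ereal is_norm_continuous_on[OF assms])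
qed

lemma convex_norm_ball:
  assumes "is_norm N"
  shows "convex (norm_ball N r)"
  unfolding convex_alt
proof (intro ballI allI impI)
  fix x y u assume *: "x \<in> norm_ball N r" "y \<in> norm_ball N r" and u: "0 \<le> u \<and> u \<le> (1::real)"
  have "x \<in> {z. N z \<le> max (N x) (N y)}" "y \<in> {z. N z \<le> max (N x) (N y)}" by auto
  then have "(1 - u) *\<^sub>R x + u *\<^sub>R y \<in> {z. N z \<le> max (N x) (N y)}"
    using convex_is_norm_le[OF assms, of "max (N x) (N y)"] u unfolding convex_alt by blast
  moreover have "ereal (max (N x) (N y)) < r" using * by (auto simp: norm_ball_def max_def)
  ultimately have "ereal (N ((1 - u) *\<^sub>R x + u *\<^sub>R y)) < r"
    by (metis ereal_less_eq(3) le_less_trans mem_Collect_eq)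
  then show "(1 - u) *\<^sub>R x + u *\<^sub>R y \<in> norm_ball N r" by (simp add: norm_ball_def)
qed

text \<open>A norming functional of \<open>x\<close> is a subgradient of the norm at \<open>x\<close>, written here as an inner
  product. These functionals replace the logarithmic norm and the Dini derivatives of the norm along
  curves: both are controlled by the numbers \<open>\<xi> \<bullet> v\<close>.\<close>

definition norming :: "('a::real_inner \<Rightarrow> real) \<Rightarrow> 'a \<Rightarrow> 'a \<Rightarrow> bool" where
  "norming N x \<xi> \<longleftrightarrow> (\<forall>v. \<xi> \<bullet> v \<le> N v) \<and> \<xi> \<bullet> x = N x"

lemma normingD:
  assumes "norming N x \<xi>"
  shows "\<xi> \<bullet> v \<le> N v" "\<xi> \<bullet> x = N x"
  using assms by (auto simp: norming_def)

text \<open>This is the Hahn-Banach theorem in finite dimension: the functional is a scaled normal of a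
  supporting hyperplane at \<open>x\<close> of the ball on whose boundary \<open>x\<close> lies.\<close>

lemma ex_norming:
  fixes N :: "'a::euclidean_space \<Rightarrow> real"
  assumes "is_norm N"
  shows "\<exists>\<xi>. norming N x \<xi>"
proof (cases "x = 0")
  case True
  then show ?thesis
    by (intro exI[of _ 0]) (simp add: norming_def is_norm_ge_0[OF assms] is_norm_zero[OF assms])
next
  case False
  then have Nx: "0 < N x"
    using is_norm_ge_0[OF assms, of x] is_norm_eq_0[OF assms, of x] by linarith
  define S where "S = {y. N y \<le> N x}"
  have cS: "convex S" unfolding S_def by (rule convex_is_norm_le[OF assms])
  have "open (norm_ball N (ereal (N x)))" by (rule open_norm_ball[OF assms])
  moreover have "norm_ball N (ereal (N x)) \<subseteq> S" by (auto simp: norm_ball_def S_def)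
  moreover have "0 \<in> norm_ball N (ereal (N x))"
    using Nx by (simp add: norm_ball_def is_norm_zero[OF assms])
  ultimately have int: "0 \<in> interior S" by (meson interiorI)
  have notint: "x \<notin> interior S"
  proof
    assume "x \<in> interior S"
    then obtain e where e: "0 < e" "cball x e \<subseteq> S" by (meson mem_interior_cball)
    define \<delta> where "\<delta> = e / norm x"
    have \<delta>: "0 < \<delta>" using e False by (simp add: \<delta>_def)
    have "(1 + \<delta>) *\<^sub>R x \<in> cball x e"
      using e False by (simp add: dist_norm \<delta>_def algebra_simps)
    then have "N ((1 + \<delta>) *\<^sub>R x) \<le> N x" using e by (auto simp: S_def)
    then have "(1 + \<delta>) * N x \<le> N x" using \<delta> by (simp add: is_norm_scale[OF assms])
    then show False using mult_pos_pos[OF \<delta> Nx] by (simp add: algebra_simps)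
  qed
  have ri: "rel_interior S = interior S"
    using int by (intro rel_interior_interior) (metis affine_hull_nonempty_interior empty_iff)
  then obtain a where a: "\<And>y. y \<in> S \<Longrightarrow> a \<bullet> x \<le> a \<bullet> y" "\<And>y. y \<in> rel_interior S \<Longrightarrow> a \<bullet> x < a \<bullet> y"
    using supporting_hyperplane_rel_boundary[OF cS, of x] notint unfolding S_def
    by (metis (no_types, lifting) mem_Collect_eq order_refl)
  have neg: "a \<bullet> x < 0" using a(2)[of 0] int ri by simp
  define \<xi> where "\<xi> = (N x / (a \<bullet> x)) *\<^sub>R a"
  have "\<xi> \<bullet> v \<le> N v" for v
  proof (cases "v = 0")
    case False
    then have Nv: "0 < N v"
      using is_norm_ge_0[OF assms, of v] is_norm_eq_0[OF assms, of v] by linarith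
    have "(N x / N v) *\<^sub>R v \<in> S" using Nv Nx by (simp add: S_def is_norm_scale[OF assms])
    then have "a \<bullet> x \<le> (N x / N v) * (a \<bullet> v)" using a(1) by fastforce
    then have "(a \<bullet> x) * N v \<le> N x * (a \<bullet> v)" using Nv by (simp add: field_simps)
    then show ?thesis using neg by (simp add: \<xi>_def neg_divide_le_eq mult.commute)
  qed (simp add: is_norm_zero[OF assms])
  moreover have "\<xi> \<bullet> x = N x" using neg by (simp add: \<xi>_def)
  ultimately show ?thesis unfolding norming_def by blast
qed

lemma matrix_norm_bdd_above:
  fixes N :: "real^'n \<Rightarrow> real"
  assumes "is_norm N"
  shows "bdd_above ((\<lambda>x. N (A *v x)) ` {x. N x = 1})"
proof -
  have "bounded_linear ((*v) A)" by simp
  then obtain K where K: "0 < K" "\<And>x. norm (A *v x) \<le> norm x * K"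
    using bounded_linear.pos_bounded by blast
  obtain C where C: "0 < C" "\<And>x. N x \<le> C * norm x" using is_norm_le_norm[OF assms] by blast
  obtain D where D: "0 < D" "\<And>x. norm x \<le> D * N x" using norm_le_is_norm[OF assms] by blast
  have "N (A *v x) \<le> C * (D * K)" if "N x = 1" for x
  proof -
    have "norm x * K \<le> D * K" using D(2)[of x] that K(1) by simp
    then have "norm (A *v x) \<le> D * K" using K(2)[of x] by linarith
    then have "C * norm (A *v x) \<le> C * (D * K)" using C(1) by simp
    then show ?thesis using C(2)[of "A *v x"] by linarith
  qed
  then show ?thesis by (intro bdd_aboveI2[where M = "C * (D * K)"]) auto
qed

lemma matrix_norm_upper:
  fixes N :: "real^'n \<Rightarrow> real"
  assumes "is_norm N"
  shows "N (A *v x) \<le> matrix_norm N A * N x"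
proof (cases "x = 0")
  case False
  then have pos: "0 < N x"
    using is_norm_ge_0[OF assms, of x] is_norm_eq_0[OF assms, of x] by linarith
  have "N (A *v ((1 / N x) *\<^sub>R x)) \<le> matrix_norm N A"
    unfolding matrix_norm_def
    by (rule cSUP_upper) (use pos matrix_norm_bdd_above[OF assms] in \<open>auto simp: is_norm_scale[OF assms]\<close>)
  then show ?thesis using pos
    by (simp add: matrix_vector_mult_scaleR is_norm_scale[OF assms] field_simps)
qed (simp add: is_norm_zero[OF assms])

lemma matrix_norm_least:
  fixes N :: "real^'n \<Rightarrow> real"
  assumes "is_norm N" "\<And>x. N x = 1 \<Longrightarrow> N (A *v x) \<le> B"
  shows "matrix_norm N A \<le> B"
proof -
  obtain b :: "real^'n" where b: "b \<noteq> 0" by (metis zero_neq_one)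
  then have "N ((1 / N b) *\<^sub>R b) = 1"
    using is_norm_ge_0[OF assms(1), of b] is_norm_eq_0[OF assms(1), of b]
    by (simp add: is_norm_scale[OF assms(1)])
  then have "{x. N x = 1} \<noteq> {}" by blast
  then show ?thesis unfolding matrix_norm_def by (rule cSUP_least) (use assms in auto)
qed

text \<open>The difference quotients of \<open>\<epsilon> \<mapsto> \<parallel>I + \<epsilon>A\<parallel>\<close> at 0 increase with \<open>\<epsilon>\<close> and are bounded below, so
  that the limit in the definition of the logarithmic norm exists. Each quotient bounds
  \<open>\<xi> \<bullet> (A x) / N x\<close>, since \<open>\<xi> \<bullet> (x + \<epsilon> A x) \<le> \<parallel>I + \<epsilon>A\<parallel> N x\<close>, and so does the limit.\<close>

lemma norming_matrix_le_log_norm: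
  fixes N :: "real^'n \<Rightarrow> real"
  assumes "is_norm N" "norming N x \<xi>"
  shows "\<xi> \<bullet> (A *v x) \<le> log_norm N A * N x"
proof -
  define \<phi> where "\<phi> = (\<lambda>\<epsilon>. (matrix_norm N (mat 1 + \<epsilon> *\<^sub>R A) - 1) / \<epsilon>)"
  have mv: "(mat 1 + \<epsilon> *\<^sub>R A) *v y = y + \<epsilon> *\<^sub>R (A *v y)" for \<epsilon> y
    by (simp add: matrix_vector_mult_add_rdistrib scaleR_matrix_vector_assoc)
  have mono: "\<phi> s \<le> \<phi> t" if "0 < s" "s \<le> t" for s t
  proof -
    define u where "u = s / t"
    have u: "0 < u" "u \<le> 1" "s = u * t" using that by (auto simp: u_def)
    have "matrix_norm N (mat 1 + s *\<^sub>R A) \<le> (1 - u) + u * matrix_norm N (mat 1 + t *\<^sub>R A)"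
    proof (rule matrix_norm_least[OF assms(1)])
      fix y assume y: "N y = 1"
      have "(mat 1 + s *\<^sub>R A) *v y = (1 - u) *\<^sub>R y + u *\<^sub>R ((mat 1 + t *\<^sub>R A) *v y)"
        by (simp add: mv u(3) scaleR_matrix_vector_assoc[symmetric] scaleR_right_distrib scaleR_left_diff_distrib)
      then have "N ((mat 1 + s *\<^sub>R A) *v y) \<le> (1 - u) + u * N ((mat 1 + t *\<^sub>R A) *v y)"
        using is_norm_triangle[OF assms(1), of "(1 - u) *\<^sub>R y" "u *\<^sub>R ((mat 1 + t *\<^sub>R A) *v y)"] u
        by (simp add: is_norm_scale[OF assms(1)] y)
      also have "u * N ((mat 1 + t *\<^sub>R A) *v y) \<le> u * matrix_norm N (mat 1 + t *\<^sub>R A)"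
        using matrix_norm_upper[OF assms(1), of "mat 1 + t *\<^sub>R A" y] y u(1)
        by (intro mult_left_mono) auto
      finally show "N ((mat 1 + s *\<^sub>R A) *v y) \<le> (1 - u) + u * matrix_norm N (mat 1 + t *\<^sub>R A)"
        by simp
    qed
    then have "matrix_norm N (mat 1 + s *\<^sub>R A) - 1 \<le> u * (matrix_norm N (mat 1 + t *\<^sub>R A) - 1)"
      by (simp add: algebra_simps)
    then show ?thesis using that by (simp add: \<phi>_def u_def field_simps)
  qed
  have low: "\<eta> \<bullet> (A *v y) \<le> \<phi> \<epsilon> * N y" if "0 < \<epsilon>" "norming N y \<eta>" for \<epsilon> y \<eta>
  proof -
    have "\<eta> \<bullet> ((mat 1 + \<epsilon> *\<^sub>R A) *v y) \<le> matrix_norm N (mat 1 + \<epsilon> *\<^sub>R A) * N y"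
      using normingD(1)[OF that(2)] matrix_norm_upper[OF assms(1)] by (rule order_trans)
    moreover have "\<eta> \<bullet> ((mat 1 + \<epsilon> *\<^sub>R A) *v y) = N y + \<epsilon> * (\<eta> \<bullet> (A *v y))"
      unfolding mv inner_add_right inner_scaleR_right normingD(2)[OF that(2)] ..
    ultimately have "\<epsilon> * (\<eta> \<bullet> (A *v y)) \<le> (matrix_norm N (mat 1 + \<epsilon> *\<^sub>R A) - 1) * N y"
      by (simp add: algebra_simps)
    then show ?thesis using that(1) by (simp add: \<phi>_def field_simps)
  qed
  obtain b :: "real^'n" where b: "b \<noteq> 0" by (metis zero_neq_one)
  then have Nb: "0 < N b"
    using is_norm_ge_0[OF assms(1), of b] is_norm_eq_0[OF assms(1), of b] by linarith
  obtain \<eta> where \<eta>: "norming N b \<eta>" using ex_norming[OF assms(1)] by blast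
  have bdd: "bdd_below (\<phi> ` {0<..})"
    by (rule bdd_belowI2[where m = "\<eta> \<bullet> (A *v b) / N b"])
       (use low[OF _ \<eta>] Nb in \<open>simp add: field_simps\<close>)
  define l where "l = Inf (\<phi> ` {0<..})"
  have "(\<phi> \<longlongrightarrow> l) (at_right 0)"
  proof (rule order_tendstoI)
    fix a assume "a < l"
    have "a < \<phi> \<epsilon>" if "0 < \<epsilon>" for \<epsilon>
      using \<open>a < l\<close> cINF_lower[OF bdd, of \<epsilon>] that unfolding l_def by simp
    then show "\<forall>\<^sub>F \<epsilon> in at_right 0. a < \<phi> \<epsilon>"
      by (simp add: eventually_mono[OF eventually_at_right_less])
  next
    fix a assume "l < a"
    then obtain \<epsilon> where \<epsilon>: "0 < \<epsilon>" "\<phi> \<epsilon> < a"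
      unfolding l_def using cINF_less_iff[OF _ bdd] by fastforce
    then have "\<forall>y>0. y < \<epsilon> \<longrightarrow> \<phi> y < a" using mono by (meson le_less_trans less_imp_le)
    then show "\<forall>\<^sub>F \<epsilon> in at_right 0. \<phi> \<epsilon> < a"
      using \<epsilon>(1) unfolding eventually_at_right_field by blast
  qed
  then have eq: "log_norm N A = l"
    unfolding log_norm_def \<phi>_def by (intro tendsto_Lim) simp_all
  show ?thesis
  proof (cases "N x = 0")
    case True
    then show ?thesis using is_norm_eq_0[OF assms(1), of x] by simp
  next
    case False
    then have pos: "0 < N x" using is_norm_ge_0[OF assms(1), of x] by linarith
    have "\<xi> \<bullet> (A *v x) / N x \<le> l"
      unfolding l_def by (rule cINF_greatest) (use low[OF _ assms(2)] pos in \<open>auto simp: field_simps\<close>)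
    then show ?thesis using pos by (simp add: eq field_simps)
  qed
qed

section \<open>Growth of norms along curves\<close>

text \<open>The derivative of \<open>w\<close> itself need not exist: a differentiable minorant that touches \<open>w\<close> from
  below at \<open>t\<close> bounds the left difference quotients of \<open>w\<close> at \<open>t\<close>. If \<open>w\<close> exceeded
  \<open>w 0\<close>, then a first point at which it exceeds a line of small positive slope would contradict
  this bound.\<close>

lemma nonincreasing_of_touching_minorants:
  fixes w :: "real \<Rightarrow> real"
  assumes cont: "continuous_on {0..T} w" and "0 \<le> T"
    and minorant: "\<And>t. 0 < t \<Longrightarrow> t < T \<Longrightarrow>
      \<exists>p p'. (\<forall>s\<in>{0..t}. p s \<le> w s) \<and> p t = w t \<and> (p has_real_derivative p') (at t) \<and> p' \<le> 0"
  shows "w T \<le> w 0"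
proof (rule ccontr)
  assume "\<not> w T \<le> w 0"
  then have gt: "w 0 < w T" by simp
  then have T: "0 < T" using \<open>0 \<le> T\<close> by (cases "T = 0") auto
  \<comment> \<open>The line of slope \<open>2 * \<epsilon>\<close> starts at \<open>w 0 + \<eta>\<close> and rises by \<open>2 * \<eta>\<close> on \<open>[0, T]\<close>, which uses up
    only three of the four quarters by which \<open>w\<close> increases.\<close>
  define \<epsilon> where "\<epsilon> = (w T - w 0) / (4 * T)"
  define \<eta> where "\<eta> = (w T - w 0) / 4"
  have \<epsilon>: "0 < \<epsilon>" and \<eta>: "0 < \<eta>" using gt T by (auto simp: \<epsilon>_def \<eta>_def)
  define v where "v = (\<lambda>s. w s - 2 * \<epsilon> * s - w 0 - \<eta>)"
  have cv: "continuous_on {0..T} v" unfolding v_def by (intro continuous_intros cont)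
  have v0: "v 0 < 0" using \<eta> by (simp add: v_def)
  have "\<epsilon> * T = \<eta>" using T by (simp add: \<epsilon>_def \<eta>_def)
  then have vT: "0 < v T" using gt by (simp add: v_def \<eta>_def)
  obtain s where s: "0 \<le> s" "s \<le> T" "v s = 0" using IVT'[of v 0 0 T] v0 vT T cv by auto
  define A where "A = {0..T} \<inter> v -` {0}"
  have cA: "closed A" unfolding A_def by (intro continuous_closed_preimage cv) auto
  have bA: "bdd_below A" unfolding A_def by (intro bdd_belowI[of _ 0]) auto
  define t where "t = Inf A"
  have tA: "t \<in> A" unfolding t_def using cA bA s by (intro closed_contains_Inf) (auto simp: A_def)
  then have t: "0 < t" "t < T" "v t = 0"
    using v0 vT by (auto simp: A_def less_le)
  have neg: "v r < 0" if r: "0 \<le> r" "r < t" for r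
  proof (rule ccontr)
    assume "\<not> v r < 0"
    moreover have "continuous_on {0..r} v" by (rule continuous_on_subset[OF cv]) (use that t in auto)
    ultimately obtain z where "0 \<le> z" "z \<le> r" "v z = 0"
      using IVT'[of v 0 0 r] v0 r by auto
    then have "z \<in> A" using that t by (auto simp: A_def)
    then have "t \<le> z" unfolding t_def by (rule cInf_lower[OF _ bA])
    then show False using \<open>z \<le> r\<close> that by simp
  qed
  obtain p p' where p: "\<forall>s\<in>{0..t}. p s \<le> w s" "p t = w t" "(p has_real_derivative p') (at t)" "p' \<le> 0"
    using minorant[OF t(1,2)] by blast
  have "((\<lambda>h. (p (t + h) - p t) / h) \<longlongrightarrow> p') (at 0)" using p(3) by (simp add: DERIV_def)
  then have "\<forall>\<^sub>F h in at 0. (p (t + h) - p t) / h < \<epsilon>"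
    by (rule order_tendstoD) (use p \<epsilon> in simp)
  then obtain d where d: "0 < d" "\<And>h. h \<noteq> 0 \<Longrightarrow> \<bar>h\<bar> < d \<Longrightarrow> (p (t + h) - p t) / h < \<epsilon>"
    unfolding eventually_at by (auto simp: dist_real_def)
  define h where "h = min (d / 2) (t / 2)"
  have h: "0 < h" "h < d" "h < t" using d t by (auto simp: h_def)
  have "(p (t + - h) - p t) / (- h) < \<epsilon>" using h by (intro d(2)) auto
  then have "p t - p (t - h) < \<epsilon> * h" using h by (simp add: field_simps)
  then have "w t - w (t - h) < \<epsilon> * h" using p(1,2) h t by (smt (verit) atLeastAtMost_iff)
  moreover have "v (t - h) < 0" using neg[of "t - h"] h by simp
  then have "w t - w (t - h) > 2 * \<epsilon> * h" using t(3) by (simp add: v_def algebra_simps)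
  moreover have "0 < \<epsilon> * h" using \<epsilon> h by simp
  ultimately show False by simp
qed

text \<open>With the integrating factor \<open>exp (- a s)\<close>, the minorant required above is
  \<open>\<xi> \<bullet> u s - M s\<close>, where \<open>\<xi>\<close> is a norming functional of \<open>u t\<close>: it lies below
  \<open>N (u s) - M s\<close>, with equality at \<open>s = t\<close>.\<close>

lemma norm_comparison:
  fixes N :: "'a::euclidean_space \<Rightarrow> real" and M :: "real \<Rightarrow> real"
  assumes N: "is_norm N" and T: "0 \<le> T" and cont: "continuous_on {0..T} u"
    and deriv: "\<And>t. 0 < t \<Longrightarrow> t < T \<Longrightarrow> (u has_vector_derivative u' t) (at t)"
    and bound: "\<And>t \<xi>. 0 < t \<Longrightarrow> t < T \<Longrightarrow> norming N (u t) \<xi> \<Longrightarrow> \<xi> \<bullet> u' t \<le> a * N (u t) + b"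
    and M: "continuous_on {0..T} M" "\<And>t. 0 < t \<Longrightarrow> t < T \<Longrightarrow> (M has_real_derivative a * M t + b) (at t)"
    and init: "N (u 0) \<le> M 0"
  shows "N (u T) \<le> M T"
proof -
  define w where "w = (\<lambda>s. exp (- a * s) * (N (u s) - M s))"
  have "w T \<le> w 0"
  proof (rule nonincreasing_of_touching_minorants)
    show "continuous_on {0..T} w"
      unfolding w_def by (intro continuous_intros continuous_on_is_norm[OF N] cont M(1))
    fix t assume t: "0 < t" "t < T"
    obtain \<xi> where \<xi>: "norming N (u t) \<xi>" using ex_norming[OF N] by blast
    define p where "p = (\<lambda>s. exp (- a * s) * (\<xi> \<bullet> u s - M s))"
    have du: "((\<lambda>s. \<xi> \<bullet> u s) has_real_derivative \<xi> \<bullet> u' t) (at t)"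
      using bounded_linear.has_vector_derivative[OF bounded_linear_inner_right deriv[OF t]]
      by (simp add: has_real_derivative_iff_has_vector_derivative)
    define p' where "p' = exp (- a * t) * (- a * (\<xi> \<bullet> u t - M t) + (\<xi> \<bullet> u' t - (a * M t + b)))"
    have "(p has_real_derivative p') (at t)"
      unfolding p_def p'_def
      by (rule derivative_eq_intros du M(2) t refl)+ (simp add: algebra_simps)
    moreover have "- a * (\<xi> \<bullet> u t - M t) + (\<xi> \<bullet> u' t - (a * M t + b)) \<le> 0"
      using bound[OF t \<xi>] normingD(2)[OF \<xi>] by (simp add: algebra_simps)
    then have "p' \<le> 0" unfolding p'_def by (simp add: mult_nonneg_nonpos)
    moreover have "\<forall>s\<in>{0..t}. p s \<le> w s" using normingD(1)[OF \<xi>] by (simp add: p_def w_def)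
    moreover have "p t = w t" using normingD(2)[OF \<xi>] by (simp add: p_def w_def)
    ultimately show "\<exists>p p'. (\<forall>s\<in>{0..t}. p s \<le> w s) \<and> p t = w t \<and> (p has_real_derivative p') (at t) \<and> p' \<le> 0"
      by blast
  qed (rule T)
  then have "exp (- a * T) * (N (u T) - M T) \<le> 0" using init by (simp add: w_def)
  then show ?thesis by (simp add: mult_le_0_iff)
qed

text \<open>A priori bounds hold only as long as a curve stays in the region where the vector field is
  controlled. Continuity turns such a conditional bound into an unconditional one.\<close>

lemma stays_in_open:
  fixes z :: "real \<Rightarrow> 'a::topological_space"
  assumes cont: "continuous_on {0..T} z" and "open U" and "z 0 \<in> U"
    and step: "\<And>s. 0 < s \<Longrightarrow> s \<le> T \<Longrightarrow> (\<And>r. 0 \<le> r \<Longrightarrow> r < s \<Longrightarrow> z r \<in> U) \<Longrightarrow> z s \<in> U"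
    and s: "0 \<le> s" "s \<le> T"
  shows "z s \<in> U"
proof (rule ccontr)
  assume "z s \<notin> U"
  define A where "A = {0..T} \<inter> z -` (- U)"
  have cA: "closed A" unfolding A_def using \<open>open U\<close> by (intro continuous_closed_preimage cont) auto
  have bA: "bdd_below A" unfolding A_def by (intro bdd_belowI[of _ 0]) auto
  have "s \<in> A" using \<open>z s \<notin> U\<close> s by (simp add: A_def)
  then have "Inf A \<in> A" using cA bA by (intro closed_contains_Inf) auto
  moreover have "z r \<in> U" if "0 \<le> r" "r < Inf A" for r
    using cInf_lower[OF _ bA, of r] that \<open>Inf A \<in> A\<close> by (force simp: A_def)
  ultimately show False
    using step[of "Inf A"] \<open>z 0 \<in> U\<close> by (cases "Inf A = 0") (auto simp: A_def less_le)
qed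

text \<open>This is the integrated form of the bound \<open>a\<close> on the logarithmic norm of the Jacobian of \<open>h\<close>.\<close>

definition one_sided_lipschitz ::
  "('a::real_inner \<Rightarrow> real) \<Rightarrow> real \<Rightarrow> 'a set \<Rightarrow> ('a \<Rightarrow> 'a) \<Rightarrow> bool" where
  "one_sided_lipschitz N a S h \<longleftrightarrow>
     (\<forall>x\<in>S. \<forall>y\<in>S. \<forall>\<xi>. norming N (x - y) \<xi> \<longrightarrow> \<xi> \<bullet> (h x - h y) \<le> a * N (x - y))"

lemma one_sided_lipschitzD:
  assumes "one_sided_lipschitz N a S h" "x \<in> S" "y \<in> S" "norming N (x - y) \<xi>"
  shows "\<xi> \<bullet> (h x - h y) \<le> a * N (x - y)"
  using assms unfolding one_sided_lipschitz_def by blast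

text \<open>Curves that satisfy a differential equation in the open interval and are continuous up to
  its end points; this is the form in which the closed-loop system provides them.\<close>

definition curve_of :: "('a::real_normed_vector \<Rightarrow> 'a) \<Rightarrow> real \<Rightarrow> (real \<Rightarrow> 'a) \<Rightarrow> bool" where
  "curve_of h T y \<longleftrightarrow>
     continuous_on {0..T} y \<and> (\<forall>s. 0 < s \<longrightarrow> s < T \<longrightarrow> (y has_vector_derivative h (y s)) (at s))"

lemma curve_of_subinterval: "curve_of h T y \<Longrightarrow> S \<le> T \<Longrightarrow> curve_of h S y"
  unfolding curve_of_def by (auto intro: continuous_on_subset)

lemma ivp_solution_subinterval: "ivp_solution h q T y \<Longrightarrow> S \<le> T \<Longrightarrow> ivp_solution h q S y"
  unfolding ivp_solution_def
  by (auto intro: has_vector_derivative_within_subset[where S = "{0..T}"])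

lemma ivp_solution_imp_curve_of: "ivp_solution h q T y \<Longrightarrow> curve_of h T y"
proof -
  assume *: "ivp_solution h q T y"
  then have "continuous_on {0..T} y"
    unfolding ivp_solution_def by (intro continuous_on_vector_derivative) auto
  moreover have "(y has_vector_derivative h (y s)) (at s)" if "0 < s" "s < T" for s
    using * that unfolding ivp_solution_def
    by (metis at_within_Icc_at atLeastAtMost_iff less_imp_le)
  ultimately show ?thesis by (simp add: curve_of_def)
qed

lemma curves_diverge_at_most_exp:
  fixes N :: "'a::euclidean_space \<Rightarrow> real"
  assumes N: "is_norm N" and osl: "one_sided_lipschitz N a U h" and T: "0 \<le> T"
    and y: "curve_of h T y" "\<And>s. 0 < s \<Longrightarrow> s < T \<Longrightarrow> y s \<in> U"
    and z: "curve_of h T z" "\<And>s. 0 < s \<Longrightarrow> s < T \<Longrightarrow> z s \<in> U"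
  shows "N (y T - z T) \<le> exp (a * T) * N (y 0 - z 0)"
proof (rule norm_comparison[OF N T, where u = "\<lambda>s. y s - z s" and u' = "\<lambda>s. h (y s) - h (z s)" and a = a and b = 0
      and M = "\<lambda>s. exp (a * s) * N (y 0 - z 0)"])
  show "continuous_on {0..T} (\<lambda>s. y s - z s)"
    using y z by (intro continuous_intros) (auto simp: curve_of_def)
  show "((\<lambda>s. y s - z s) has_vector_derivative h (y t) - h (z t)) (at t)" if "0 < t" "t < T" for t
    using y z that by (intro derivative_intros) (auto simp: curve_of_def)
  show "\<xi> \<bullet> (h (y t) - h (z t)) \<le> a * N (y t - z t) + 0"
    if "0 < t" "t < T" "norming N (y t - z t) \<xi>" for t \<xi>
    using one_sided_lipschitzD[OF osl] y z that by auto
qed (auto intro!: continuous_intros derivative_eq_intros)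

text \<open>Only one of the two curves is assumed to stay in \<open>U\<close>. The other one cannot leave \<open>U\<close>
  first, because the two agree up to such a time.\<close>

lemma curve_of_unique:
  fixes N :: "'a::euclidean_space \<Rightarrow> real"
  assumes N: "is_norm N" and osl: "one_sided_lipschitz N a U h" and "open U"
    and y: "curve_of h T y" "\<And>s. 0 \<le> s \<Longrightarrow> s < T \<Longrightarrow> y s \<in> U"
    and z: "curve_of h T z" and eq: "y 0 = z 0" and s: "0 \<le> s" "s \<le> T"
  shows "z s = y s"
proof -
  have agree: "z r = y r" if r: "0 \<le> r" "r \<le> T" and zU: "\<And>r'. 0 < r' \<Longrightarrow> r' < r \<Longrightarrow> z r' \<in> U" for r
  proof -
    have "N (y r - z r) \<le> exp (a * r) * N (y 0 - z 0)"
      using curve_of_subinterval[OF y(1)] curve_of_subinterval[OF z] r y(2) zU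
      by (intro curves_diverge_at_most_exp[OF N osl]) auto
    then show ?thesis
      using eq is_norm_ge_0[OF N, of "y r - z r"] is_norm_eq_0[OF N, of "y r - z r"]
      by (simp add: is_norm_zero[OF N])
  qed
  have inU: "z r \<in> U" if r: "0 \<le> r" "r < T" for r
  proof (rule stays_in_open[where T = r and z = z])
    show "continuous_on {0..r} z"
      using z r by (auto simp: curve_of_def intro: continuous_on_subset)
    show "z 0 \<in> U" using y(2)[of 0] eq r by simp
    show "z s \<in> U" if "0 < s" "s \<le> r" "\<And>r. 0 \<le> r \<Longrightarrow> r < s \<Longrightarrow> z r \<in> U" for s
      using agree[of s] y(2)[of s] that r by simp
  qed (use r \<open>open U\<close> in auto)
  show ?thesis using agree[of s] inU s by simp
qed

section \<open>From bounds on the logarithmic norm to one-sided bounds on the vector field\<close>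

text \<open>Along the segment from \<open>y\<close> to \<open>x\<close> the function \<open>\<xi> \<bullet> h\<close> has the derivative
  \<open>\<xi> \<bullet> (Dh (x - y))\<close>, which the logarithmic norm bounds; the mean value theorem does the rest.\<close>

lemma one_sided_lipschitz_of_log_norm:
  fixes N :: "real^'n \<Rightarrow> real" and h :: "real^'n \<Rightarrow> real^'n"
  assumes N: "is_norm N" and "convex S"
    and diff: "\<And>x. x \<in> S \<Longrightarrow> h differentiable (at x)"
    and bound: "\<And>x. x \<in> S \<Longrightarrow> log_norm N (jacobian h (at x)) \<le> a"
  shows "one_sided_lipschitz N a S h"
  unfolding one_sided_lipschitz_def
proof (intro ballI allI impI)
  fix x y \<xi> assume xy: "x \<in> S" "y \<in> S" and \<xi>: "norming N (x - y) \<xi>"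
  define \<phi> where "\<phi> = (\<lambda>s. \<xi> \<bullet> h (y + s *\<^sub>R (x - y)))"
  define \<phi>' where "\<phi>' = (\<lambda>s. \<xi> \<bullet> (jacobian h (at (y + s *\<^sub>R (x - y))) *v (x - y)))"
  have inS: "y + s *\<^sub>R (x - y) \<in> S" if "0 \<le> s" "s \<le> 1" for s
    using convexD_alt[OF \<open>convex S\<close> xy(2,1) that] by (simp add: algebra_simps)
  have deriv: "(\<phi> has_real_derivative \<phi>' s) (at s)" if s: "0 \<le> s" "s \<le> 1" for s
  proof -
    have 1: "(h has_derivative (\<lambda>v. jacobian h (at (y + s *\<^sub>R (x - y))) *v v)) (at (y + s *\<^sub>R (x - y)))"
      using diff[OF inS[OF s]] by (simp add: jacobian_works)
    have 2: "((\<lambda>s. y + s *\<^sub>R (x - y)) has_vector_derivative (x - y)) (at s)"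
      by (auto intro!: derivative_eq_intros)
    have "((\<lambda>s. h (y + s *\<^sub>R (x - y))) has_vector_derivative jacobian h (at (y + s *\<^sub>R (x - y))) *v (x - y)) (at s)"
      using vector_derivative_diff_chain_within[OF 2 has_derivative_at_withinI[OF 1]] by (simp add: o_def)
    from bounded_linear.has_vector_derivative[OF bounded_linear_inner_right this, of \<xi>]
    show ?thesis by (simp add: \<phi>_def \<phi>'_def has_real_derivative_iff_has_vector_derivative)
  qed
  obtain s where s: "0 < s" "s < 1" "\<phi> 1 - \<phi> 0 = (1 - 0) * \<phi>' s"
    using MVT2[of 0 1 \<phi> \<phi>'] deriv by auto
  have "\<phi>' s \<le> log_norm N (jacobian h (at (y + s *\<^sub>R (x - y)))) * N (x - y)"
    unfolding \<phi>'_def by (rule norming_matrix_le_log_norm[OF N \<xi>])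
  also have "\<dots> \<le> a * N (x - y)"
    using bound[OF inS] s is_norm_ge_0[OF N] by (intro mult_right_mono) auto
  finally show "\<xi> \<bullet> (h x - h y) \<le> a * N (x - y)"
    using s(3) by (simp add: \<phi>_def inner_diff_right)
qed

text \<open>Let \<open>E\<close> be the exceptional null set. Its image under the locally Lipschitz function is a
  null set too, hence some value between \<open>\<phi> a\<close> and \<open>\<phi> b\<close> is not attained in
  \<open>E\<close>. At the last point where this value is attained the derivative is nonnegative.\<close>

lemma decreasing_of_negative_derivative_ae:
  fixes \<phi> :: "real \<Rightarrow> real"
  assumes "a \<le> b" and cont: "continuous_on {a..b} \<phi>" and E: "negligible E"
    and lips: "\<And>s. s \<in> {a..b} \<Longrightarrow> \<exists>T B. open T \<and> s \<in> T \<and> (\<forall>r\<in>{a..b} \<inter> T. \<bar>\<phi> r - \<phi> s\<bar> \<le> B * \<bar>r - s\<bar>)"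
    and deriv: "\<And>s. a < s \<Longrightarrow> s < b \<Longrightarrow> s \<notin> E \<Longrightarrow> \<exists>d<0. (\<phi> has_real_derivative d) (at s)"
  shows "\<phi> b \<le> \<phi> a"
proof (rule ccontr)
  assume "\<not> \<phi> b \<le> \<phi> a"
  then have gt: "\<phi> a < \<phi> b" by simp
  have "negligible (\<phi> ` (E \<inter> {a..b}))"
  proof (rule negligible_locally_Lipschitz_image)
    show "negligible (E \<inter> {a..b})" using E by (rule negligible_subset) auto
    show "\<exists>T B. open T \<and> x \<in> T \<and> (\<forall>y\<in>E \<inter> {a..b} \<inter> T. norm (\<phi> y - \<phi> x) \<le> B * norm (y - x))"
      if "x \<in> E \<inter> {a..b}" for x
      using lips[of x] that by (force simp: real_norm_def)
  qed simp
  moreover have "\<not> negligible {\<phi> a<..<\<phi> b}"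
    using gt by (simp add: open_not_negligible)
  ultimately obtain v where v: "\<phi> a < v" "v < \<phi> b" "v \<notin> \<phi> ` (E \<inter> {a..b})"
    using negligible_subset by (metis greaterThanLessThan_iff subsetI)
  define A where "A = {a..b} \<inter> \<phi> -` {v}"
  have cA: "closed A" unfolding A_def by (intro continuous_closed_preimage cont) auto
  have bA: "bdd_above A" unfolding A_def by (intro bdd_aboveI[of _ b]) auto
  obtain r where "a \<le> r" "r \<le> b" "\<phi> r = v" using IVT'[of \<phi> a v b] v \<open>a \<le> b\<close> cont by auto
  then have "A \<noteq> {}" by (auto simp: A_def)
  define t where "t = Sup A"
  have tA: "t \<in> A" unfolding t_def using cA bA \<open>A \<noteq> {}\<close> by (intro closed_contains_Sup)
  then have t: "a < t" "t < b" "\<phi> t = v" "t \<notin> E"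
    using v by (auto simp: A_def less_le)
  have above: "v < \<phi> r" if r: "t < r" "r \<le> b" for r
  proof (rule ccontr)
    assume "\<not> v < \<phi> r"
    moreover have "continuous_on {r..b} \<phi>" by (rule continuous_on_subset[OF cont]) (use r t in auto)
    ultimately obtain z where "r \<le> z" "z \<le> b" "\<phi> z = v"
      using IVT'[of \<phi> r v b] v r by auto
    then have "z \<in> A" using r t by (auto simp: A_def)
    then have "z \<le> t" unfolding t_def by (rule cSup_upper[OF _ bA])
    then show False using \<open>r \<le> z\<close> r by simp
  qed
  obtain d where d: "d < 0" "(\<phi> has_real_derivative d) (at t)" using deriv[OF t(1,2,4)] by blast
  obtain \<delta> where \<delta>: "0 < \<delta>" "\<And>h. 0 < h \<Longrightarrow> h < \<delta> \<Longrightarrow> \<phi> (t + h) < \<phi> t"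
    using DERIV_neg_dec_right[OF d(2,1)] by blast
  define h where "h = min (\<delta> / 2) (b - t)"
  have "0 < h" "h < \<delta>" "t + h \<le> b" using \<delta> t by (auto simp: h_def)
  then show False using \<delta>(2)[of h] above[of "t + h"] t(3) by simp
qed

text \<open>For fixed \<open>s\<close> the set of all \<open>w\<close> with \<open>w + s *\<^sub>R x \<in> E\<close> is a translate of \<open>E\<close>; Fubini's theorem
  exchanges the roles of \<open>w\<close> and \<open>s\<close>. For this, \<open>E\<close> is first enlarged to a Borel null set.\<close>

lemma negligible_on_translated_segments:
  fixes E :: "'a::euclidean_space set" and x :: 'a
  assumes "negligible E"
  shows "AE w in lborel. negligible {s::real. w + s *\<^sub>R x \<in> E}"
proof -
  have "E \<in> null_sets lebesgue" using assms by (simp add: negligible_iff_null_sets)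
  then obtain E' where E': "E' \<in> null_sets lborel" "E \<subseteq> E'"
    using null_sets_completion_iff2 by metis
  have meas: "{p \<in> space (lborel \<Otimes>\<^sub>M lborel). fst p + snd p *\<^sub>R x \<notin> E'} \<in> sets (lborel \<Otimes>\<^sub>M lborel)"
  proof -
    have [measurable]: "E' \<in> sets borel" using E' by auto
    have "(\<lambda>p. fst p + snd p *\<^sub>R x) \<in> borel_measurable (lborel \<Otimes>\<^sub>M lborel)" by measurable
    then show ?thesis by measurable
  qed
  have "AE w in lborel. w + s *\<^sub>R x \<notin> E'" for s :: real
  proof -
    have "{w. w - (- (s *\<^sub>R x)) \<in> E'} \<in> null_sets lborel"
      by (rule null_sets_translation[OF E'(1)])
    then have "{w. w + s *\<^sub>R x \<in> E'} \<in> null_sets lborel" by simp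
    then show ?thesis by (rule AE_I') auto
  qed
  then have "AE s in lborel. AE w in lborel. w + s *\<^sub>R x \<notin> E'" by simp
  then have "AE w in lborel. AE s in lborel. w + s *\<^sub>R x \<notin> E'"
    using lborel_pair.AE_commute[of "\<lambda>w (s::real). w + s *\<^sub>R x \<notin> E'"] meas by simp
  then show ?thesis
  proof (eventually_elim)
    case (elim w)
    then have "AE s in lebesgue. s \<notin> {s. w + s *\<^sub>R x \<in> E'}" by (simp add: AE_completion)
    then have "negligible {s. w + s *\<^sub>R x \<in> E'}"
      by (simp add: completion.AE_iff_null_sets AE_iff_null_sets negligible_iff_null_sets)
    then show ?case by (rule negligible_subset) (use E' in auto)
  qed
qed

text \<open>Here differentiability is only available almost everywhere, and a given segment may lie entirely
  in the exceptional set. Almost every small translate of the segment does not, so the estimate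
  holds there and carries over to the given segment by continuity.\<close>

lemma one_sided_lipschitz_of_log_norm_ae:
  fixes N :: "real^'n \<Rightarrow> real" and h :: "real^'n \<Rightarrow> real^'n"
  assumes N: "is_norm N" and "convex S" "open S"
    and lip: "local_lipschitz (UNIV :: real set) S (\<lambda>_. h)"
    and ae: "AE x in lebesgue. x \<in> S \<longrightarrow> h differentiable (at x) \<and> log_norm N (jacobian h (at x)) \<le> a"
  shows "one_sided_lipschitz N a S h"
  unfolding one_sided_lipschitz_def
proof (intro ballI allI impI)
  fix x y \<xi> assume xy: "x \<in> S" "y \<in> S" and \<xi>: "norming N (x - y) \<xi>"
  define v where "v = x - y"
  define \<Phi> where "\<Phi> = (\<lambda>w. \<xi> \<bullet> (h (w + v) - h w))"
  have conth: "continuous_on S h"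
    using local_lipschitz_continuous_on[OF lip] by simp
  have isCont_h: "isCont h z" if "z \<in> S" for z
    using conth \<open>open S\<close> that continuous_on_eq_continuous_at by blast
  define E where "E = {z \<in> S. \<not> (h differentiable (at z) \<and> log_norm N (jacobian h (at z)) \<le> a)}"
  have "negligible E"
  proof -
    obtain Z where "Z \<in> null_sets lebesgue"
      "{x \<in> space lebesgue. \<not> (x \<in> S \<longrightarrow> h differentiable (at x) \<and> log_norm N (jacobian h (at x)) \<le> a)} \<subseteq> Z"
      using ae unfolding eventually_ae_filter by blast
    then show "negligible E" by (intro negligible_subset[of Z E]) (auto simp: negligible_iff_null_sets E_def)
  qed
  note seg = negligible_on_translated_segments[OF this, of v]
  show "\<xi> \<bullet> (h x - h y) \<le> a * N (x - y)"
  proof (rule ccontr)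
    assume "\<not> ?thesis"
    then have gt: "a * N v < \<Phi> y" by (simp add: \<Phi>_def v_def)
    \<comment> \<open>The slope \<open>K\<close> is subtracted below; being larger than \<open>a * N v\<close>, it makes the derivative negative
      almost everywhere on a good translate, and being smaller than \<open>\<Phi> y\<close>, it leaves a contradiction
      on all translates close to the given segment.\<close>
    define K where "K = (a * N v + \<Phi> y) / 2"
    have K: "a * N v < K" "K < \<Phi> y" using gt by (auto simp: K_def)
    have "isCont \<Phi> y"
      unfolding \<Phi>_def using xy isCont_h[of x] isCont_h[of y]
      by (intro continuous_intros isCont_o2[of _ "\<lambda>w. w + v" h]) (auto simp: v_def)
    then have "\<forall>\<^sub>F w in nhds y. K < \<Phi> w"
      using K(2) by (intro order_tendstoD) (auto simp: isCont_def tendsto_at_iff_tendsto_nhds)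
    moreover have "\<forall>\<^sub>F w in nhds y. w \<in> S" using \<open>open S\<close> xy by (simp add: eventually_nhds_in_open)
    moreover have "\<forall>\<^sub>F w in nhds y. w + v \<in> S"
    proof -
      have "((\<lambda>w. w + v) \<longlongrightarrow> y + v) (nhds y)" by (intro tendsto_intros filterlim_ident)
      then show ?thesis by (rule topological_tendstoD) (use xy \<open>open S\<close> in \<open>auto simp: v_def\<close>)
    qed
    ultimately have "\<forall>\<^sub>F w in nhds y. K < \<Phi> w \<and> w \<in> S \<and> w + v \<in> S" by eventually_elim simp
    then obtain U where U: "open U" "y \<in> U" "\<And>w. w \<in> U \<Longrightarrow> K < \<Phi> w \<and> w \<in> S \<and> w + v \<in> S"
      unfolding eventually_nhds by blast
    have "\<exists>w\<in>U. negligible {s::real. w + s *\<^sub>R v \<in> E}"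
    proof (rule ccontr)
      assume "\<not> ?thesis"
      with seg have "AE w in lborel. w \<notin> U" by (auto elim!: eventually_mono)
      then have "U \<in> null_sets lborel" using U(1) by (subst AE_iff_null_sets) auto
      then have "negligible U" unfolding negligible_iff_null_sets by (rule null_sets_completionI)
      then show False using open_not_negligible U(1,2) by blast
    qed
    then obtain w where w: "w \<in> U" "negligible {s::real. w + s *\<^sub>R v \<in> E}" by blast
    have inS: "w + s *\<^sub>R v \<in> S" if "s \<in> {0..1}" for s
    proof -
      have "(1 - s) *\<^sub>R w + s *\<^sub>R (w + v) \<in> S"
        using convexD_alt[OF \<open>convex S\<close>, of w "w + v" s] U(3)[OF w(1)] that by simp
      then show ?thesis by (simp add: algebra_simps)
    qed
    define \<phi> where "\<phi> = (\<lambda>s. \<xi> \<bullet> h (w + s *\<^sub>R v) - K * s)"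
    have "\<phi> 1 \<le> \<phi> 0"
    proof (rule decreasing_of_negative_derivative_ae[where \<phi> = \<phi>, OF _ _ w(2)])
      have "continuous_on {0..1} (\<lambda>s. h (w + s *\<^sub>R v))"
        by (rule continuous_on_compose2[OF conth]) (auto intro!: continuous_intros inS)
      then show "continuous_on {0..1} \<phi>" unfolding \<phi>_def by (intro continuous_intros)
    next
      fix s :: real assume s: "s \<in> {0..1}"
      obtain u L where u: "0 < u"
        and lipL: "\<And>r::real. r \<in> cball 0 u \<inter> UNIV \<Longrightarrow> L-lipschitz_on (cball (w + s *\<^sub>R v) u \<inter> S) h"
        using local_lipschitzE[OF lip UNIV_I inS[OF s], of 0] by metis
      from lipL[of 0] u have L: "0 \<le> L" "\<And>p q. p \<in> cball (w + s *\<^sub>R v) u \<inter> S \<Longrightarrow> q \<in> cball (w + s *\<^sub>R v) u \<inter> S \<Longrightarrow> norm (h p - h q) \<le> L * norm (p - q)"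
        by (auto simp: lipschitz_on_def dist_norm)
      define T where "T = ball s (u / (norm v + 1))"
      have "\<bar>\<phi> r - \<phi> s\<bar> \<le> (norm \<xi> * (L * norm v) + \<bar>K\<bar>) * \<bar>r - s\<bar>" if r: "r \<in> {0..1} \<inter> T" for r
      proof -
        have diff: "(w + r *\<^sub>R v) - (w + s *\<^sub>R v) = (r - s) *\<^sub>R v" by (simp add: algebra_simps)
        have "norm ((r - s) *\<^sub>R v) \<le> \<bar>r - s\<bar> * (norm v + 1)" by (simp add: mult_left_mono)
        also have "\<dots> \<le> (u / (norm v + 1)) * (norm v + 1)"
          using r by (intro mult_right_mono) (auto simp: T_def dist_real_def)
        also have "\<dots> = u" by (simp add: add_nonneg_eq_0_iff)
        finally have "w + r *\<^sub>R v \<in> cball (w + s *\<^sub>R v) u \<inter> S"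
          using inS r diff by (simp add: dist_norm norm_minus_commute)
        then have "norm (h (w + r *\<^sub>R v) - h (w + s *\<^sub>R v)) \<le> L * norm ((w + r *\<^sub>R v) - (w + s *\<^sub>R v))"
          using inS[OF s] u by (intro L(2)) auto
        also have "\<dots> = L * norm v * \<bar>r - s\<bar>" by (simp only: diff) simp
        finally have "norm \<xi> * norm (h (w + r *\<^sub>R v) - h (w + s *\<^sub>R v)) \<le> norm \<xi> * (L * norm v * \<bar>r - s\<bar>)"
          by (simp add: mult_left_mono)
        then have "\<bar>\<xi> \<bullet> (h (w + r *\<^sub>R v) - h (w + s *\<^sub>R v))\<bar> \<le> norm \<xi> * (L * norm v * \<bar>r - s\<bar>)"
          using Cauchy_Schwarz_ineq2 order_trans by blast
        moreover have "\<phi> r - \<phi> s = \<xi> \<bullet> (h (w + r *\<^sub>R v) - h (w + s *\<^sub>R v)) - K * (r - s)"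
          by (simp add: \<phi>_def inner_diff_right algebra_simps)
        moreover have "\<bar>K * (r - s)\<bar> = \<bar>K\<bar> * \<bar>r - s\<bar>" by (rule abs_mult)
        ultimately show ?thesis by (simp add: distrib_right mult.assoc)
      qed
      moreover have "s \<in> T" "open T" using u by (auto simp: T_def add_nonneg_pos)
      ultimately show "\<exists>T B. open T \<and> s \<in> T \<and> (\<forall>r\<in>{0..1} \<inter> T. \<bar>\<phi> r - \<phi> s\<bar> \<le> B * \<bar>r - s\<bar>)" by blast
    next
      fix s :: real assume s: "0 < s" "s < 1" "s \<notin> {s. w + s *\<^sub>R v \<in> E}"
      define J where "J = jacobian h (at (w + s *\<^sub>R v))"
      have good: "h differentiable (at (w + s *\<^sub>R v))" "log_norm N J \<le> a"
        using s inS[of s] by (auto simp: E_def J_def)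
      have 1: "(h has_derivative (\<lambda>z. J *v z)) (at (w + s *\<^sub>R v))"
        using good(1) by (simp add: jacobian_works J_def)
      have 2: "((\<lambda>s. w + s *\<^sub>R v) has_vector_derivative v) (at s)"
        by (auto intro!: derivative_eq_intros)
      have "((\<lambda>s. h (w + s *\<^sub>R v)) has_vector_derivative J *v v) (at s)"
        using vector_derivative_diff_chain_within[OF 2 has_derivative_at_withinI[OF 1]] by (simp add: o_def)
      from bounded_linear.has_vector_derivative[OF bounded_linear_inner_right this, of \<xi>]
      have "((\<lambda>s. \<xi> \<bullet> h (w + s *\<^sub>R v)) has_real_derivative \<xi> \<bullet> (J *v v)) (at s)"
        by (simp add: has_real_derivative_iff_has_vector_derivative)
      then have "(\<phi> has_real_derivative \<xi> \<bullet> (J *v v) - K) (at s)"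
        unfolding \<phi>_def by (auto intro!: derivative_eq_intros)
      moreover have "\<xi> \<bullet> (J *v v) \<le> log_norm N J * N v"
        using norming_matrix_le_log_norm[OF N] \<xi> unfolding v_def by blast
      moreover have "log_norm N J * N v \<le> a * N v"
        using good(2) is_norm_ge_0[OF N] by (rule mult_right_mono)
      ultimately show "\<exists>d<0. (\<phi> has_real_derivative d) (at s)" using K(1) by force
    qed simp
    then have "\<Phi> w \<le> K" by (simp add: \<phi>_def \<Phi>_def inner_diff_right)
    then show False using U(3)[OF w(1)] by simp
  qed
qed

section \<open>Existence of solutions\<close>

text \<open>Tonelli's approximations of a solution: the integral equation is delayed by \<open>\<epsilon>\<close>, so that \<open>n\<close>
  iterations determine its solution on \<open>[0, n \<epsilon>]\<close>. For \<open>t \<le> \<epsilon>\<close> the interval of integration is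
  empty or a point, and the value is \<open>q\<close>.\<close>

primrec delayed_iterate :: "('a::euclidean_space \<Rightarrow> 'a) \<Rightarrow> 'a \<Rightarrow> real \<Rightarrow> nat \<Rightarrow> real \<Rightarrow> 'a" where
  "delayed_iterate h q \<epsilon> 0 = (\<lambda>t. q)"
| "delayed_iterate h q \<epsilon> (Suc n) = (\<lambda>t. q + integral {0..t - \<epsilon>} (\<lambda>s. h (delayed_iterate h q \<epsilon> n s)))"

lemma delayed_iterate_lipschitz:
  fixes h :: "'a::euclidean_space \<Rightarrow> 'a"
  assumes h: "continuous_on UNIV h" and M: "\<And>x. norm (h x) \<le> M"
  shows "norm (delayed_iterate h q \<epsilon> n t - delayed_iterate h q \<epsilon> n s) \<le> M * \<bar>t - s\<bar>"
proof (induction n arbitrary: s t)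
  case 0
  then show ?case using order_trans[OF norm_ge_zero M] by simp
next
  case (Suc n)
  let ?y = "delayed_iterate h q \<epsilon> n"
  have M0: "0 \<le> M" using order_trans[OF norm_ge_zero M] .
  have "M-lipschitz_on UNIV ?y"
    using Suc.IH M0 by (intro lipschitz_onI) (auto simp: dist_norm)
  then have "continuous_on UNIV ?y" by (rule lipschitz_on_continuous_on)
  then have cont: "continuous_on A (\<lambda>s. h (?y s))" for A
    by (intro continuous_on_compose2[OF h]) (auto intro: continuous_on_subset)
  have le: "norm (integral {0..b} (\<lambda>s. h (?y s)) - integral {0..a} (\<lambda>s. h (?y s))) \<le> M * (b - a)"
    if ab: "a \<le> b" for a b
  proof (cases "a \<le> 0")
    case True
    then have "integral {0..a} (\<lambda>s. h (?y s)) = 0" by (cases "a = 0") auto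
    moreover have "norm (integral {0..b} (\<lambda>s. h (?y s))) \<le> M * (b - a)"
    proof (cases "0 \<le> b")
      case True
      have "norm (integral {0..b} (\<lambda>s. h (?y s))) \<le> M * (b - 0)"
        using True cont M by (intro integral_bound) auto
      also have "\<dots> \<le> M * (b - a)" using M0 \<open>a \<le> 0\<close> by (intro mult_left_mono) auto
      finally show ?thesis .
    qed (use M0 ab in simp)
    ultimately show ?thesis by simp
  next
    case False
    then have "integral {0..a} (\<lambda>s. h (?y s)) + integral {a..b} (\<lambda>s. h (?y s)) = integral {0..b} (\<lambda>s. h (?y s))"
      using ab cont by (intro Henstock_Kurzweil_Integration.integral_combine integrable_continuous_real) auto
    then have "integral {0..b} (\<lambda>s. h (?y s)) - integral {0..a} (\<lambda>s. h (?y s)) = integral {a..b} (\<lambda>s. h (?y s))"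
      by (simp add: algebra_simps)
    then show ?thesis using ab cont M integral_bound[of a b "\<lambda>s. h (?y s)" M] by simp
  qed
  show ?case
  proof (cases "s \<le> t")
    case True
    then show ?thesis using le[of "s - \<epsilon>" "t - \<epsilon>"] by simp
  next
    case False
    then show ?thesis using le[of "t - \<epsilon>" "s - \<epsilon>"] by (simp add: norm_minus_commute)
  qed
qed

lemma delayed_iterate_stable:
  assumes "0 < \<epsilon>" "t \<le> real n * \<epsilon>"
  shows "delayed_iterate h q \<epsilon> (Suc n) t = delayed_iterate h q \<epsilon> n t"
  using assms(2)
proof (induction n arbitrary: t)
  case 0
  then show ?case using assms(1) by (cases "t = \<epsilon>") auto
next
  case (Suc n)
  have "integral {0..t - \<epsilon>} (\<lambda>s. h (delayed_iterate h q \<epsilon> (Suc n) s))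
      = integral {0..t - \<epsilon>} (\<lambda>s. h (delayed_iterate h q \<epsilon> n s))"
  proof (rule Henstock_Kurzweil_Integration.integral_cong)
    fix s assume "s \<in> {0..t - \<epsilon>}"
    then have "s \<le> real n * \<epsilon>" using Suc.prems by (simp add: algebra_simps)
    then show "h (delayed_iterate h q \<epsilon> (Suc n) s) = h (delayed_iterate h q \<epsilon> n s)"
      by (simp only: Suc.IH)
  qed
  then show ?case by simp
qed

text \<open>Peano's theorem. A limit of delayed solutions with vanishing delay, which exists by the
  Arzela-Ascoli theorem, satisfies the integral equation without delay.\<close>

lemma peano_existence:
  fixes h :: "'a::euclidean_space \<Rightarrow> 'a"
  assumes h: "continuous_on UNIV h" and M: "\<And>x. norm (h x) \<le> M" and T: "0 \<le> T"
  obtains y where "ivp_solution h q T y"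
proof -
  have M0: "0 \<le> M" using order_trans[OF norm_ge_zero M] .
  define \<epsilon> where "\<epsilon> = (\<lambda>n. (T + 1) / real (Suc n))"
  have \<epsilon>: "0 < \<epsilon> n" "T \<le> real (Suc n) * \<epsilon> n" for n using T by (auto simp: \<epsilon>_def)
  define \<F> where "\<F> = (\<lambda>n. delayed_iterate h q (\<epsilon> n) (Suc n))"
  have lip: "norm (\<F> n t - \<F> n s) \<le> M * \<bar>t - s\<bar>" for n t s
    unfolding \<F>_def by (rule delayed_iterate_lipschitz[OF h M])
  have eq: "\<F> n t = q + integral {0..t - \<epsilon> n} (\<lambda>s. h (\<F> n s))" if "t \<le> T" for n t
    using delayed_iterate_stable[OF \<epsilon>(1), of t "Suc n" n h q] \<epsilon>(2)[of n] that unfolding \<F>_def by simp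
  have F0: "\<F> n 0 = q" for n using eq[of 0 n] \<epsilon>(1)[of n] T by simp
  have contF: "continuous_on A (\<F> n)" for n A
    using lip M0 by (intro lipschitz_on_continuous_on[of M] lipschitz_onI) (auto simp: dist_norm)
  have bounded: "norm (\<F> n t) \<le> norm q + M * T" if "t \<in> {0..T}" for n t
  proof -
    have "norm (\<F> n t) \<le> norm q + norm (\<F> n t - \<F> n 0)"
      using norm_triangle_sub[of "\<F> n t" q] by (simp add: F0)
    also have "norm (\<F> n t - \<F> n 0) \<le> M * \<bar>t - 0\<bar>" by (rule lip)
    also have "\<dots> \<le> M * T" using that M0 by (intro mult_left_mono) auto
    finally show ?thesis by simp
  qed
  have equicont: "\<exists>d>0. \<forall>n s. s \<in> {0..T} \<and> norm (t - s) < d \<longrightarrow> norm (\<F> n t - \<F> n s) < e"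
    if "0 < e" for t e
  proof (intro exI[of _ "e / (M + 1)"] conjI allI impI)
    fix n s assume "s \<in> {0..T} \<and> norm (t - s) < e / (M + 1)"
    then have "\<bar>t - s\<bar> * (M + 1) < e" using M0 by (simp add: pos_less_divide_eq)
    moreover have "M * \<bar>t - s\<bar> \<le> \<bar>t - s\<bar> * (M + 1)" by (simp add: algebra_simps)
    ultimately show "norm (\<F> n t - \<F> n s) < e" using lip[of n t s] by linarith
  qed (use that M0 in simp)
  obtain y k where y: "continuous_on {0..T} y" and k: "strict_mono (k :: nat \<Rightarrow> nat)"
    and lim: "\<And>e. 0 < e \<Longrightarrow> \<exists>N. \<forall>n t. n \<ge> N \<and> t \<in> {0..T} \<longrightarrow> norm (\<F> (k n) t - y t) < e"
  proof (rule Arzela_Ascoli[of "{0..T}" \<F> "norm q + M * T"])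
    show "compact {0..T}" by simp
    show "norm (\<F> n t) \<le> norm q + M * T" if "t \<in> {0..T}" for n t by (rule bounded[OF that])
    show "\<exists>d>0. \<forall>n s. s \<in> {0..T} \<and> norm (t - s) < d \<longrightarrow> norm (\<F> n t - \<F> n s) < e"
      if "t \<in> {0..T}" "0 < e" for t e by (rule equicont[OF that(2)])
  qed (rule that)
  have unif: "uniform_limit {0..T} (\<lambda>n. \<F> (k n)) y sequentially"
    unfolding uniform_limit_sequentially_iff dist_norm using lim by meson
  have Flim: "(\<lambda>n. \<F> (k n) t) \<longlonglongrightarrow> y t" if "t \<in> {0..T}" for t
    using tendsto_uniform_limitI[OF unif that] .
  have integral_eq: "y t = q + integral {0..t} (\<lambda>s. h (y s))" if t: "t \<in> {0..T}" for t
  proof -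
    have "(\<lambda>n. integral {0..t} (\<lambda>s. h (\<F> (k n) s))) \<longlonglongrightarrow> integral {0..t} (\<lambda>s. h (y s))"
    proof (rule dominated_convergence(2)[where h = "\<lambda>_. M"])
      show "(\<lambda>s. h (\<F> (k n) s)) integrable_on {0..t}" for n
        by (intro integrable_continuous_real continuous_on_compose2[OF h contF]) auto
      show "(\<lambda>n. h (\<F> (k n) s)) \<longlonglongrightarrow> h (y s)" if "s \<in> {0..t}" for s
        using that t by (intro continuous_on_tendsto_compose[OF h Flim]) auto
    qed (use M in auto)
    then have "(\<lambda>n. q + integral {0..t} (\<lambda>s. h (\<F> (k n) s))) \<longlonglongrightarrow> q + integral {0..t} (\<lambda>s. h (y s))"
      by (intro tendsto_intros)
    moreover have "(\<lambda>n. q + integral {0..t} (\<lambda>s. h (\<F> (k n) s)) - \<F> (k n) t) \<longlonglongrightarrow> 0"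
    proof (rule Lim_null_comparison)
      have "norm (q + integral {0..t} (\<lambda>s. h (\<F> n s)) - \<F> n t) \<le> M * \<epsilon> n" for n
      proof -
        let ?g = "\<lambda>s. h (\<F> n s)"
        have int: "?g integrable_on {a..b}" for a b
          by (intro integrable_continuous_real continuous_on_compose2[OF h contF]) auto
        show ?thesis
        proof (cases "\<epsilon> n \<le> t")
          case True
          then have "integral {0..t - \<epsilon> n} ?g + integral {t - \<epsilon> n..t} ?g = integral {0..t} ?g"
            using \<epsilon>(1)[of n] by (intro Henstock_Kurzweil_Integration.integral_combine int) auto
          then have "q + integral {0..t} ?g - \<F> n t = integral {t - \<epsilon> n..t} ?g"
            using eq[of t n] t by (simp add: algebra_simps)
          moreover have "norm (integral {t - \<epsilon> n..t} ?g) \<le> M * (t - (t - \<epsilon> n))"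
            using \<epsilon>(1)[of n] M by (intro integral_bound continuous_on_compose2[OF h contF]) auto
          ultimately show ?thesis by simp
        next
          case False
          then have "q + integral {0..t} ?g - \<F> n t = integral {0..t} ?g"
            using eq[of t n] t by simp
          moreover have "norm (integral {0..t} ?g) \<le> M * (t - 0)"
            using t M by (intro integral_bound continuous_on_compose2[OF h contF]) auto
          moreover have "M * t \<le> M * \<epsilon> n" using False M0 by (intro mult_left_mono) auto
          ultimately show ?thesis by simp
        qed
      qed
      then show "\<forall>\<^sub>F n in sequentially. norm (q + integral {0..t} (\<lambda>s. h (\<F> (k n) s)) - \<F> (k n) t) \<le> M * \<epsilon> (k n)"
        by simp
      have "(\<lambda>n. (T + 1) * inverse (real (Suc n))) \<longlonglongrightarrow> (T + 1) * 0"
        by (intro tendsto_intros LIMSEQ_inverse_real_of_nat)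
      then have "\<epsilon> \<longlonglongrightarrow> 0" by (simp add: \<epsilon>_def divide_inverse)
      then have "(\<lambda>n. \<epsilon> (k n)) \<longlonglongrightarrow> 0"
        using LIMSEQ_subseq_LIMSEQ[OF _ k] by (simp add: o_def)
      then show "(\<lambda>n. M * \<epsilon> (k n)) \<longlonglongrightarrow> 0" by (rule tendsto_mult_right_zero)
    qed
    ultimately have "(\<lambda>n. \<F> (k n) t) \<longlonglongrightarrow> q + integral {0..t} (\<lambda>s. h (y s))"
      using tendsto_diff by fastforce
    then show ?thesis using LIMSEQ_unique Flim[OF t] by blast
  qed
  have conthy: "continuous_on {0..T} (\<lambda>s. h (y s))" by (intro continuous_on_compose2[OF h y]) auto
  have "ivp_solution h q T y"
    unfolding ivp_solution_def
  proof (intro conjI ballI)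
    show "y 0 = q" using integral_eq[of 0] T by simp
    fix s assume s: "s \<in> {0..T}"
    have "((\<lambda>u. integral {0..u} (\<lambda>s. h (y s))) has_vector_derivative h (y s)) (at s within {0..T})"
      by (rule integral_has_vector_derivative[OF conthy s])
    then have "((\<lambda>u. q + integral {0..u} (\<lambda>s. h (y s))) has_vector_derivative h (y s)) (at s within {0..T})"
      by (auto intro!: derivative_eq_intros)
    then show "(y has_vector_derivative h (y s)) (at s within {0..T})"
      by (rule has_vector_derivative_transform[OF s, rotated]) (use integral_eq in auto)
  qed
  then show ?thesis by (rule that)
qed

text \<open>Peano's theorem applies to the vector field composed with the projection to a closed ball; the
  composition is bounded, and it agrees with the vector field as long as the solution stays in that
  ball.\<close>

lemma solution_until_exit:
  fixes h :: "'a::euclidean_space \<Rightarrow> 'a"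
  assumes N: "is_norm N" and h: "continuous_on UNIV h" and q: "N q < r" and T: "0 < T"
  obtains z \<tau> where "0 < \<tau>" "\<tau> \<le> T" "ivp_solution h q \<tau> z"
    "\<And>s. 0 \<le> s \<Longrightarrow> s < \<tau> \<Longrightarrow> N (z s) < r" "\<tau> = T \<or> N (z \<tau>) = r"
proof -
  define K where "K = {x. N x \<le> r}"
  have "q \<in> K" using q by (simp add: K_def)
  then have K: "convex K" "compact K" "closed K" "K \<noteq> {}"
    using convex_is_norm_le[OF N] compact_is_norm_le[OF N, of r]
    by (auto simp: K_def compact_imp_closed)
  define h' where "h' = (\<lambda>x. h (closest_point K x))"
  have conth': "continuous_on UNIV h'"
    unfolding h'_def by (intro continuous_on_compose2[OF h] continuous_on_closest_point K) auto
  have "bounded (h ` K)"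
    by (intro compact_imp_bounded compact_continuous_image continuous_on_subset[OF h] K) auto
  then obtain M where "\<And>x. x \<in> K \<Longrightarrow> norm (h x) \<le> M" by (auto simp: bounded_iff)
  then have "norm (h' x) \<le> M" for x
    unfolding h'_def using closest_point_in_set[OF K(3,4)] by blast
  then obtain z where z: "ivp_solution h' q T z" using peano_existence[OF conth'] T by (metis less_imp_le)
  then have contz: "continuous_on {0..T} z" and z0: "z 0 = q"
    using ivp_solution_imp_curve_of by (auto simp: curve_of_def ivp_solution_def)
  have contN: "continuous_on {0..T} (\<lambda>s. N (z s))" by (rule continuous_on_is_norm[OF N contz])
  have sol: "ivp_solution h q \<tau> z" if "\<tau> \<le> T" "\<And>s. 0 \<le> s \<Longrightarrow> s \<le> \<tau> \<Longrightarrow> N (z s) \<le> r" for \<tau>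
  proof -
    have "h' (z s) = h (z s)" if "s \<in> {0..\<tau>}" for s
      using \<open>\<And>s. 0 \<le> s \<Longrightarrow> s \<le> \<tau> \<Longrightarrow> N (z s) \<le> r\<close>[of s] that by (simp add: h'_def K_def closest_point_self)
    then show ?thesis
      using ivp_solution_subinterval[OF z \<open>\<tau> \<le> T\<close>] by (simp add: ivp_solution_def)
  qed
  define A where "A = {0..T} \<inter> (\<lambda>s. N (z s)) -` {r}"
  have cA: "closed A" unfolding A_def by (intro continuous_closed_preimage contN) auto
  have bA: "bdd_below A" unfolding A_def by (intro bdd_belowI[of _ 0]) auto
  have hit: "\<exists>a\<in>A. a \<le> s" if s: "0 \<le> s" "s \<le> T" "\<not> N (z s) < r" for s
  proof -
    have "continuous_on {0..s} (\<lambda>s. N (z s))" by (rule continuous_on_subset[OF contN]) (use s in auto)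
    then obtain a where "0 \<le> a" "a \<le> s" "N (z a) = r"
      using IVT'[of "\<lambda>s. N (z s)" 0 r s] s q z0 by auto
    then show ?thesis using s by (auto simp: A_def)
  qed
  show ?thesis
  proof (cases "A = {}")
    case True
    then have "N (z s) < r" if "0 \<le> s" "s \<le> T" for s using hit that by blast
    then show ?thesis using that[OF T order_refl sol] by (simp add: less_imp_le)
  next
    case False
    define \<tau> where "\<tau> = Inf A"
    have "\<tau> \<in> A" unfolding \<tau>_def using cA bA False by (intro closed_contains_Inf)
    then have \<tau>: "0 < \<tau>" "\<tau> \<le> T" "N (z \<tau>) = r"
      using q z0 by (auto simp: A_def less_le)
    have below: "N (z s) < r" if s: "0 \<le> s" "s < \<tau>" for s
    proof (rule ccontr)
      assume "\<not> N (z s) < r"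
      then obtain a where "a \<in> A" "a \<le> s" using hit[of s] s \<tau> by auto
      then show False using cInf_lower[OF _ bA, of a] s by (simp add: \<tau>_def)
    qed
    have "N (z s) \<le> r" if "0 \<le> s" "s \<le> \<tau>" for s using below[of s] \<tau>(3) that by (cases "s = \<tau>") auto
    then show ?thesis using that[OF \<tau>(1,2) sol below] \<tau> by simp
  qed
qed

section \<open>The logarithmic quantizer\<close>

lemma quant_level_Suc: "0 < \<rho> \<Longrightarrow> quant_level \<rho> \<zeta> (j + 1) = \<rho> * quant_level \<rho> \<zeta> j"
  by (simp add: quant_level_def power_int_add)

lemma quant_level_eq_powr: "0 < \<rho> \<Longrightarrow> quant_level \<rho> \<zeta> j = \<rho> powr real_of_int j * \<zeta>"
  by (simp add: quant_level_def powr_real_of_int')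

lemma quant_level_antimono:
  assumes "0 < \<rho>" "\<rho> < 1" "0 < \<zeta>" "i \<le> j"
  shows "quant_level \<rho> \<zeta> j \<le> quant_level \<rho> \<zeta> i"
  using assms by (simp add: quant_level_eq_powr powr_mono')

lemma log_quant_pos_bracket:
  assumes \<rho>: "0 < \<rho>" "\<rho> < 1" and \<zeta>: "0 < \<zeta>" and z: "0 < z"
  obtains j where "quant_level \<rho> \<zeta> (j + 1) \<le> z" "z < quant_level \<rho> \<zeta> j"
    "log_quant_pos \<rho> \<zeta> z = (1 + \<rho>) / 2 * quant_level \<rho> \<zeta> j"
proof -
  define l where "l = log \<rho> (z / \<zeta>)"
  have zl: "z = \<rho> powr l * \<zeta>" using \<rho> \<zeta> z by (simp add: l_def)
  define j where "j = \<lceil>l\<rceil> - 1"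
  have "real_of_int j < l" "l \<le> real_of_int (j + 1)" unfolding j_def by linarith+
  then have j: "quant_level \<rho> \<zeta> (j + 1) \<le> z" "z < quant_level \<rho> \<zeta> j"
    using \<rho> \<zeta> by (auto simp: quant_level_eq_powr zl powr_mono' powr_less_mono' simp del: of_int_add)
  have uniq: "i = j" if "quant_level \<rho> \<zeta> (i + 1) \<le> z" "z < quant_level \<rho> \<zeta> i" for i
  proof (rule ccontr)
    assume "i \<noteq> j"
    then have "i + 1 \<le> j \<or> j + 1 \<le> i" by linarith
    then show False
      using quant_level_antimono[OF \<rho> \<zeta>, of "i + 1" j] quant_level_antimono[OF \<rho> \<zeta>, of "j + 1" i] j that
      by linarith
  qed
  have "(THE j. quant_level \<rho> \<zeta> (j + 1) \<le> z \<and> z < quant_level \<rho> \<zeta> j) = j"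
    by (rule the_equality) (use j uniq in blast)+
  then have "log_quant_pos \<rho> \<zeta> z = (quant_level \<rho> \<zeta> j + quant_level \<rho> \<zeta> (j + 1)) / 2"
    by (simp add: log_quant_pos_def)
  also have "\<dots> = (1 + \<rho>) / 2 * quant_level \<rho> \<zeta> j"
    unfolding quant_level_Suc[OF \<rho>(1)] by (simp add: algebra_simps)
  finally show ?thesis using that j by blast
qed

text \<open>A positive \<open>z\<close> lies in a bracket \<open>[\<rho> b, b)\<close> whose midpoint is the quantized value. The error is
  at most half the bracket length \<open>(1 - \<rho>) b / 2\<close>, and both this and the distance of the midpoint
  from zero scale with \<open>b\<close>: this gives the relative error. As \<open>z < \<zeta>\<close>, the bracket
  lies in \<open>[0, \<zeta>]\<close>.\<close>

lemma log_quant_scalar_bounds: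
  assumes \<rho>: "0 < \<rho>" "\<rho> < 1" and z: "\<bar>z\<bar> < \<zeta>"
  shows "\<bar>log_quant_scalar \<rho> \<zeta> z - z\<bar> \<le> (1 - \<rho>) / (1 + \<rho>) * \<bar>log_quant_scalar \<rho> \<zeta> z\<bar>"
    and "\<bar>log_quant_scalar \<rho> \<zeta> z\<bar> \<le> (1 + \<rho>) / (2 * \<rho>) * \<bar>z\<bar>"
    and "\<bar>log_quant_scalar \<rho> \<zeta> z\<bar> \<le> (1 + \<rho>) / 2 * \<zeta>"
proof -
  have \<zeta>: "0 < \<zeta>" using z by linarith
  have pos: "\<bar>log_quant_pos \<rho> \<zeta> y - y\<bar> \<le> (1 - \<rho>) / (1 + \<rho>) * log_quant_pos \<rho> \<zeta> y
      \<and> 0 \<le> log_quant_pos \<rho> \<zeta> y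
      \<and> log_quant_pos \<rho> \<zeta> y \<le> (1 + \<rho>) / (2 * \<rho>) * y \<and> log_quant_pos \<rho> \<zeta> y \<le> (1 + \<rho>) / 2 * \<zeta>"
    if y: "0 < y" "y < \<zeta>" for y
  proof -
    obtain j where j: "quant_level \<rho> \<zeta> (j + 1) \<le> y" "y < quant_level \<rho> \<zeta> j"
      "log_quant_pos \<rho> \<zeta> y = (1 + \<rho>) / 2 * quant_level \<rho> \<zeta> j"
      using log_quant_pos_bracket[OF \<rho> \<zeta> y(1)] by blast
    define b where "b = quant_level \<rho> \<zeta> j"
    have b: "\<rho> * b \<le> y" "y < b" "log_quant_pos \<rho> \<zeta> y = (1 + \<rho>) / 2 * b"
      using j \<rho> by (auto simp: b_def quant_level_Suc)
    have "0 \<le> j"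
    proof (rule ccontr)
      assume "\<not> 0 \<le> j"
      then have "quant_level \<rho> \<zeta> 0 \<le> quant_level \<rho> \<zeta> (j + 1)"
        by (intro quant_level_antimono \<rho> \<zeta>) auto
      then show False using j(1) y(2) by (simp add: quant_level_def)
    qed
    then have "b \<le> \<zeta>"
      using quant_level_antimono[OF \<rho> \<zeta>, of 0 j] by (simp add: b_def quant_level_def)
    then have "(1 + \<rho>) / 2 * b \<le> (1 + \<rho>) / 2 * \<zeta>" using \<rho> by (intro mult_left_mono) auto
    moreover have "\<bar>(1 + \<rho>) / 2 * b - y\<bar> \<le> (1 - \<rho>) / 2 * b"
      using b(1,2) by (simp add: abs_le_iff field_simps)
    moreover have "(1 - \<rho>) / (1 + \<rho>) * ((1 + \<rho>) / 2 * b) = (1 - \<rho>) / 2 * b"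
      using \<rho> by (simp add: field_simps)
    moreover have "(1 + \<rho>) / 2 * b = (1 + \<rho>) / (2 * \<rho>) * (\<rho> * b)" using \<rho> by simp
    then have "(1 + \<rho>) / 2 * b \<le> (1 + \<rho>) / (2 * \<rho>) * y"
      using mult_left_mono[OF b(1), of "(1 + \<rho>) / (2 * \<rho>)"] \<rho> by simp
    moreover have "0 \<le> (1 + \<rho>) / 2 * b" using b(2) y \<rho> by simp
    ultimately show ?thesis unfolding b(3) by simp
  qed
  consider "z = 0" | "0 < z" | "z < 0" by linarith
  then have "\<bar>log_quant_scalar \<rho> \<zeta> z - z\<bar> \<le> (1 - \<rho>) / (1 + \<rho>) * \<bar>log_quant_scalar \<rho> \<zeta> z\<bar>
    \<and> \<bar>log_quant_scalar \<rho> \<zeta> z\<bar> \<le> (1 + \<rho>) / (2 * \<rho>) * \<bar>z\<bar>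
    \<and> \<bar>log_quant_scalar \<rho> \<zeta> z\<bar> \<le> (1 + \<rho>) / 2 * \<zeta>"
  proof cases
    case 1
    then show ?thesis using \<rho> \<zeta> by (simp add: log_quant_scalar_def)
  next
    case 2
    then show ?thesis using pos[of z] z by (simp add: log_quant_scalar_def)
  next
    case 3
    then have "log_quant_scalar \<rho> \<zeta> z = - log_quant_pos \<rho> \<zeta> (- z)" by (simp add: log_quant_scalar_def)
    moreover have "\<bar>- log_quant_pos \<rho> \<zeta> (- z) - z\<bar> = \<bar>log_quant_pos \<rho> \<zeta> (- z) - (- z)\<bar>" by linarith
    moreover have "\<bar>z\<bar> = - z" using 3 by simp
    moreover have "0 < - z" "- z < \<zeta>" using 3 z by auto
    ultimately show ?thesis using pos[of "- z"] by (metis abs_minus_cancel abs_of_nonneg)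
  qed
  then show "\<bar>log_quant_scalar \<rho> \<zeta> z - z\<bar> \<le> (1 - \<rho>) / (1 + \<rho>) * \<bar>log_quant_scalar \<rho> \<zeta> z\<bar>"
    and "\<bar>log_quant_scalar \<rho> \<zeta> z\<bar> \<le> (1 + \<rho>) / (2 * \<rho>) * \<bar>z\<bar>"
    and "\<bar>log_quant_scalar \<rho> \<zeta> z\<bar> \<le> (1 + \<rho>) / 2 * \<zeta>"
    by blast+
qed

lemma p_norm_mono:
  fixes u v :: "real^'n"
  assumes r: "1 \<le> r" and C: "0 \<le> C" and le: "\<And>i. \<bar>u $ i\<bar> \<le> C * \<bar>v $ i\<bar>"
  shows "p_norm r u \<le> C * p_norm r v"
proof (cases "r = \<infinity>")
  case True
  have "infnorm u \<le> C * infnorm v"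
    unfolding infnorm_cart
  proof (rule cSup_least)
    show "{\<bar>u $ i\<bar> |i. i \<in> UNIV} \<noteq> {}" by blast
    fix a assume "a \<in> {\<bar>u $ i\<bar> |i. i \<in> UNIV}"
    then obtain i where "a = \<bar>u $ i\<bar>" by blast
    then have "a \<le> C * infnorm v"
      using le[of i] mult_left_mono[OF component_le_infnorm_cart[of v i] C] by linarith
    then show "a \<le> C * Sup {\<bar>v $ i\<bar> |i. i \<in> UNIV}" by (simp only: infnorm_cart)
  qed
  then show ?thesis using True by (simp add: p_norm_def)
next
  case False
  define k where "k = real_of_ereal r"
  have k: "1 \<le> k" using r False unfolding k_def by (cases r) auto
  have "(\<Sum>i\<in>UNIV. \<bar>u $ i\<bar> powr k) \<le> (\<Sum>i\<in>UNIV. C powr k * \<bar>v $ i\<bar> powr k)"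
  proof (rule sum_mono)
    fix i
    have "\<bar>u $ i\<bar> powr k \<le> (C * \<bar>v $ i\<bar>) powr k" using k le by (intro powr_mono2) auto
    then show "\<bar>u $ i\<bar> powr k \<le> C powr k * \<bar>v $ i\<bar> powr k" using C by (simp add: powr_mult)
  qed
  also have "\<dots> = C powr k * (\<Sum>i\<in>UNIV. \<bar>v $ i\<bar> powr k)" by (simp add: sum_distrib_left)
  finally have "(\<Sum>i\<in>UNIV. \<bar>u $ i\<bar> powr k) powr (1 / k) \<le> (C powr k * (\<Sum>i\<in>UNIV. \<bar>v $ i\<bar> powr k)) powr (1 / k)"
    using k by (intro powr_mono2) (auto intro!: sum_nonneg)
  also have "\<dots> = (C powr k) powr (1 / k) * (\<Sum>i\<in>UNIV. \<bar>v $ i\<bar> powr k) powr (1 / k)"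
    by (rule powr_mult)
  also have "(C powr k) powr (1 / k) = C" using k C by (simp add: powr_powr)
  finally show ?thesis using False by (simp add: p_norm_def k_def)
qed

lemma diag_matrix_mult: "(diag_matrix \<theta> *v x) $ i = \<theta> $ i * x $ i"
  by (simp add: diag_matrix_def matrix_vector_mult_def if_distrib[of "\<lambda>a. a * _"] cong: if_cong)

lemma weighted_norm_mono:
  fixes x y \<theta> :: "real^'n"
  assumes "1 \<le> r" "0 \<le> C" "\<And>i. \<bar>x $ i\<bar> \<le> C * \<bar>y $ i\<bar>"
  shows "weighted_norm r \<theta> x \<le> C * weighted_norm r \<theta> y"
  unfolding weighted_norm_def
proof (rule p_norm_mono[OF assms(1,2)])
  fix i
  show "\<bar>(diag_matrix \<theta> *v x) $ i\<bar> \<le> C * \<bar>(diag_matrix \<theta> *v y) $ i\<bar>"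
    using mult_left_mono[OF assms(3)[of i], of "\<bar>\<theta> $ i\<bar>"]
    by (simp add: diag_matrix_mult abs_mult algebra_simps)
qed

lemma weighted_norm_inf_upper: "\<bar>\<theta> $ i * x $ i\<bar> \<le> weighted_norm \<infinity> \<theta> x"
  using component_le_infnorm_cart[of "diag_matrix \<theta> *v x" i]
  by (simp add: weighted_norm_def p_norm_def diag_matrix_mult)

lemma weighted_norm_inf_least:
  assumes "\<And>i. \<bar>\<theta> $ i * x $ i\<bar> \<le> B"
  shows "weighted_norm \<infinity> \<theta> x \<le> B"
proof -
  have "Sup {\<bar>(diag_matrix \<theta> *v x) $ i\<bar> |i. i \<in> UNIV} \<le> B"
  proof (rule cSup_least)
    show "{\<bar>(diag_matrix \<theta> *v x) $ i\<bar> |i. i \<in> UNIV} \<noteq> {}" by blast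
    show "a \<le> B" if "a \<in> {\<bar>(diag_matrix \<theta> *v x) $ i\<bar> |i. i \<in> UNIV}" for a
      using that assms by (auto simp: diag_matrix_mult)
  qed
  then show ?thesis by (simp add: weighted_norm_def p_norm_def infnorm_cart)
qed

text \<open>Up to the weights, all coordinates are quantized alike, and the coordinatewise relative error
  bounds carry over to every weighted \<open>p\<close>-norm because these norms are monotone.\<close>

lemma log_quant_bounds:
  fixes \<theta> \<omega> X\<^sub>0 x :: "real^'n"
  assumes \<rho>: "0 < \<rho>" "\<rho> < 1" and \<theta>: "\<forall>i. 0 < \<theta> $ i" and X\<^sub>0: "\<forall>i. X\<^sub>0 $ i = \<zeta> / \<theta> $ i"
    and x: "weighted_norm \<infinity> \<theta> x < \<zeta>"
  shows "weighted_norm \<infinity> \<theta> (log_quant \<rho> X\<^sub>0 x) \<le> (1 + \<rho>) / 2 * \<zeta>"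
    and "1 \<le> r \<Longrightarrow> weighted_norm r \<omega> (x - log_quant \<rho> X\<^sub>0 x)
      \<le> (1 - \<rho>) / (1 + \<rho>) * weighted_norm r \<omega> (log_quant \<rho> X\<^sub>0 x)"
    and "1 \<le> r \<Longrightarrow> weighted_norm r \<omega> (log_quant \<rho> X\<^sub>0 x) \<le> (1 + \<rho>) / (2 * \<rho>) * weighted_norm r \<omega> x"
proof -
  have small: "\<bar>x $ i\<bar> < X\<^sub>0 $ i" for i
  proof -
    have "\<theta> $ i * \<bar>x $ i\<bar> < \<zeta>"
      using weighted_norm_inf_upper[of \<theta> i x] x \<theta>[rule_format, of i] by (simp add: abs_mult)
    then show ?thesis using \<theta>[rule_format, of i] by (simp add: X\<^sub>0 pos_less_divide_eq mult.commute)
  qed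
  note coord = log_quant_scalar_bounds[OF \<rho> small]
  show "weighted_norm \<infinity> \<theta> (log_quant \<rho> X\<^sub>0 x) \<le> (1 + \<rho>) / 2 * \<zeta>"
  proof (rule weighted_norm_inf_least)
    fix i
    have "\<theta> $ i * \<bar>log_quant \<rho> X\<^sub>0 x $ i\<bar> \<le> \<theta> $ i * ((1 + \<rho>) / 2 * (\<zeta> / \<theta> $ i))"
      using coord(3)[of i] \<theta>[rule_format, of i] by (intro mult_left_mono) (auto simp: log_quant_def X\<^sub>0)
    also have "\<dots> = (1 + \<rho>) / 2 * \<zeta>" using \<theta>[rule_format, of i] by simp
    finally show "\<bar>\<theta> $ i * log_quant \<rho> X\<^sub>0 x $ i\<bar> \<le> (1 + \<rho>) / 2 * \<zeta>"
      using \<theta>[rule_format, of i] by (simp add: abs_mult)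
  qed
  show "weighted_norm r \<omega> (x - log_quant \<rho> X\<^sub>0 x) \<le> (1 - \<rho>) / (1 + \<rho>) * weighted_norm r \<omega> (log_quant \<rho> X\<^sub>0 x)"
    if "1 \<le> r"
    using coord(1) \<rho> that by (intro weighted_norm_mono) (auto simp: log_quant_def abs_minus_commute)
  show "weighted_norm r \<omega> (log_quant \<rho> X\<^sub>0 x) \<le> (1 + \<rho>) / (2 * \<rho>) * weighted_norm r \<omega> x" if "1 \<le> r"
    using coord(2) \<rho> that by (intro weighted_norm_mono) (auto simp: log_quant_def)
qed

section \<open>The constants of the lower bound on the sampling intervals\<close>

lemma nu_has_real_derivative:
  assumes "0 < t"
  shows "(nu d\<^sub>1 d\<^sub>2 has_real_derivative d\<^sub>2 * exp (d\<^sub>1 * t)) (at t)"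
proof -
  have "((\<lambda>x. integral {0..x} (\<lambda>s. exp (d\<^sub>1 * s))) has_real_derivative exp (d\<^sub>1 * t)) (at t within {0..t + 1})"
    using assms by (intro integral_has_real_derivative continuous_intros) auto
  then have "((\<lambda>x. integral {0..x} (\<lambda>s. exp (d\<^sub>1 * s))) has_real_derivative exp (d\<^sub>1 * t)) (at t)"
    using assms by (simp add: at_within_Icc_at)
  then show ?thesis
    unfolding nu_def[abs_def] by (auto intro!: derivative_eq_intros)
qed

lemma nu_0: "nu d\<^sub>1 d\<^sub>2 0 = 0"
  by (simp add: nu_def)

lemma continuous_on_nu: "continuous_on {0..T} (nu d\<^sub>1 d\<^sub>2)"
  unfolding nu_def[abs_def]
  by (intro continuous_intros indefinite_integral_continuous_1 integrable_continuous_real)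

lemma nu_linear_ode:
  assumes "0 \<le> t"
  shows "d\<^sub>1 * nu d\<^sub>1 d\<^sub>2 t + d\<^sub>2 = d\<^sub>2 * exp (d\<^sub>1 * t)"
proof -
  have "((\<lambda>s. d\<^sub>1 * exp (d\<^sub>1 * s)) has_integral exp (d\<^sub>1 * t) - exp (d\<^sub>1 * 0)) {0..t}"
    using assms
    by (intro fundamental_theorem_of_calculus)
       (auto intro!: derivative_eq_intros simp flip: has_real_derivative_iff_has_vector_derivative)
  from integral_unique[OF this]
  have "d\<^sub>1 * integral {0..t} (\<lambda>s. exp (d\<^sub>1 * s)) = exp (d\<^sub>1 * t) - 1" by simp
  moreover have "d\<^sub>1 * nu d\<^sub>1 d\<^sub>2 t = d\<^sub>2 * (d\<^sub>1 * integral {0..t} (\<lambda>s. exp (d\<^sub>1 * s)))"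
    unfolding nu_def by (rule mult.left_commute)
  ultimately show ?thesis by (simp only: right_diff_distrib)
qed

lemma nu_increase:
  assumes "0 \<le> d\<^sub>1" "0 \<le> d\<^sub>2" "0 \<le> a" "a \<le> b"
  shows "d\<^sub>2 * (b - a) \<le> nu d\<^sub>1 d\<^sub>2 b - nu d\<^sub>1 d\<^sub>2 a"
proof -
  have int: "(\<lambda>s. exp (d\<^sub>1 * s)) integrable_on {c..d}" for c d
    by (intro integrable_continuous_real continuous_intros)
  have "integral {0..a} (\<lambda>s. exp (d\<^sub>1 * s)) + integral {a..b} (\<lambda>s. exp (d\<^sub>1 * s)) = integral {0..b} (\<lambda>s. exp (d\<^sub>1 * s))"
    using assms by (intro Henstock_Kurzweil_Integration.integral_combine int) auto
  moreover have "integral {a..b} (\<lambda>_. 1) \<le> integral {a..b} (\<lambda>s. exp (d\<^sub>1 * s))"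
    using assms by (intro integral_le int) auto
  ultimately have "b - a \<le> integral {0..b} (\<lambda>s. exp (d\<^sub>1 * s)) - integral {0..a} (\<lambda>s. exp (d\<^sub>1 * s))"
    using assms by simp
  then show ?thesis unfolding nu_def right_diff_distrib[symmetric] using assms by (intro mult_left_mono) auto
qed

lemma nu_nonneg: "0 \<le> d\<^sub>1 \<Longrightarrow> 0 \<le> d\<^sub>2 \<Longrightarrow> 0 \<le> t \<Longrightarrow> 0 \<le> nu d\<^sub>1 d\<^sub>2 t"
  unfolding nu_def
  by (intro mult_nonneg_nonneg integral_nonneg integrable_continuous_real continuous_intros) auto

lemma ex1_level:
  fixes G :: "real \<Rightarrow> real"
  assumes cont: "\<And>b. continuous_on {0..b} G" and "0 < d"
    and incr: "\<And>a b. 0 \<le> a \<Longrightarrow> a \<le> b \<Longrightarrow> d * (b - a) \<le> G b - G a" and "G 0 < v"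
  shows "\<exists>!t. 0 < t \<and> G t = v"
proof (rule ex_ex1I)
  define b where "b = (v - G 0) / d"
  have "0 < b" using assms by (simp add: b_def)
  moreover have "v \<le> G b" using incr[of 0 b] \<open>0 < b\<close> \<open>0 < d\<close> by (simp add: b_def)
  ultimately obtain t where "0 \<le> t" "G t = v" using IVT'[of G 0 v b] cont \<open>G 0 < v\<close> by auto
  moreover have "t \<noteq> 0" using \<open>G t = v\<close> \<open>G 0 < v\<close> by auto
  ultimately show "\<exists>t. 0 < t \<and> G t = v" by (intro exI[of _ t]) auto
next
  fix s t assume *: "0 < s \<and> G s = v" "0 < t \<and> G t = v"
  have "d * (t - s) \<le> 0 \<or> s > t" "d * (s - t) \<le> 0 \<or> t > s"
    using incr[of s t] incr[of t s] * by auto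
  moreover have "\<not> d * (t - s) \<le> 0" if "s < t" using mult_pos_pos[OF \<open>0 < d\<close>, of "t - s"] that by simp
  moreover have "\<not> d * (s - t) \<le> 0" if "t < s" using mult_pos_pos[OF \<open>0 < d\<close>, of "s - t"] that by simp
  ultimately show "s = t" by argo
qed

lemma tau_min_props:
  assumes "0 \<le> d\<^sub>1" "0 < d\<^sub>2" "0 \<le> L * (1 - \<rho>) / (1 + \<rho>)" "L * (1 - \<rho>) / (1 + \<rho>) < \<sigma> / \<Gamma>"
  shows "0 < tau_min d\<^sub>1 d\<^sub>2 L \<rho> \<Gamma> \<sigma>"
    and "\<And>s. 0 \<le> s \<Longrightarrow> s \<le> tau_min d\<^sub>1 d\<^sub>2 L \<rho> \<Gamma> \<sigma> \<Longrightarrow>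
      L * (1 - \<rho>) / (1 + \<rho>) * exp (d\<^sub>1 * s) + nu d\<^sub>1 d\<^sub>2 s \<le> \<sigma> / \<Gamma>"
proof -
  define k where "k = L * (1 - \<rho>) / (1 + \<rho>)"
  define G where "G = (\<lambda>t. k * exp (d\<^sub>1 * t) + nu d\<^sub>1 d\<^sub>2 t)"
  have incr: "d\<^sub>2 * (b - a) \<le> G b - G a" if "0 \<le> a" "a \<le> b" for a b
  proof -
    have "k * exp (d\<^sub>1 * a) \<le> k * exp (d\<^sub>1 * b)"
      using assms that by (intro mult_left_mono) (auto simp: k_def mult_left_mono)
    then show ?thesis using nu_increase[of d\<^sub>1 d\<^sub>2 a b] assms that by (simp add: G_def)
  qed
  have "\<exists>!t. 0 < t \<and> G t = \<sigma> / \<Gamma>"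
  proof (rule ex1_level[OF _ assms(2) incr])
    show "continuous_on {0..b} G" for b unfolding G_def by (intro continuous_intros continuous_on_nu)
    show "G 0 < \<sigma> / \<Gamma>" using assms by (simp add: G_def nu_0 k_def)
  qed
  then have *: "0 < tau_min d\<^sub>1 d\<^sub>2 L \<rho> \<Gamma> \<sigma>" "G (tau_min d\<^sub>1 d\<^sub>2 L \<rho> \<Gamma> \<sigma>) = \<sigma> / \<Gamma>"
    using theI'[of "\<lambda>t. 0 < t \<and> G t = \<sigma> / \<Gamma>"] by (auto simp: tau_min_def G_def k_def)
  show "0 < tau_min d\<^sub>1 d\<^sub>2 L \<rho> \<Gamma> \<sigma>" by (rule *)
  fix s assume s: "0 \<le> s" "s \<le> tau_min d\<^sub>1 d\<^sub>2 L \<rho> \<Gamma> \<sigma>"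
  have "0 \<le> d\<^sub>2 * (tau_min d\<^sub>1 d\<^sub>2 L \<rho> \<Gamma> \<sigma> - s)" using s assms by simp
  then show "L * (1 - \<rho>) / (1 + \<rho>) * exp (d\<^sub>1 * s) + nu d\<^sub>1 d\<^sub>2 s \<le> \<sigma> / \<Gamma>"
    using incr[OF s] *(2) by (simp add: G_def k_def)
qed

lemma tau_tilde_min_props:
  assumes "0 \<le> d\<^sub>1" "0 < d\<^sub>2" "0 < \<kappa>" "\<kappa> < 1"
  shows "0 < tau_tilde_min d\<^sub>1 d\<^sub>2 \<kappa>"
    and "\<And>s. 0 \<le> s \<Longrightarrow> s < tau_tilde_min d\<^sub>1 d\<^sub>2 \<kappa> \<Longrightarrow> \<kappa> * (1 + nu d\<^sub>1 d\<^sub>2 s) < 1"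
proof -
  have ex: "\<exists>!t. 0 < t \<and> nu d\<^sub>1 d\<^sub>2 t = 1 / \<kappa> - 1"
  proof (rule ex1_level[OF continuous_on_nu assms(2)])
    show "d\<^sub>2 * (b - a) \<le> nu d\<^sub>1 d\<^sub>2 b - nu d\<^sub>1 d\<^sub>2 a" if "0 \<le> a" "a \<le> b" for a b
      using assms(1,2) that by (intro nu_increase) auto
    show "nu d\<^sub>1 d\<^sub>2 0 < 1 / \<kappa> - 1" using assms by (simp add: nu_0)
  qed
  have "(0 \<le> t \<and> \<kappa> * (1 + nu d\<^sub>1 d\<^sub>2 t) = 1) \<longleftrightarrow> (0 < t \<and> nu d\<^sub>1 d\<^sub>2 t = 1 / \<kappa> - 1)" for t
  proof -
    have "\<kappa> * (1 + nu d\<^sub>1 d\<^sub>2 t) = 1 \<longleftrightarrow> nu d\<^sub>1 d\<^sub>2 t = 1 / \<kappa> - 1"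
      using assms(3) by (auto simp: field_simps)
    moreover have "nu d\<^sub>1 d\<^sub>2 0 \<noteq> 1 / \<kappa> - 1" using assms by (simp add: nu_0)
    ultimately show ?thesis by (auto simp: less_le)
  qed
  then have "tau_tilde_min d\<^sub>1 d\<^sub>2 \<kappa> = (THE t. 0 < t \<and> nu d\<^sub>1 d\<^sub>2 t = 1 / \<kappa> - 1)"
    by (simp add: tau_tilde_min_def)
  then have *: "0 < tau_tilde_min d\<^sub>1 d\<^sub>2 \<kappa>" "nu d\<^sub>1 d\<^sub>2 (tau_tilde_min d\<^sub>1 d\<^sub>2 \<kappa>) = 1 / \<kappa> - 1"
    using theI'[OF ex] by auto
  show "0 < tau_tilde_min d\<^sub>1 d\<^sub>2 \<kappa>" by (rule *)
  fix s assume s: "0 \<le> s" "s < tau_tilde_min d\<^sub>1 d\<^sub>2 \<kappa>"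
  have "0 < d\<^sub>2 * (tau_tilde_min d\<^sub>1 d\<^sub>2 \<kappa> - s)" using s assms(2) by simp
  also have "\<dots> \<le> 1 / \<kappa> - 1 - nu d\<^sub>1 d\<^sub>2 s"
    using nu_increase[of d\<^sub>1 d\<^sub>2 s "tau_tilde_min d\<^sub>1 d\<^sub>2 \<kappa>"] s assms *(2) by simp
  finally have "nu d\<^sub>1 d\<^sub>2 s < 1 / \<kappa> - 1" by simp
  then show "\<kappa> * (1 + nu d\<^sub>1 d\<^sub>2 s) < 1" using assms(3) by (simp add: field_simps)
qed

section \<open>The predicted state and the self-triggering mechanism\<close>

lemma ivp_exists_uniquely_and_value:
  fixes N :: "'a::euclidean_space \<Rightarrow> real"
  assumes "is_norm N" "one_sided_lipschitz N a U h" "open U"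
    and y: "ivp_solution h q T y" and inU: "\<And>s. 0 \<le> s \<Longrightarrow> s < T \<Longrightarrow> y s \<in> U" and "0 \<le> T"
  shows "ivp_exists_uniquely h q T" and "ivp_value h q T = y T"
proof -
  have uniq: "z s = y s" if "ivp_solution h q T z" "s \<in> {0..T}" for z s
  proof (rule curve_of_unique[OF assms(1-3)])
    show "curve_of h T y" "curve_of h T z" using y that by (auto intro: ivp_solution_imp_curve_of)
    show "y 0 = z 0" using y that by (simp add: ivp_solution_def)
  qed (use inU that in auto)
  then show "ivp_exists_uniquely h q T" unfolding ivp_exists_uniquely_def using y by blast
  show "ivp_value h q T = y T"
    unfolding ivp_value_def
  proof (rule the_equality)
    show "\<exists>z. ivp_solution h q T z \<and> z T = y T" using y by blast
    show "v = y T" if "\<exists>z. ivp_solution h q T z \<and> z T = v" for v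
      using that uniq[of _ T] \<open>0 \<le> T\<close> by auto
  qed
qed

locale held_input =
  fixes f :: "(real^'n) \<times> (real^'m) \<Rightarrow> real^'n" and g :: "real^'n \<Rightarrow> real^'m"
    and N :: "real^'n \<Rightarrow> real" and R\<^sub>2 :: ereal and d\<^sub>1 d\<^sub>2 :: real
  assumes norm_N: "is_norm N" and f_cont: "continuous_on UNIV f"
    and d\<^sub>1: "0 \<le> d\<^sub>1" and d\<^sub>2: "0 < d\<^sub>2"
    and osl: "\<And>q. q \<in> norm_ball N R\<^sub>2 \<Longrightarrow> one_sided_lipschitz N d\<^sub>1 (norm_ball N R\<^sub>2) (held_field f g q)"
    and drift: "\<And>q. q \<in> norm_ball N R\<^sub>2 \<Longrightarrow> N (held_field f g q q) \<le> d\<^sub>2 * N q"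
begin

lemma held_field_continuous: "continuous_on UNIV (held_field f g q)"
  unfolding held_field_def[abs_def]
  by (intro continuous_on_compose2[OF f_cont] continuous_intros) auto

text \<open>\<open>d\<^sub>2 * N q\<close> bounds the initial speed of the predicted state, and \<open>d\<^sub>1\<close> the rate at which its
  distance from \<open>q\<close> can grow: the comparison function solves \<open>\<nu>' = d\<^sub>1 \<nu> + d\<^sub>2\<close>.\<close>

lemma predicted_state_drift:
  assumes q: "q \<in> norm_ball N R\<^sub>2" and y: "curve_of (held_field f g q) T y" "y 0 = q"
    and inball: "\<And>s. 0 < s \<Longrightarrow> s < T \<Longrightarrow> y s \<in> norm_ball N R\<^sub>2" and T: "0 \<le> T"
  shows "N (y T - q) \<le> nu d\<^sub>1 d\<^sub>2 T * N q"
proof (rule norm_comparison[OF norm_N T, where u = "\<lambda>s. y s - q" and u' = "\<lambda>s. held_field f g q (y s)"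
      and a = d\<^sub>1 and b = "d\<^sub>2 * N q" and M = "\<lambda>s. nu d\<^sub>1 d\<^sub>2 s * N q"])
  show "continuous_on {0..T} (\<lambda>s. y s - q)"
    using y by (intro continuous_intros) (simp add: curve_of_def)
  fix t assume t: "0 < t" "t < T"
  show "((\<lambda>s. y s - q) has_vector_derivative held_field f g q (y t)) (at t)"
    using y t by (auto simp: curve_of_def intro!: derivative_eq_intros)
  have "d\<^sub>1 * (nu d\<^sub>1 d\<^sub>2 t * N q) + d\<^sub>2 * N q = d\<^sub>2 * exp (d\<^sub>1 * t) * N q"
    using nu_linear_ode[of t d\<^sub>1 d\<^sub>2] t by (simp flip: distrib_right mult.assoc)
  then show "((\<lambda>s. nu d\<^sub>1 d\<^sub>2 s * N q) has_real_derivative d\<^sub>1 * (nu d\<^sub>1 d\<^sub>2 t * N q) + d\<^sub>2 * N q) (at t)"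
    using DERIV_cmult_right[OF nu_has_real_derivative[OF t(1), of d\<^sub>1 d\<^sub>2], of "N q"] by simp
  fix \<xi> assume \<xi>: "norming N (y t - q) \<xi>"
  have "\<xi> \<bullet> held_field f g q (y t) = \<xi> \<bullet> (held_field f g q (y t) - held_field f g q q) + \<xi> \<bullet> held_field f g q q"
    by (simp add: inner_diff_right)
  also have "\<dots> \<le> d\<^sub>1 * N (y t - q) + d\<^sub>2 * N q"
    using one_sided_lipschitzD[OF osl[OF q] inball[OF t] q \<xi>] normingD(1)[OF \<xi>, of "held_field f g q q"] drift[OF q]
    by linarith
  finally show "\<xi> \<bullet> held_field f g q (y t) \<le> d\<^sub>1 * N (y t - q) + d\<^sub>2 * N q" .
next
  show "continuous_on {0..T} (\<lambda>s. nu d\<^sub>1 d\<^sub>2 s * N q)" by (intro continuous_intros continuous_on_nu)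
  show "N (y 0 - q) \<le> nu d\<^sub>1 d\<^sub>2 0 * N q" using y by (simp add: is_norm_zero[OF norm_N] nu_0)
qed

text \<open>The drift estimate keeps the solution bounded, so that it exists until \<open>\<tau>\<^sub>m\<^sub>a\<^sub>x\<close> or until it reaches
  the boundary of the ball. In the latter case it still exists, and is unique, at the exit time
  itself; hence the infimum in \<^const>\<open>tau_tilde\<close> is the exit time, whatever value
  \<^const>\<open>ivp_value\<close> takes later.\<close>

lemma prediction:
  assumes q: "q \<in> norm_ball N R\<^sub>2" and \<tau>\<^sub>m\<^sub>a\<^sub>x: "0 < \<tau>\<^sub>m\<^sub>a\<^sub>x"
  obtains y \<tau> where "tau_tilde f g N R\<^sub>2 \<tau>\<^sub>m\<^sub>a\<^sub>x q = \<tau>" "0 < \<tau>" "\<tau> \<le> \<tau>\<^sub>m\<^sub>a\<^sub>x" "ivp_solution (held_field f g q) q \<tau> y"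
    "\<And>s. 0 \<le> s \<Longrightarrow> s < \<tau> \<Longrightarrow> y s \<in> norm_ball N R\<^sub>2"
    "\<And>s. 0 \<le> s \<Longrightarrow> s \<le> \<tau> \<Longrightarrow> pred_state f g q s = y s"
    "\<And>s. 0 \<le> s \<Longrightarrow> s \<le> \<tau> \<Longrightarrow> N (y s - q) \<le> nu d\<^sub>1 d\<^sub>2 s * N q"
    "\<tau> = \<tau>\<^sub>m\<^sub>a\<^sub>x \<or> R\<^sub>2 \<le> ereal (N (y \<tau>))"
proof -
  let ?h = "held_field f g q"
  \<comment> \<open>By the drift estimate the norm of the predicted state stays below \<open>M\<close> up to \<open>\<tau>\<^sub>m\<^sub>a\<^sub>x\<close>. Hence the ball
    of radius \<open>r\<close> below is only left through the boundary of the given ball.\<close>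
  define M where "M = N q * (1 + nu d\<^sub>1 d\<^sub>2 \<tau>\<^sub>m\<^sub>a\<^sub>x) + 1"
  have Nq: "0 \<le> N q" by (rule is_norm_ge_0[OF norm_N])
  have nonneg: "0 \<le> N q * nu d\<^sub>1 d\<^sub>2 \<tau>\<^sub>m\<^sub>a\<^sub>x"
    using Nq nu_nonneg[OF d\<^sub>1, of d\<^sub>2 \<tau>\<^sub>m\<^sub>a\<^sub>x] d\<^sub>2 \<tau>\<^sub>m\<^sub>a\<^sub>x by (intro mult_nonneg_nonneg) auto
  obtain r where r: "N q < r" "ereal r \<le> R\<^sub>2" "ereal r = R\<^sub>2 \<or> r = M"
  proof (cases "R\<^sub>2 \<le> ereal M")
    case True
    then obtain r where "R\<^sub>2 = ereal r" using q by (cases R\<^sub>2) (auto simp: norm_ball_def)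
    then show ?thesis using that[of r] q by (auto simp: norm_ball_def)
  next
    case False
    then show ?thesis using that[of M] nonneg by (auto simp: M_def algebra_simps)
  qed
  obtain y \<tau> where \<tau>: "0 < \<tau>" "\<tau> \<le> \<tau>\<^sub>m\<^sub>a\<^sub>x" and y: "ivp_solution ?h q \<tau> y"
    and below: "\<And>s. 0 \<le> s \<Longrightarrow> s < \<tau> \<Longrightarrow> N (y s) < r" and exit: "\<tau> = \<tau>\<^sub>m\<^sub>a\<^sub>x \<or> N (y \<tau>) = r"
    using solution_until_exit[OF norm_N held_field_continuous r(1) \<tau>\<^sub>m\<^sub>a\<^sub>x] by blast
  have inball: "y s \<in> norm_ball N R\<^sub>2" if "0 \<le> s" "s < \<tau>" for s
  proof -
    have "ereal (N (y s)) < ereal r" using below[OF that] by simp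
    also note r(2)
    finally show ?thesis by (simp add: norm_ball_def)
  qed
  have drift: "N (y s - q) \<le> nu d\<^sub>1 d\<^sub>2 s * N q" if "0 \<le> s" "s \<le> \<tau>" for s
  proof (rule predicted_state_drift[OF q])
    show "curve_of ?h s y" by (rule ivp_solution_imp_curve_of[OF ivp_solution_subinterval[OF y that(2)]])
    show "y 0 = q" using y by (simp add: ivp_solution_def)
    show "y r \<in> norm_ball N R\<^sub>2" if "0 < r" "r < s" for r using inball that \<open>s \<le> \<tau>\<close> by simp
  qed (rule that)
  have pred: "pred_state f g q s = y s" if "0 \<le> s" "s \<le> \<tau>" for s
    unfolding pred_state_def
    by (rule ivp_exists_uniquely_and_value(2)[OF norm_N osl[OF q] open_norm_ball[OF norm_N]])
       (use ivp_solution_subinterval[OF y] inball that in auto)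
  have exit': "\<tau> = \<tau>\<^sub>m\<^sub>a\<^sub>x \<or> R\<^sub>2 \<le> ereal (N (y \<tau>))"
  proof (rule disjCI)
    assume "\<not> R\<^sub>2 \<le> ereal (N (y \<tau>))"
    show "\<tau> = \<tau>\<^sub>m\<^sub>a\<^sub>x"
    proof (rule ccontr)
      assume "\<tau> \<noteq> \<tau>\<^sub>m\<^sub>a\<^sub>x"
      then have "N (y \<tau>) = M" using exit r(3) \<open>\<not> R\<^sub>2 \<le> ereal (N (y \<tau>))\<close> by auto
      moreover have "nu d\<^sub>1 d\<^sub>2 \<tau> * N q \<le> nu d\<^sub>1 d\<^sub>2 \<tau>\<^sub>m\<^sub>a\<^sub>x * N q"
      proof (intro mult_right_mono Nq)
        have "0 \<le> d\<^sub>2 * (\<tau>\<^sub>m\<^sub>a\<^sub>x - \<tau>)" using d\<^sub>2 \<tau> by simp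
        also have "\<dots> \<le> nu d\<^sub>1 d\<^sub>2 \<tau>\<^sub>m\<^sub>a\<^sub>x - nu d\<^sub>1 d\<^sub>2 \<tau>" using d\<^sub>2 \<tau> by (intro nu_increase[OF d\<^sub>1]) auto
        finally show "nu d\<^sub>1 d\<^sub>2 \<tau> \<le> nu d\<^sub>1 d\<^sub>2 \<tau>\<^sub>m\<^sub>a\<^sub>x" by simp
      qed
      moreover have "N (y \<tau>) \<le> N q + N (y \<tau> - q)" by (rule is_norm_triangle_sub[OF norm_N])
      moreover have "N (y \<tau> - q) \<le> nu d\<^sub>1 d\<^sub>2 \<tau> * N q" using drift[of \<tau>] \<tau> by simp
      moreover have "M = N q + nu d\<^sub>1 d\<^sub>2 \<tau>\<^sub>m\<^sub>a\<^sub>x * N q + 1" by (simp add: M_def algebra_simps)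
      ultimately show False by linarith
    qed
  qed
  have "tau_tilde f g N R\<^sub>2 \<tau>\<^sub>m\<^sub>a\<^sub>x q = \<tau>"
  proof (cases "\<tau> = \<tau>\<^sub>m\<^sub>a\<^sub>x")
    case True
    then have "\<forall>\<tau>\<in>{0<..<\<tau>\<^sub>m\<^sub>a\<^sub>x}. ereal (N (pred_state f g q \<tau>)) < R\<^sub>2"
      using pred inball by (auto simp: norm_ball_def)
    then show ?thesis using True by (simp add: tau_tilde_def)
  next
    case False
    then have out: "R\<^sub>2 \<le> ereal (N (pred_state f g q \<tau>))" using exit' pred \<tau> by auto
    then have "\<not> (\<forall>\<tau>\<in>{0<..<\<tau>\<^sub>m\<^sub>a\<^sub>x}. ereal (N (pred_state f g q \<tau>)) < R\<^sub>2)"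
      using False \<tau> by (auto simp: not_less intro!: bexI[of _ \<tau>])
    then have "tau_tilde f g N R\<^sub>2 \<tau>\<^sub>m\<^sub>a\<^sub>x q = Inf {\<tau>. 0 < \<tau> \<and> ereal (N (pred_state f g q \<tau>)) \<ge> R\<^sub>2}"
      unfolding tau_tilde_def by (rule if_not_P)
    also have "\<dots> = \<tau>"
    proof (rule cInf_eq_minimum)
      show "\<tau> \<in> {\<tau>. 0 < \<tau> \<and> ereal (N (pred_state f g q \<tau>)) \<ge> R\<^sub>2}" using \<tau> out by simp
      fix s assume "s \<in> {\<tau>. 0 < \<tau> \<and> ereal (N (pred_state f g q \<tau>)) \<ge> R\<^sub>2}"
      then show "\<tau> \<le> s"
        using pred[of s] inball[of s] by (force simp: norm_ball_def)
    qed
    finally show ?thesis .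
  qed
  then show ?thesis using that \<tau> y inball pred drift exit' by blast
qed

text \<open>If \<open>q\<close> lies in the ball shrunk by \<open>\<kappa>\<close>, the drift estimate keeps the predicted state in the ball
  until \<^const>\<open>tau_tilde_min\<close>, and keeps the trigger condition satisfied until \<^const>\<open>tau_min\<close>.\<close>

lemma sampling_interval:
  fixes N\<^sub>c\<^sub>l :: "real^'n \<Rightarrow> real"
  assumes \<tau>\<^sub>m\<^sub>a\<^sub>x: "0 < \<tau>\<^sub>m\<^sub>a\<^sub>x" and L: "0 \<le> L * (1 - \<rho>) / (1 + \<rho>)" "L * (1 - \<rho>) / (1 + \<rho>) < \<sigma> / \<Gamma>"
    and \<Gamma>: "0 < \<Gamma>" "N q \<le> \<Gamma> * N\<^sub>c\<^sub>l q" and "0 < \<sigma>"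
    and \<kappa>: "0 < \<kappa>" "\<kappa> < 1" and b: "0 < b" "ereal b \<le> R\<^sub>2" "N q \<le> \<kappa> * b"
    and T: "T = stm_interval f g N\<^sub>c\<^sub>l N R\<^sub>2 d\<^sub>1 L \<rho> \<sigma> \<tau>\<^sub>m\<^sub>a\<^sub>x q"
  shows "min \<tau>\<^sub>m\<^sub>a\<^sub>x (min (tau_min d\<^sub>1 d\<^sub>2 L \<rho> \<Gamma> \<sigma>) (tau_tilde_min d\<^sub>1 d\<^sub>2 \<kappa>)) \<le> T" and "T \<le> \<tau>\<^sub>m\<^sub>a\<^sub>x"
    and "\<exists>y. ivp_solution (held_field f g q) q T y \<and> (\<forall>s. 0 \<le> s \<longrightarrow> s < T \<longrightarrow> y s \<in> norm_ball N R\<^sub>2)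
      \<and> (\<forall>s. 0 < s \<longrightarrow> s < T \<longrightarrow>
            L * (1 - \<rho>) / (1 + \<rho>) * exp (d\<^sub>1 * s) * N q + N (y s - q) \<le> \<sigma> * N\<^sub>c\<^sub>l q)"
proof -
  define k where "k = L * (1 - \<rho>) / (1 + \<rho>)"
  define t\<^sub>1 where "t\<^sub>1 = tau_min d\<^sub>1 d\<^sub>2 L \<rho> \<Gamma> \<sigma>"
  define t\<^sub>2 where "t\<^sub>2 = tau_tilde_min d\<^sub>1 d\<^sub>2 \<kappa>"
  have Nq: "0 \<le> N q" by (rule is_norm_ge_0[OF norm_N])
  have "\<kappa> * b < 1 * b" using \<kappa>(2) b(1) by (rule mult_strict_right_mono)
  then have "ereal (N q) < ereal b" using b(3) by simp
  also note b(2)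
  finally have q: "q \<in> norm_ball N R\<^sub>2" by (simp add: norm_ball_def)
  obtain y \<tau> where tilde: "tau_tilde f g N R\<^sub>2 \<tau>\<^sub>m\<^sub>a\<^sub>x q = \<tau>" and \<tau>: "0 < \<tau>" "\<tau> \<le> \<tau>\<^sub>m\<^sub>a\<^sub>x"
    and y: "ivp_solution (held_field f g q) q \<tau> y"
    and inball: "\<And>s. 0 \<le> s \<Longrightarrow> s < \<tau> \<Longrightarrow> y s \<in> norm_ball N R\<^sub>2"
    and pred: "\<And>s. 0 \<le> s \<Longrightarrow> s \<le> \<tau> \<Longrightarrow> pred_state f g q s = y s"
    and dr: "\<And>s. 0 \<le> s \<Longrightarrow> s \<le> \<tau> \<Longrightarrow> N (y s - q) \<le> nu d\<^sub>1 d\<^sub>2 s * N q"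
    and exit: "\<tau> = \<tau>\<^sub>m\<^sub>a\<^sub>x \<or> R\<^sub>2 \<le> ereal (N (y \<tau>))"
  proof (rule prediction[OF q \<tau>\<^sub>m\<^sub>a\<^sub>x])
  qed (rule that)
  have low: "min \<tau>\<^sub>m\<^sub>a\<^sub>x t\<^sub>2 \<le> \<tau>"
  proof (rule ccontr)
    assume "\<not> ?thesis"
    then have less: "\<tau> < \<tau>\<^sub>m\<^sub>a\<^sub>x" "\<tau> < t\<^sub>2" by auto
    have "N (y \<tau>) \<le> N q * (1 + nu d\<^sub>1 d\<^sub>2 \<tau>)"
      using is_norm_triangle_sub[OF norm_N, of "y \<tau>" q] dr[of \<tau>] \<tau> by (simp add: algebra_simps)
    also have "\<dots> \<le> (\<kappa> * b) * (1 + nu d\<^sub>1 d\<^sub>2 \<tau>)"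
      using b(3) nu_nonneg[OF d\<^sub>1, of d\<^sub>2 \<tau>] d\<^sub>2 \<tau> by (intro mult_right_mono) auto
    also have "\<dots> = (\<kappa> * (1 + nu d\<^sub>1 d\<^sub>2 \<tau>)) * b" by (simp only: mult_ac)
    also have "\<dots> < 1 * b"
      using tau_tilde_min_props(2)[OF d\<^sub>1 d\<^sub>2 \<kappa>, of \<tau>] less \<tau> b(1)
      by (intro mult_strict_right_mono) (auto simp: t\<^sub>2_def)
    finally have "ereal (N (y \<tau>)) < ereal b" by simp
    then have "ereal (N (y \<tau>)) < R\<^sub>2" using b(2) by (rule less_le_trans)
    then show False using exit less by (auto simp: not_le[symmetric])
  qed
  have psi: "psi_log f g N L \<rho> d\<^sub>1 s q = k * exp (d\<^sub>1 * s) * N q + N (y s - q)" if "0 \<le> s" "s \<le> \<tau>" for s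
    using pred[OF that] by (simp add: psi_log_def k_def)
  have psi_ok: "psi_log f g N L \<rho> d\<^sub>1 s q \<le> \<sigma> * N\<^sub>c\<^sub>l q" if s: "0 \<le> s" "s \<le> \<tau>" "s \<le> t\<^sub>1" for s
  proof -
    have "psi_log f g N L \<rho> d\<^sub>1 s q \<le> (k * exp (d\<^sub>1 * s) + nu d\<^sub>1 d\<^sub>2 s) * N q"
      unfolding psi[OF s(1,2)] using dr[OF s(1,2)] by (simp add: distrib_right)
    also have "\<dots> \<le> (\<sigma> / \<Gamma>) * N q"
      using tau_min_props(2)[OF d\<^sub>1 d\<^sub>2 L, of s] s Nq by (intro mult_right_mono) (auto simp: t\<^sub>1_def k_def)
    also have "\<dots> \<le> (\<sigma> / \<Gamma>) * (\<Gamma> * N\<^sub>c\<^sub>l q)" using \<Gamma> \<open>0 < \<sigma>\<close> by (intro mult_left_mono) auto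
    also have "\<dots> = \<sigma> * N\<^sub>c\<^sub>l q" using \<Gamma>(1) by simp
    finally show ?thesis .
  qed
  have "min \<tau> t\<^sub>1 \<le> T \<and> T \<le> \<tau> \<and> (\<forall>s. 0 < s \<longrightarrow> s < T \<longrightarrow> psi_log f g N L \<rho> d\<^sub>1 s q \<le> \<sigma> * N\<^sub>c\<^sub>l q)"
  proof (cases "\<forall>s\<in>{0<..<\<tau>}. psi_log f g N L \<rho> d\<^sub>1 s q \<le> \<sigma> * N\<^sub>c\<^sub>l q")
    case True
    then have "T = \<tau>" by (simp add: T stm_interval_def tilde)
    then show ?thesis using True by auto
  next
    case False
    define V where "V = {s. 0 < s \<and> psi_log f g N L \<rho> d\<^sub>1 s q > \<sigma> * N\<^sub>c\<^sub>l q}"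
    have TV: "T = Inf V" using False by (auto simp: T stm_interval_def tilde V_def)
    have bV: "bdd_below V" by (rule bdd_belowI[of _ 0]) (auto simp: V_def)
    obtain s\<^sub>1 where s\<^sub>1: "s\<^sub>1 \<in> V" "s\<^sub>1 < \<tau>" using False by (auto simp: V_def not_le)
    have "T \<le> \<tau>" using cInf_lower[OF s\<^sub>1(1) bV] s\<^sub>1(2) TV by simp
    moreover have "min \<tau> t\<^sub>1 \<le> T"
      unfolding TV
    proof (rule cInf_greatest)
      show "V \<noteq> {}" using s\<^sub>1 by blast
      show "min \<tau> t\<^sub>1 \<le> s" if "s \<in> V" for s
        using psi_ok[of s] that by (force simp: V_def)
    qed
    moreover have "psi_log f g N L \<rho> d\<^sub>1 s q \<le> \<sigma> * N\<^sub>c\<^sub>l q" if "0 < s" "s < T" for s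
      using cInf_lower[OF _ bV, of s] that TV by (force simp: V_def not_le)
    ultimately show ?thesis by blast
  qed
  then have T: "min \<tau> t\<^sub>1 \<le> T" "T \<le> \<tau>"
    and ok: "\<And>s. 0 < s \<Longrightarrow> s < T \<Longrightarrow> psi_log f g N L \<rho> d\<^sub>1 s q \<le> \<sigma> * N\<^sub>c\<^sub>l q"
    by auto
  show "min \<tau>\<^sub>m\<^sub>a\<^sub>x (min (tau_min d\<^sub>1 d\<^sub>2 L \<rho> \<Gamma> \<sigma>) (tau_tilde_min d\<^sub>1 d\<^sub>2 \<kappa>)) \<le> T"
    using T low unfolding t\<^sub>1_def t\<^sub>2_def by linarith
  show "T \<le> \<tau>\<^sub>m\<^sub>a\<^sub>x" using T \<tau> by simp
  show "\<exists>y. ivp_solution (held_field f g q) q T y \<and> (\<forall>s. 0 \<le> s \<longrightarrow> s < T \<longrightarrow> y s \<in> norm_ball N R\<^sub>2)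
      \<and> (\<forall>s. 0 < s \<longrightarrow> s < T \<longrightarrow>
            L * (1 - \<rho>) / (1 + \<rho>) * exp (d\<^sub>1 * s) * N q + N (y s - q) \<le> \<sigma> * N\<^sub>c\<^sub>l q)"
  proof (intro exI[of _ y] conjI allI impI)
    show "ivp_solution (held_field f g q) q T y" by (rule ivp_solution_subinterval[OF y T(2)])
    show "y s \<in> norm_ball N R\<^sub>2" if "0 \<le> s" "s < T" for s using inball that T by simp
    show "L * (1 - \<rho>) / (1 + \<rho>) * exp (d\<^sub>1 * s) * N q + N (y s - q) \<le> \<sigma> * N\<^sub>c\<^sub>l q"
      if "0 < s" "s < T" for s
      using ok[OF that] psi[of s] that T by (simp add: k_def)
  qed
qed

end

section \<open>The closed loop\<close>

text \<open>These are the properties of the norms, the vector field, the quantizer and the mechanism from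
  which stability follows. The constants have the following meaning: \<open>r\<^sub>0\<close> is the radius of the admissible states at
  sampling times, \<open>k\<close> the relative quantization error, \<open>\<beta>\<close> the growth of the norm under
  quantization, \<open>\<kappa> R\<close> bounds the quantized states, and \<open>\<tau>\<^sub>l\<close> and \<open>\<tau>\<^sub>m\<^sub>a\<^sub>x\<close> bound the sampling intervals. The number \<open>\<alpha> \<sigma> \<beta> / c\<close> compares the
  perturbation of the closed-loop vector field by the measurement error with its contraction rate.\<close>

locale closed_loop = held_input f g N R\<^sub>2 d\<^sub>1 d\<^sub>2
  for f :: "(real^'n) \<times> (real^'m) \<Rightarrow> real^'n" and g :: "real^'n \<Rightarrow> real^'m"
    and N :: "real^'n \<Rightarrow> real" and R\<^sub>2 :: ereal and d\<^sub>1 d\<^sub>2 :: real +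
  fixes N\<^sub>c\<^sub>l :: "real^'n \<Rightarrow> real" and c \<alpha> \<sigma> R r\<^sub>0 k \<beta> \<kappa> \<tau>\<^sub>l \<tau>\<^sub>m\<^sub>a\<^sub>x :: real
    and Q :: "real^'n \<Rightarrow> real^'n" and T :: "real^'n \<Rightarrow> real"
  assumes norm_N\<^sub>c\<^sub>l: "is_norm N\<^sub>c\<^sub>l" and c: "0 < c" and \<alpha>: "0 < \<alpha>" and \<sigma>: "0 < \<sigma>" and \<beta>: "0 < \<beta>"
    and R: "0 < R" and r\<^sub>0: "r\<^sub>0 \<le> R" and \<kappa>: "\<kappa> < 1" and \<tau>\<^sub>l: "0 < \<tau>\<^sub>l"
    and small_gain: "\<alpha> * \<sigma> * \<beta> / c < 1"
    and inner_ball: "\<And>x. N\<^sub>c\<^sub>l x < R \<Longrightarrow> x \<in> norm_ball N R\<^sub>2"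
    and contraction: "\<And>x \<xi>. N\<^sub>c\<^sub>l x < R \<Longrightarrow> norming N\<^sub>c\<^sub>l x \<xi> \<Longrightarrow> \<xi> \<bullet> pert_field f g x 0 \<le> - c * N\<^sub>c\<^sub>l x"
    and perturbation: "\<And>x e. N\<^sub>c\<^sub>l x < R \<Longrightarrow> N e < \<sigma> * R \<Longrightarrow>
      N\<^sub>c\<^sub>l (pert_field f g x e - pert_field f g x 0) \<le> \<alpha> * N e"
    and quantizer: "\<And>x. N\<^sub>c\<^sub>l x < r\<^sub>0 \<Longrightarrow> N\<^sub>c\<^sub>l (Q x) \<le> \<kappa> * R"
      "\<And>x. N\<^sub>c\<^sub>l x < r\<^sub>0 \<Longrightarrow> N (x - Q x) \<le> k * N (Q x)"
      "\<And>x. N\<^sub>c\<^sub>l x < r\<^sub>0 \<Longrightarrow> N\<^sub>c\<^sub>l (Q x) \<le> \<beta> * N\<^sub>c\<^sub>l x"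
    and sampling: "\<And>q. N\<^sub>c\<^sub>l q \<le> \<kappa> * R \<Longrightarrow> \<tau>\<^sub>l \<le> T q" "\<And>q. N\<^sub>c\<^sub>l q \<le> \<kappa> * R \<Longrightarrow> T q \<le> \<tau>\<^sub>m\<^sub>a\<^sub>x"
      "\<And>q. N\<^sub>c\<^sub>l q \<le> \<kappa> * R \<Longrightarrow> \<exists>y. ivp_solution (held_field f g q) q (T q) y
        \<and> (\<forall>s. 0 \<le> s \<longrightarrow> s < T q \<longrightarrow> y s \<in> norm_ball N R\<^sub>2)
        \<and> (\<forall>s. 0 < s \<longrightarrow> s < T q \<longrightarrow> k * exp (d\<^sub>1 * s) * N q + N (y s - q) \<le> \<sigma> * N\<^sub>c\<^sub>l q)"
begin

definition gain :: real where "gain = \<alpha> * \<sigma> * \<beta> / c"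

lemma gain_bounds: "0 < gain" "gain < 1"
  using \<alpha> \<sigma> \<beta> c small_gain by (auto simp: gain_def)

definition decay :: "real \<Rightarrow> real" where "decay s = exp (- c * s) * (1 - gain) + gain"

lemma decay_le_1:
  assumes "0 \<le> s"
  shows "decay s \<le> 1"
proof -
  have "exp (- c * s) * (1 - gain) \<le> 1 * (1 - gain)"
    using assms c gain_bounds by (intro mult_right_mono) auto
  then show ?thesis by (simp add: decay_def)
qed

lemma N\<^sub>c\<^sub>l_nonneg: "0 \<le> N\<^sub>c\<^sub>l x"
  by (rule is_norm_ge_0[OF norm_N\<^sub>c\<^sub>l])

lemma quantized_in_ball: "N\<^sub>c\<^sub>l x < r\<^sub>0 \<Longrightarrow> N\<^sub>c\<^sub>l (Q x) < R"
  using quantizer(1)[of x] mult_strict_right_mono[OF \<kappa> R] by simp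

lemma sampling_interval_pos: "N\<^sub>c\<^sub>l x < r\<^sub>0 \<Longrightarrow> 0 < T (Q x)"
  using sampling(1)[OF quantizer(1)] \<tau>\<^sub>l by fastforce

text \<open>The mechanism cannot see \<open>x\<close>, but it bounds the measurement error \<open>q - z t\<close>: the distance of the
  state \<open>z t\<close> to the predicted state \<open>y t\<close> grows at most like \<open>exp (d\<^sub>1 t)\<close> from the quantization error,
  and the distance of \<open>y t\<close> to \<open>q\<close> is monitored. With \<open>e = q - z t\<close> the field is
  \<open>pert_field f g (z t) e\<close>, a perturbation of a contracting field.\<close>

lemma held_interval_estimate:
  assumes x: "N\<^sub>c\<^sub>l x < r\<^sub>0" and z: "curve_of (held_field f g (Q x)) S z" "z 0 = x"
    and S: "0 \<le> S" "S \<le> T (Q x)" and inball: "\<And>s. 0 < s \<Longrightarrow> s < S \<Longrightarrow> N\<^sub>c\<^sub>l (z s) < R"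
  shows "N\<^sub>c\<^sub>l (z S) \<le> decay S * N\<^sub>c\<^sub>l x"
proof -
  define q where "q = Q x"
  obtain y where y: "ivp_solution (held_field f g q) q (T q) y"
    and y_ball: "\<And>s. 0 \<le> s \<Longrightarrow> s < T q \<Longrightarrow> y s \<in> norm_ball N R\<^sub>2"
    and trigger: "\<And>s. 0 < s \<Longrightarrow> s < T q \<Longrightarrow> k * exp (d\<^sub>1 * s) * N q + N (y s - q) \<le> \<sigma> * N\<^sub>c\<^sub>l q"
    using sampling(3)[OF quantizer(1)[OF x]] unfolding q_def by blast
  have y0: "y 0 = q" using y by (simp add: ivp_solution_def)
  have q_ball: "q \<in> norm_ball N R\<^sub>2" using inner_ball quantized_in_ball[OF x] by (simp add: q_def)
  define b where "b = \<alpha> * \<sigma> * N\<^sub>c\<^sub>l q"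
  define M where "M = (\<lambda>s. exp (- c * s) * (N\<^sub>c\<^sub>l x - b / c) + b / c)"
  have "N\<^sub>c\<^sub>l (z S) \<le> M S"
  proof (rule norm_comparison[OF norm_N\<^sub>c\<^sub>l S(1), where u = z and u' = "\<lambda>s. held_field f g q (z s)" and a = "- c" and b = b])
    show "continuous_on {0..S} z" using z by (simp add: curve_of_def)
    fix t assume t: "0 < t" "t < S"
    show "(z has_vector_derivative held_field f g q (z t)) (at t)"
      using z t by (simp add: curve_of_def q_def)
    show "(M has_real_derivative - c * M t + b) (at t)"
      unfolding M_def using c by (auto intro!: derivative_eq_intros simp: field_simps)
    fix \<xi> assume \<xi>: "norming N\<^sub>c\<^sub>l (z t) \<xi>"
    define e where "e = q - z t"
    have "N (z t - y t) \<le> exp (d\<^sub>1 * t) * N (z 0 - y 0)"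
    proof (rule curves_diverge_at_most_exp[OF norm_N osl[OF q_ball]])
      show "curve_of (held_field f g q) t z" using curve_of_subinterval[OF z(1)] t by (simp add: q_def)
      show "curve_of (held_field f g q) t y"
        using ivp_solution_imp_curve_of[OF ivp_solution_subinterval[OF y]] t S by (simp add: q_def)
      show "z s \<in> norm_ball N R\<^sub>2" if "0 < s" "s < t" for s using inner_ball inball that t by simp
      show "y s \<in> norm_ball N R\<^sub>2" if "0 < s" "s < t" for s using y_ball that t S by (simp add: q_def)
    qed (use t in simp)
    also have "\<dots> \<le> exp (d\<^sub>1 * t) * (k * N q)"
      using quantizer(2)[OF x] by (intro mult_left_mono) (auto simp: q_def z(2) y0[unfolded q_def])
    finally have "N (z t - y t) \<le> k * exp (d\<^sub>1 * t) * N q" by (simp add: mult_ac)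
    moreover have "N e \<le> N (y t - q) + N (z t - y t)"
      using is_norm_triangle[OF norm_N, of "y t - q" "z t - y t"] is_norm_minus_commute[OF norm_N, of q "z t"]
      by (simp add: e_def)
    ultimately have e: "N e \<le> \<sigma> * N\<^sub>c\<^sub>l q" using trigger[of t] t S by (simp add: q_def)
    have "\<sigma> * N\<^sub>c\<^sub>l q < \<sigma> * R" using quantized_in_ball[OF x] \<sigma> by (simp add: q_def)
    then have "N\<^sub>c\<^sub>l (pert_field f g (z t) e - pert_field f g (z t) 0) \<le> \<alpha> * N e"
      using inball t e by (intro perturbation) auto
    also have "\<dots> \<le> b" using mult_left_mono[OF e, of \<alpha>] \<alpha> by (simp add: b_def mult.assoc)
    finally have "\<xi> \<bullet> (pert_field f g (z t) e - pert_field f g (z t) 0) \<le> b"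
      using normingD(1)[OF \<xi>] order_trans by blast
    moreover have "\<xi> \<bullet> pert_field f g (z t) 0 \<le> - c * N\<^sub>c\<^sub>l (z t)"
      using contraction[OF inball[OF t] \<xi>] .
    moreover have "held_field f g q (z t) = pert_field f g (z t) e"
      by (simp add: held_field_def pert_field_def e_def)
    ultimately show "\<xi> \<bullet> held_field f g q (z t) \<le> - c * N\<^sub>c\<^sub>l (z t) + b" by (simp add: inner_diff_right)
  next
    show "continuous_on {0..S} M" unfolding M_def by (intro continuous_intros)
    show "N\<^sub>c\<^sub>l (z 0) \<le> M 0" by (simp add: M_def z(2))
  qed
  also have "M S = exp (- c * S) * N\<^sub>c\<^sub>l x + (1 - exp (- c * S)) * (b / c)"
    by (simp add: M_def algebra_simps)
  also have "\<dots> \<le> exp (- c * S) * N\<^sub>c\<^sub>l x + (1 - exp (- c * S)) * (gain * N\<^sub>c\<^sub>l x)"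
  proof -
    have "b \<le> \<alpha> * \<sigma> * (\<beta> * N\<^sub>c\<^sub>l x)"
      unfolding b_def q_def using quantizer(3)[OF x] \<alpha> \<sigma> by (intro mult_left_mono) auto
    then have "b / c \<le> \<alpha> * \<sigma> * (\<beta> * N\<^sub>c\<^sub>l x) / c" using c by (intro divide_right_mono) auto
    then have "b / c \<le> gain * N\<^sub>c\<^sub>l x" by (simp add: gain_def mult.assoc)
    moreover have "exp (- c * S) \<le> 1" using c S by simp
    ultimately show ?thesis by (intro add_left_mono mult_left_mono) auto
  qed
  also have "\<dots> = decay S * N\<^sub>c\<^sub>l x" by (simp add: decay_def algebra_simps)
  finally show ?thesis .
qed

text \<open>Since the bound is below \<open>r\<^sub>0 \<le> R\<close>, the state cannot leave the ball in which the estimate was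
  derived.\<close>

lemma held_interval_estimate_le:
  assumes "N\<^sub>c\<^sub>l x < r\<^sub>0" "curve_of (held_field f g (Q x)) S z" "z 0 = x"
    and "0 \<le> S" "S \<le> T (Q x)" "\<And>s. 0 < s \<Longrightarrow> s < S \<Longrightarrow> N\<^sub>c\<^sub>l (z s) < R"
  shows "N\<^sub>c\<^sub>l (z S) < r\<^sub>0"
  using held_interval_estimate[OF assms] mult_right_mono[OF decay_le_1[OF assms(4)] N\<^sub>c\<^sub>l_nonneg[of x]] assms(1)
  by simp

lemma held_interval_decay:
  assumes x: "N\<^sub>c\<^sub>l x < r\<^sub>0" and z: "curve_of (held_field f g (Q x)) (T (Q x)) z" "z 0 = x"
    and s: "0 \<le> s" "s \<le> T (Q x)"
  shows "N\<^sub>c\<^sub>l (z s) < R" and "N\<^sub>c\<^sub>l (z s) \<le> decay s * N\<^sub>c\<^sub>l x"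
proof -
  have inball: "N\<^sub>c\<^sub>l (z s) < R" if s: "0 \<le> s" "s \<le> T (Q x)" for s
  proof -
    have "z s \<in> norm_ball N\<^sub>c\<^sub>l (ereal R)"
    proof (rule stays_in_open[OF _ open_norm_ball[OF norm_N\<^sub>c\<^sub>l] _ _ s])
      show "continuous_on {0..T (Q x)} z" using z by (simp add: curve_of_def)
      show "z 0 \<in> norm_ball N\<^sub>c\<^sub>l (ereal R)" using x z r\<^sub>0 by (simp add: norm_ball_def)
      fix s assume "0 < s" "s \<le> T (Q x)" "\<And>r. 0 \<le> r \<Longrightarrow> r < s \<Longrightarrow> z r \<in> norm_ball N\<^sub>c\<^sub>l (ereal R)"
      then show "z s \<in> norm_ball N\<^sub>c\<^sub>l (ereal R)"
        using held_interval_estimate_le[OF x curve_of_subinterval[OF z(1)] z(2), of s] r\<^sub>0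
        by (simp add: norm_ball_def)
    qed
    then show ?thesis by (simp add: norm_ball_def)
  qed
  then show "N\<^sub>c\<^sub>l (z s) < R" using s by blast
  show "N\<^sub>c\<^sub>l (z s) \<le> decay s * N\<^sub>c\<^sub>l x"
    using held_interval_estimate[OF x curve_of_subinterval[OF z(1)] z(2)] inball s by simp
qed

text \<open>A solution that stopped before the end of the interval would have reached the boundary of the
  \<open>R\<close>-ball, contrary to the estimate.\<close>

lemma held_interval_exists:
  assumes x: "N\<^sub>c\<^sub>l x < r\<^sub>0"
  shows "\<exists>z. ivp_solution (held_field f g (Q x)) x (T (Q x)) z"
proof -
  have "N\<^sub>c\<^sub>l x < R" using x r\<^sub>0 by simp
  then obtain z \<tau> where \<tau>: "0 < \<tau>" "\<tau> \<le> T (Q x)" and z: "ivp_solution (held_field f g (Q x)) x \<tau> z"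
    and below: "\<And>s. 0 \<le> s \<Longrightarrow> s < \<tau> \<Longrightarrow> N\<^sub>c\<^sub>l (z s) < R" and exit: "\<tau> = T (Q x) \<or> N\<^sub>c\<^sub>l (z \<tau>) = R"
    using solution_until_exit[OF norm_N\<^sub>c\<^sub>l held_field_continuous _ sampling_interval_pos[OF x]] by blast
  have "N\<^sub>c\<^sub>l (z \<tau>) < r\<^sub>0"
    using held_interval_estimate_le[OF x ivp_solution_imp_curve_of[OF z]] z \<tau> below
    by (simp add: ivp_solution_def)
  then have "\<tau> = T (Q x)" using exit r\<^sub>0 by auto
  then show ?thesis using z by blast
qed

lemma held_interval_unique:
  assumes x: "N\<^sub>c\<^sub>l x < r\<^sub>0" and y: "curve_of (held_field f g (Q x)) (T (Q x)) y" "y 0 = x"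
    and z: "curve_of (held_field f g (Q x)) (T (Q x)) z" "z 0 = x" and s: "0 \<le> s" "s \<le> T (Q x)"
  shows "z s = y s"
proof (rule curve_of_unique[OF norm_N osl open_norm_ball[OF norm_N] y(1) _ z(1) _ s])
  show "Q x \<in> norm_ball N R\<^sub>2" using inner_ball quantized_in_ball[OF x] by simp
  show "y r \<in> norm_ball N R\<^sub>2" if "0 \<le> r" "r < T (Q x)" for r
    using held_interval_decay(1)[OF x y] that inner_ball by simp
qed (use y z in simp)

end

section \<open>Trajectories of the closed loop\<close>

lemma has_vector_derivative_shift:
  fixes y :: "real \<Rightarrow> 'a::real_normed_vector"
  assumes "(y has_vector_derivative d) (at (s + b) within (\<lambda>r. r + b) ` S)"
  shows "((\<lambda>r. y (r + b)) has_vector_derivative d) (at s within S)"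
proof -
  have "((\<lambda>r. r + b) has_vector_derivative 1) (at s within S)"
    by (auto intro!: derivative_eq_intros)
  from vector_derivative_diff_chain_within[OF this assms[unfolded has_vector_derivative_def]]
  show ?thesis by (simp add: o_def)
qed

context closed_loop
begin

text \<open>With \<open>\<theta> = s / \<tau>\<close> and \<open>Y = decay \<tau>\<close>, the claim is \<open>(1 - gain) exp (- c \<tau>)\<^sup>\<theta> + gain \<le> Y\<^sup>\<theta>\<close>. Divided by
  \<open>Y\<^sup>\<theta>\<close>, it follows from \<open>u\<^sup>\<theta> \<le> 1 - \<theta> + \<theta> u\<close> for \<open>u = exp (- c \<tau>) / Y\<close> and \<open>u = 1 / Y\<close>.\<close>

lemma decay_le_exp:
  assumes s: "0 \<le> s" "s \<le> \<tau>" and "0 < \<tau>" and \<gamma>: "\<gamma> = - 1 / \<tau> * ln (decay \<tau>)"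
  shows "decay s \<le> exp (- \<gamma> * s)"
proof -
  define Y where "Y = decay \<tau>"
  have Y: "0 < Y" using gain_bounds by (simp add: Y_def decay_def add_nonneg_pos)
  define \<theta> where "\<theta> = s / \<tau>"
  have \<theta>: "0 \<le> \<theta>" "\<theta> \<le> 1" "s = \<theta> * \<tau>" using assms by (auto simp: \<theta>_def)
  have convex: "exp (\<theta> * v) \<le> 1 - \<theta> + \<theta> * exp v" for v :: real
    using convex_onD[OF exp_convex \<theta>(1,2), of 0 v] by simp
  define E where "E = exp (\<theta> * - ln Y)"
  have "- \<gamma> * s = \<theta> * ln Y" using \<open>0 < \<tau>\<close> by (simp add: \<gamma> Y_def \<theta>(3))
  then have inv: "exp (- \<gamma> * s) * E = 1" unfolding E_def by (simp flip: exp_add)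
  have "exp (- c * s) * E = exp (- c * s + \<theta> * - ln Y)" unfolding E_def by (rule exp_add[symmetric])
  also have "- c * s + \<theta> * - ln Y = \<theta> * (- c * \<tau> - ln Y)" by (simp add: \<theta>(3) algebra_simps)
  finally have "exp (- c * s) * E = exp (\<theta> * (- c * \<tau> - ln Y))" .
  moreover have "decay s * E = (1 - gain) * (exp (- c * s) * E) + gain * E"
    by (simp add: decay_def algebra_simps)
  ultimately have "decay s * E = (1 - gain) * exp (\<theta> * (- c * \<tau> - ln Y)) + gain * exp (\<theta> * - ln Y)"
    by (simp add: E_def)
  also have "\<dots> \<le> (1 - gain) * (1 - \<theta> + \<theta> * exp (- c * \<tau> - ln Y)) + gain * (1 - \<theta> + \<theta> * exp (- ln Y))"
    using gain_bounds by (intro add_mono mult_left_mono convex) auto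
  also have "\<dots> = 1 - \<theta> + \<theta> * (((1 - gain) * exp (- c * \<tau>) + gain) / Y)"
    using Y by (simp add: exp_diff exp_minus field_simps)
  also have "(1 - gain) * exp (- c * \<tau>) + gain = Y" by (simp add: Y_def decay_def mult.commute)
  also have "1 - \<theta> + \<theta> * (Y / Y) = exp (- \<gamma> * s) * E" using Y inv by simp
  finally show ?thesis by (rule mult_right_le_imp_le) (simp add: E_def)
qed

lemma rate_pos:
  assumes "0 < \<tau>" "\<gamma> = - 1 / \<tau> * ln (decay \<tau>)"
  shows "0 < \<gamma>"
proof -
  have "exp (- c * \<tau>) * (1 - gain) < 1 * (1 - gain)"
    using gain_bounds c assms(1) by (intro mult_strict_right_mono) auto
  then have "decay \<tau> < 1" by (simp add: decay_def)
  moreover have "0 < decay \<tau>" using gain_bounds by (simp add: decay_def add_nonneg_pos)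
  ultimately show ?thesis using assms by (simp add: divide_less_0_iff)
qed

lemma \<tau>\<^sub>m\<^sub>a\<^sub>x_pos: "N\<^sub>c\<^sub>l x < r\<^sub>0 \<Longrightarrow> 0 < \<tau>\<^sub>m\<^sub>a\<^sub>x"
  using sampling(2)[OF quantizer(1), of x] sampling_interval_pos[of x] by simp

abbreviation trajectory :: "real^'n \<Rightarrow> (nat \<Rightarrow> real) \<Rightarrow> (real \<Rightarrow> real^'n) \<Rightarrow> bool" where
  "trajectory \<equiv> closed_loop_trajectory f g Q T"

lemma
  assumes "trajectory x\<^sub>0 t x"
  shows trajectory_time: "t 0 = 0" "t (Suc j) = t j + T (Q (x (t j)))"
    and trajectory_start: "x 0 = x\<^sub>0"
    and trajectory_continuous: "continuous_on (\<Union>k. {t k..t (Suc k)}) x"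
    and trajectory_derivative: "s \<in> {t j..<t (Suc j)} \<Longrightarrow>
      (x has_vector_derivative f (x s, g (Q (x (t j))))) (at s within {t j..<t (Suc j)})"
  using assms unfolding closed_loop_trajectory_def by blast+

lemma trajectory_on_interval:
  assumes "trajectory x\<^sub>0 t x"
  shows "curve_of (held_field f g (Q (x (t j)))) (T (Q (x (t j)))) (\<lambda>s. x (s + t j))"
  unfolding curve_of_def
proof (intro conjI allI impI)
  define \<tau> where "\<tau> = T (Q (x (t j)))"
  have next_t: "t (Suc j) = t j + \<tau>" unfolding \<tau>_def by (rule trajectory_time(2)[OF assms])
  have "continuous_on {t j..t (Suc j)} x"
    by (rule continuous_on_subset[OF trajectory_continuous[OF assms]]) blast
  then show "continuous_on {0..\<tau>} (\<lambda>s. x (s + t j))"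
    by (rule continuous_on_compose2) (auto intro!: continuous_intros simp: next_t)
  fix s assume s: "0 < s" "s < \<tau>"
  have "(x has_vector_derivative f (x (s + t j), g (Q (x (t j))))) (at (s + t j) within {t j..<t (Suc j)})"
    using s by (intro trajectory_derivative[OF assms]) (simp add: next_t)
  moreover have "at (s + t j) within {t j..<t (Suc j)} = at (s + t j)"
    using s next_t by (intro at_within_interior) simp
  ultimately have "(x has_vector_derivative f (x (s + t j), g (Q (x (t j))))) (at (s + t j))" by simp
  then show "((\<lambda>s. x (s + t j)) has_vector_derivative held_field f g (Q (x (t j))) (x (s + t j))) (at s)"
    using has_vector_derivative_shift[of x _ s "t j" UNIV]
    by (simp add: held_field_def has_vector_derivative_at_within)
qed

lemma trajectory_decay_on_interval:
  assumes traj: "trajectory x\<^sub>0 t x" and small: "N\<^sub>c\<^sub>l (x (t j)) < r\<^sub>0" and \<gamma>: "\<gamma> = - 1 / \<tau>\<^sub>m\<^sub>a\<^sub>x * ln (decay \<tau>\<^sub>m\<^sub>a\<^sub>x)"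
    and s: "s \<in> {t j..t (Suc j)}"
  shows "N\<^sub>c\<^sub>l (x s) \<le> exp (- \<gamma> * (s - t j)) * N\<^sub>c\<^sub>l (x (t j))"
proof -
  note next_t = trajectory_time(2)[OF traj, of j]
  have "N\<^sub>c\<^sub>l (x (s - t j + t j)) \<le> decay (s - t j) * N\<^sub>c\<^sub>l (x (t j))"
    using s by (intro held_interval_decay(2)[OF small trajectory_on_interval[OF traj]]) (auto simp: next_t)
  also have "\<dots> \<le> exp (- \<gamma> * (s - t j)) * N\<^sub>c\<^sub>l (x (t j))"
    using s next_t sampling(2)[OF quantizer(1)[OF small]]
    by (intro mult_right_mono decay_le_exp[OF _ _ \<tau>\<^sub>m\<^sub>a\<^sub>x_pos[OF small] \<gamma>] N\<^sub>c\<^sub>l_nonneg) auto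
  finally show ?thesis by simp
qed

text \<open>The decay on the previous intervals brings the state back into the range of the quantizer, which
  the estimate on the next interval needs; so both are proved by one induction.\<close>

lemma trajectory_at_sampling_times:
  assumes traj: "trajectory x\<^sub>0 t x" and x\<^sub>0: "N\<^sub>c\<^sub>l x\<^sub>0 < r\<^sub>0" and \<gamma>: "\<gamma> = - 1 / \<tau>\<^sub>m\<^sub>a\<^sub>x * ln (decay \<tau>\<^sub>m\<^sub>a\<^sub>x)"
  shows "N\<^sub>c\<^sub>l (x (t j)) \<le> exp (- \<gamma> * t j) * N\<^sub>c\<^sub>l x\<^sub>0" and "N\<^sub>c\<^sub>l (x (t j)) < r\<^sub>0" and "0 \<le> t j"
proof -
  have small: "N\<^sub>c\<^sub>l (x (t j)) < r\<^sub>0" if "N\<^sub>c\<^sub>l (x (t j)) \<le> exp (- \<gamma> * t j) * N\<^sub>c\<^sub>l x\<^sub>0" "0 \<le> t j" for j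
  proof -
    have "0 \<le> \<gamma> * t j" using rate_pos[OF \<tau>\<^sub>m\<^sub>a\<^sub>x_pos[OF x\<^sub>0] \<gamma>] that(2) by simp
    then have "exp (- \<gamma> * t j) * N\<^sub>c\<^sub>l x\<^sub>0 \<le> 1 * N\<^sub>c\<^sub>l x\<^sub>0" by (intro mult_right_mono N\<^sub>c\<^sub>l_nonneg) auto
    then show ?thesis using that(1) x\<^sub>0 by simp
  qed
  have "N\<^sub>c\<^sub>l (x (t j)) \<le> exp (- \<gamma> * t j) * N\<^sub>c\<^sub>l x\<^sub>0 \<and> 0 \<le> t j"
  proof (induction j)
    case 0
    then show ?case by (simp add: trajectory_time(1)[OF traj] trajectory_start[OF traj])
  next
    case (Suc j)
    have sm: "N\<^sub>c\<^sub>l (x (t j)) < r\<^sub>0" using Suc by (intro small) auto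
    note next_t = trajectory_time(2)[OF traj, of j]
    have "N\<^sub>c\<^sub>l (x (t (Suc j))) \<le> exp (- \<gamma> * (t (Suc j) - t j)) * N\<^sub>c\<^sub>l (x (t j))"
      using sampling_interval_pos[OF sm] by (intro trajectory_decay_on_interval[OF traj sm \<gamma>]) (simp add: next_t)
    also have "\<dots> \<le> exp (- \<gamma> * (t (Suc j) - t j)) * (exp (- \<gamma> * t j) * N\<^sub>c\<^sub>l x\<^sub>0)"
      using Suc by (intro mult_left_mono) auto
    also have "\<dots> = exp (- \<gamma> * t (Suc j)) * N\<^sub>c\<^sub>l x\<^sub>0" by (simp add: algebra_simps flip: exp_add mult.assoc)
    finally show ?case using Suc sampling_interval_pos[OF sm] by (simp add: next_t)
  qed
  then show "N\<^sub>c\<^sub>l (x (t j)) \<le> exp (- \<gamma> * t j) * N\<^sub>c\<^sub>l x\<^sub>0" "N\<^sub>c\<^sub>l (x (t j)) < r\<^sub>0" "0 \<le> t j"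
    using small by auto
qed

lemma steps_cover:
  fixes t :: "nat \<Rightarrow> real"
  assumes "t 0 = 0" and step: "\<And>j. \<tau>\<^sub>l \<le> t (Suc j) - t j" and "0 \<le> s"
  shows "\<exists>j. t j \<le> s \<and> s < t (Suc j)"
proof -
  have grow: "real j * \<tau>\<^sub>l \<le> t j" for j
  proof (induction j)
    case (Suc j)
    then show ?case using step[of j] by (simp add: algebra_simps)
  qed (simp add: assms(1))
  obtain n where n: "s < real n * \<tau>\<^sub>l" using reals_Archimedean3[OF \<tau>\<^sub>l] by blast
  then have ex: "s < t n" using grow[of n] by linarith
  define m where "m = (LEAST j. s < t j)"
  have m: "s < t m" unfolding m_def by (rule LeastI[of "\<lambda>j. s < t j", OF ex])
  then obtain j where "m = Suc j" using assms(1,3) by (cases m) auto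
  then have "\<not> s < t j" using not_less_Least[of j "\<lambda>j. s < t j"] by (simp add: m_def)
  then show ?thesis using m \<open>m = Suc j\<close> by (intro exI[of _ j]) auto
qed

lemma trajectory_step:
  assumes "trajectory x\<^sub>0 t x" "N\<^sub>c\<^sub>l x\<^sub>0 < r\<^sub>0"
  shows "\<tau>\<^sub>l \<le> t (Suc j) - t j"
  using sampling(1)[OF quantizer(1)[OF trajectory_at_sampling_times(2)[OF assms refl, of j]]]
  by (simp add: trajectory_time(2)[OF assms(1)])

lemma trajectory_covers:
  assumes "trajectory x\<^sub>0 t x" "N\<^sub>c\<^sub>l x\<^sub>0 < r\<^sub>0" "0 \<le> s"
  shows "\<exists>j. t j \<le> s \<and> s < t (Suc j)"
  by (intro steps_cover trajectory_step[OF assms(1,2)] assms(3) trajectory_time(1)[OF assms(1)])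

lemma trajectory_decay:
  assumes traj: "trajectory x\<^sub>0 t x" and x\<^sub>0: "N\<^sub>c\<^sub>l x\<^sub>0 < r\<^sub>0" and \<gamma>: "\<gamma> = - 1 / \<tau>\<^sub>m\<^sub>a\<^sub>x * ln (decay \<tau>\<^sub>m\<^sub>a\<^sub>x)"
    and s: "0 \<le> s"
  shows "N\<^sub>c\<^sub>l (x s) \<le> exp (- \<gamma> * s) * N\<^sub>c\<^sub>l x\<^sub>0"
proof -
  obtain j where j: "t j \<le> s" "s < t (Suc j)" using trajectory_covers[OF traj x\<^sub>0 s] by blast
  have "N\<^sub>c\<^sub>l (x s) \<le> exp (- \<gamma> * (s - t j)) * N\<^sub>c\<^sub>l (x (t j))"
    using trajectory_decay_on_interval[OF traj trajectory_at_sampling_times(2)[OF traj x\<^sub>0 \<gamma>] \<gamma>] j by simp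
  also have "\<dots> \<le> exp (- \<gamma> * (s - t j)) * (exp (- \<gamma> * t j) * N\<^sub>c\<^sub>l x\<^sub>0)"
    using trajectory_at_sampling_times(1)[OF traj x\<^sub>0 \<gamma>] by (intro mult_left_mono) auto
  also have "\<dots> = exp (- \<gamma> * s) * N\<^sub>c\<^sub>l x\<^sub>0" by (simp add: algebra_simps flip: exp_add mult.assoc)
  finally show ?thesis .
qed

lemma trajectory_unique:
  assumes x: "trajectory x\<^sub>0 t x" and y: "trajectory x\<^sub>0 u y" and x\<^sub>0: "N\<^sub>c\<^sub>l x\<^sub>0 < r\<^sub>0"
  shows "u = t" and "\<And>s. 0 \<le> s \<Longrightarrow> y s = x s"
proof -
  have interval: "y s = x s" if eq: "u j = t j" "y (t j) = x (t j)" and s: "t j \<le> s" "s \<le> t (Suc j)" for j s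
  proof -
    have "y (s - t j + t j) = x (s - t j + t j)"
    proof (rule held_interval_unique[where x = "x (t j)" and y = "\<lambda>s. x (s + t j)"
          and z = "\<lambda>s. y (s + t j)" and s = "s - t j"])
      show "N\<^sub>c\<^sub>l (x (t j)) < r\<^sub>0" by (rule trajectory_at_sampling_times(2)[OF x x\<^sub>0 refl])
      show "curve_of (held_field f g (Q (x (t j)))) (T (Q (x (t j)))) (\<lambda>s. x (s + t j))"
        by (rule trajectory_on_interval[OF x])
      show "curve_of (held_field f g (Q (x (t j)))) (T (Q (x (t j)))) (\<lambda>s. y (s + t j))"
        using trajectory_on_interval[OF y, of j] eq by simp
    qed (use eq s trajectory_time(2)[OF x, of j] in auto)
    then show ?thesis by simp
  qed
  have times: "u j = t j \<and> y (t j) = x (t j)" for j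
  proof (induction j)
    case 0
    then show ?case
      by (simp add: trajectory_time(1)[OF x] trajectory_time(1)[OF y] trajectory_start[OF x] trajectory_start[OF y])
  next
    case (Suc j)
    have "u (Suc j) = t (Suc j)"
      using Suc by (simp only: trajectory_time(2)[OF x] trajectory_time(2)[OF y])
    moreover have "t j \<le> t (Suc j)" using trajectory_step[OF x x\<^sub>0, of j] \<tau>\<^sub>l by simp
    ultimately show ?case using interval[of j "t (Suc j)"] Suc by simp
  qed
  then show "u = t" by auto
  fix s :: real assume "0 \<le> s"
  then obtain j where "t j \<le> s" "s < t (Suc j)" using trajectory_covers[OF x x\<^sub>0] by blast
  then show "y s = x s" using interval[of j s] times[of j] by simp
qed

text \<open>The pieces on the sampling intervals are put together. Piece \<open>j\<close> describes the trajectory on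
  the closed interval, since piece \<open>j + 1\<close> starts where it ends.\<close>

lemma trajectory_exists:
  assumes x\<^sub>0: "N\<^sub>c\<^sub>l x\<^sub>0 < r\<^sub>0"
  shows "\<exists>t x. trajectory x\<^sub>0 t x"
proof -
  \<comment> \<open>\<open>\<Phi> x\<close> is the solution on the sampling interval that starts at \<open>x\<close>, and \<open>X\<close> and \<open>t\<close> are the states
    and the times at which these intervals start.\<close>
  define \<Phi> where "\<Phi> = (\<lambda>x. SOME z. ivp_solution (held_field f g (Q x)) x (T (Q x)) z)"
  have \<Phi>: "ivp_solution (held_field f g (Q x)) x (T (Q x)) (\<Phi> x)" if "N\<^sub>c\<^sub>l x < r\<^sub>0" for x
    unfolding \<Phi>_def by (rule someI_ex[OF held_interval_exists[OF that]])
  define X where "X = rec_nat x\<^sub>0 (\<lambda>_ x. \<Phi> x (T (Q x)))"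
  have X: "X 0 = x\<^sub>0" "X (Suc j) = \<Phi> (X j) (T (Q (X j)))" for j by (simp_all add: X_def)
  have small: "N\<^sub>c\<^sub>l (X j) < r\<^sub>0" for j
  proof (induction j)
    case (Suc j)
    have "N\<^sub>c\<^sub>l (\<Phi> (X j) (T (Q (X j)))) < r\<^sub>0"
    proof (rule held_interval_estimate_le[OF Suc])
      show curve: "curve_of (held_field f g (Q (X j))) (T (Q (X j))) (\<Phi> (X j))"
        by (rule ivp_solution_imp_curve_of[OF \<Phi>[OF Suc]])
      show start: "\<Phi> (X j) 0 = X j" using \<Phi>[OF Suc] by (simp add: ivp_solution_def)
      show "N\<^sub>c\<^sub>l (\<Phi> (X j) s) < R" if "0 < s" "s < T (Q (X j))" for s
        using held_interval_decay(1)[OF Suc curve start] that by simp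
    qed (use sampling_interval_pos[OF Suc] in auto)
    then show ?case by (simp add: X(2))
  qed (simp add: X x\<^sub>0)
  define t where "t = (\<lambda>j. \<Sum>i<j. T (Q (X i)))"
  have t: "t 0 = 0" "t (Suc j) = t j + T (Q (X j))" for j by (simp_all add: t_def)
  have step: "\<tau>\<^sub>l \<le> t (Suc j) - t j" for j
    using sampling(1)[OF quantizer(1)[OF small[of j]]] by (simp add: t(2))
  have t_less: "t j < t (Suc j)" for j using step[of j] \<tau>\<^sub>l by simp
  have inc: "t i \<le> t j" if "i \<le> j" for i j
    by (rule lift_Suc_mono_le[of t, OF less_imp_le[OF t_less] that])
  define I where "I = (\<lambda>s. LEAST j. s < t (Suc j))"
  define x where "x = (\<lambda>s. \<Phi> (X (I s)) (s - t (I s)))"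
  have x_open: "x s = \<Phi> (X j) (s - t j)" if "t j \<le> s" "s < t (Suc j)" for s j
  proof -
    have "I s = j"
      unfolding I_def
    proof (rule Least_equality)
      show "j \<le> i" if "s < t (Suc i)" for i
      proof (rule ccontr)
        assume "\<not> j \<le> i"
        then have "t (Suc i) \<le> t j" by (intro inc) simp
        then show False using that \<open>t j \<le> s\<close> by simp
      qed
    qed (rule that(2))
    then show ?thesis by (simp add: x_def)
  qed
  have xt: "x (t j) = X j" for j
    using x_open[of j "t j"] t_less \<Phi>[OF small[of j]] by (simp add: ivp_solution_def)
  have x_closed: "x s = \<Phi> (X j) (s - t j)" if "s \<in> {t j..t (Suc j)}" for s j
  proof (cases "s = t (Suc j)")
    case True
    then show ?thesis using xt[of "Suc j"] by (simp add: X(2) t(2))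
  next
    case False
    then show ?thesis using x_open that by simp
  qed
  have piece: "(x has_vector_derivative f (x s, g (Q (x (t j))))) (at s within {t j..t (Suc j)})"
    if s: "s \<in> {t j..t (Suc j)}" for s j
  proof -
    have "(\<Phi> (X j) has_vector_derivative f (\<Phi> (X j) (s - t j), g (Q (X j)))) (at (s - t j) within {0..T (Q (X j))})"
      using \<Phi>[OF small[of j]] s by (auto simp: ivp_solution_def held_field_def t(2))
    then have "(\<Phi> (X j) has_vector_derivative f (\<Phi> (X j) (s - t j), g (Q (X j))))
        (at (s + - t j) within (\<lambda>r. r + - t j) ` {t j..t (Suc j)})"
      by (simp add: t(2))
    from has_vector_derivative_shift[OF this]
    have "((\<lambda>r. \<Phi> (X j) (r - t j)) has_vector_derivative f (x s, g (Q (x (t j))))) (at s within {t j..t (Suc j)})"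
      using x_closed[OF s] by (simp add: xt)
    then show ?thesis by (rule has_vector_derivative_transform[OF s, rotated]) (rule x_closed)
  qed
  have cover: "(\<Union>j. {t j..t (Suc j)}) = {0..}"
  proof (intro equalityI subsetI)
    fix s assume "s \<in> (\<Union>j. {t j..t (Suc j)})"
    then obtain j where "t j \<le> s" by auto
    then show "s \<in> {0..}" using inc[of 0 j] t(1) by simp
  next
    fix s :: real assume "s \<in> {0..}"
    then show "s \<in> (\<Union>j. {t j..t (Suc j)})" using steps_cover[OF t(1) step, of s] by force
  qed
  have initial: "continuous_on {0..t n} x" for n
  proof (induction n)
    case (Suc n)
    have "continuous_on {t n..t (Suc n)} x" using piece by (rule continuous_on_vector_derivative)
    then have "continuous_on ({0..t n} \<union> {t n..t (Suc n)}) x" using Suc by (intro continuous_on_closed_Un) auto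
    moreover have "{0..t n} \<union> {t n..t (Suc n)} = {0..t (Suc n)}"
      using inc[of 0 n] t_less[of n] t(1) by (intro ivl_disj_un_two_touch) auto
    ultimately show ?case by simp
  qed (simp add: t)
  have "continuous_on {0..} x"
    unfolding continuous_on_eq_continuous_within
  proof
    fix s :: real assume s: "s \<in> {0..}"
    then obtain n where n: "s < t n" using steps_cover[OF t(1) step, of s] by auto
    have "continuous (at s within {0..t n}) x"
      using initial[of n] s n by (simp add: continuous_on_eq_continuous_within)
    moreover have "at s within {0..} = at s within {0..t n}"
      using n by (intro at_within_nhd[of s "{..<t n}"]) auto
    ultimately show "continuous (at s within {0..}) x" by simp
  qed
  then have "continuous_on (\<Union>j. {t j..t (Suc j)}) x" by (simp only: cover)
  moreover have "(x has_vector_derivative f (x s, g (Q (x (t j))))) (at s within {t j..<t (Suc j)})"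
    if "s \<in> {t j..<t (Suc j)}" for s j
    using that by (intro has_vector_derivative_within_subset[OF piece]) auto
  ultimately have "trajectory x\<^sub>0 t x"
    unfolding closed_loop_trajectory_def using t xt[of 0] X(1) by (simp add: xt)
  then show ?thesis by blast
qed

lemma trajectory_prediction_exists:
  assumes "trajectory x\<^sub>0 t x" "N\<^sub>c\<^sub>l x\<^sub>0 < r\<^sub>0"
  shows "N\<^sub>c\<^sub>l (Q (x (t j))) < R"
    and "ivp_exists_uniquely (held_field f g (Q (x (t j)))) (Q (x (t j))) (t (Suc j) - t j)"
proof -
  have small: "N\<^sub>c\<^sub>l (x (t j)) < r\<^sub>0" by (rule trajectory_at_sampling_times(2)[OF assms refl])
  show lt: "N\<^sub>c\<^sub>l (Q (x (t j))) < R" by (rule quantized_in_ball[OF small])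
  have "t (Suc j) - t j = T (Q (x (t j)))" by (simp add: trajectory_time(2)[OF assms(1)])
  then show "ivp_exists_uniquely (held_field f g (Q (x (t j)))) (Q (x (t j))) (t (Suc j) - t j)"
    using sampling(3)[OF quantizer(1)[OF small]] sampling_interval_pos[OF small]
      ivp_exists_uniquely_and_value(1)[OF norm_N osl[OF inner_ball[OF lt]] open_norm_ball[OF norm_N]]
    by auto
qed

end

theorem theorem4p3:
  fixes f :: "(real^'n) \<times> (real^'m) \<Rightarrow> real^'n" and g :: "real^'n \<Rightarrow> real^'m"
    and N\<^sub>c\<^sub>l N\<^sub>o\<^sub>p :: "real^'n \<Rightarrow> real"
    and R\<^sub>1 R\<^sub>2 R r :: ereal
    and c d\<^sub>1 d\<^sub>2 \<Gamma> \<alpha> \<sigma>\<^sub>0 \<sigma>\<^sub>1 \<sigma> \<rho> \<chi>\<^sub>0 \<kappa> \<gamma> \<tau>\<^sub>m\<^sub>a\<^sub>x :: real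
    and L\<^sub>c\<^sub>l\<^sub>1 L\<^sub>c\<^sub>l\<^sub>2 L\<^sub>o\<^sub>p\<^sub>1 L\<^sub>o\<^sub>p\<^sub>2 L\<^sub>c\<^sub>l L\<^sub>o\<^sub>p :: real
    and \<theta>\<^sub>c\<^sub>l \<theta>\<^sub>o\<^sub>p X\<^sub>0 x\<^sub>0 :: "real^'n"
    and Q :: "real^'n \<Rightarrow> real^'n" and T :: "real^'n \<Rightarrow> real"
  assumes f_cont: "continuous_on UNIV f" and g_cont: "continuous_on UNIV g"
    and equilibrium: "f (0, g 0) = 0"
    \<comment> \<open>(A1)\<close>
    and "is_norm N\<^sub>c\<^sub>l" and "0 < c" and "0 < R\<^sub>1"
    and "local_lipschitz (UNIV :: real set) (norm_ball N\<^sub>c\<^sub>l R\<^sub>1) (\<lambda>_ x. pert_field f g x 0)"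
    and "AE x in lebesgue. x \<in> norm_ball N\<^sub>c\<^sub>l R\<^sub>1 \<longrightarrow>
           (\<lambda>y. pert_field f g y 0) differentiable (at x) \<and>
           log_norm N\<^sub>c\<^sub>l (jacobian (\<lambda>y. pert_field f g y 0) (at x)) \<le> - c"
    \<comment> \<open>(A2)\<close>
    and "is_norm N\<^sub>o\<^sub>p" and "0 \<le> d\<^sub>1" and "0 < d\<^sub>2" and "0 < R\<^sub>2"
    and "\<forall>q\<in>norm_ball N\<^sub>o\<^sub>p R\<^sub>2. cont_differentiable_on (norm_ball N\<^sub>o\<^sub>p R\<^sub>2) (held_field f g q)"
    and "\<forall>x\<in>norm_ball N\<^sub>o\<^sub>p R\<^sub>2. \<forall>q\<in>norm_ball N\<^sub>o\<^sub>p R\<^sub>2.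
           log_norm N\<^sub>o\<^sub>p (jacobian (held_field f g q) (at x)) \<le> d\<^sub>1"
    and "\<forall>q\<in>norm_ball N\<^sub>o\<^sub>p R\<^sub>2. N\<^sub>o\<^sub>p (held_field f g q q) \<le> d\<^sub>2 * N\<^sub>o\<^sub>p q"
    and "0 < \<Gamma>" and "\<forall>x. N\<^sub>o\<^sub>p x \<le> \<Gamma> * N\<^sub>c\<^sub>l x"
    and "R = min R\<^sub>1 (R\<^sub>2 / ereal \<Gamma>)"
    \<comment> \<open>(A3)\<close>
    and "0 < \<alpha>" and "0 < \<sigma>\<^sub>0"
    and "\<forall>x\<in>norm_ball N\<^sub>c\<^sub>l R. \<forall>e\<in>norm_ball N\<^sub>o\<^sub>p (ereal \<sigma>\<^sub>0 * R).
           N\<^sub>c\<^sub>l (pert_field f g x e - pert_field f g x 0) \<le> \<alpha> * N\<^sub>o\<^sub>p e"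
    \<comment> \<open>norm comparison constants\<close>
    and "\<forall>i. 0 < \<theta>\<^sub>c\<^sub>l $ i" and "\<forall>i. 0 < \<theta>\<^sub>o\<^sub>p $ i" and "1 \<le> r"
    and "0 < L\<^sub>c\<^sub>l\<^sub>1" and "0 < L\<^sub>c\<^sub>l\<^sub>2" and "0 < L\<^sub>o\<^sub>p\<^sub>1" and "0 < L\<^sub>o\<^sub>p\<^sub>2"
    and "\<forall>x. L\<^sub>c\<^sub>l\<^sub>1 * weighted_norm \<infinity> \<theta>\<^sub>c\<^sub>l x \<le> N\<^sub>c\<^sub>l x \<and> N\<^sub>c\<^sub>l x \<le> L\<^sub>c\<^sub>l\<^sub>2 * weighted_norm \<infinity> \<theta>\<^sub>c\<^sub>l x"
    and "\<forall>x. L\<^sub>o\<^sub>p\<^sub>1 * weighted_norm r \<theta>\<^sub>o\<^sub>p x \<le> N\<^sub>o\<^sub>p x \<and> N\<^sub>o\<^sub>p x \<le> L\<^sub>o\<^sub>p\<^sub>2 * weighted_norm r \<theta>\<^sub>o\<^sub>p x"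
    and "L\<^sub>c\<^sub>l = L\<^sub>c\<^sub>l\<^sub>2 / L\<^sub>c\<^sub>l\<^sub>1" and "L\<^sub>o\<^sub>p = L\<^sub>o\<^sub>p\<^sub>2 / L\<^sub>o\<^sub>p\<^sub>1"
    \<comment> \<open>(A4)\<close>
    and "R \<noteq> \<infinity>" and "\<forall>i. X\<^sub>0 $ i = \<chi>\<^sub>0 / \<theta>\<^sub>c\<^sub>l $ i" and "0 < \<chi>\<^sub>0"
    and "R / ereal L\<^sub>c\<^sub>l\<^sub>2 \<le> ereal \<chi>\<^sub>0" and "ereal \<chi>\<^sub>0 < 2 * R / ereal (L\<^sub>c\<^sub>l\<^sub>2 * (1 + \<rho>))"
    \<comment> \<open>parameter conditions\<close>
    and "0 < \<rho>" and "\<rho> < 1" and "0 < \<sigma>" and "\<sigma> \<le> \<sigma>\<^sub>0"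
    and "\<sigma>\<^sub>1 = 2 * c * \<rho> / (\<alpha> * L\<^sub>c\<^sub>l * (1 + \<rho>))"
    and "\<Gamma> * L\<^sub>o\<^sub>p * (1 - \<rho>) / (1 + \<rho>) < \<sigma>" and "\<sigma> < \<sigma>\<^sub>1"
    and "(1 + \<rho>) * L\<^sub>c\<^sub>l\<^sub>2 * \<chi>\<^sub>0 / (2 * real_of_ereal R) < \<kappa>" and "\<kappa> < 1"
    \<comment> \<open>closed-loop system with quantizer \<open>Q\<close> and self-triggering mechanism \<open>T\<close>\<close>
    and "x\<^sub>0 \<in> norm_ball N\<^sub>c\<^sub>l (R / ereal L\<^sub>c\<^sub>l)" and "0 < \<tau>\<^sub>m\<^sub>a\<^sub>x"
    and "Q = log_quant \<rho> X\<^sub>0"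
    and "T = stm_interval f g N\<^sub>c\<^sub>l N\<^sub>o\<^sub>p R\<^sub>2 d\<^sub>1 L\<^sub>o\<^sub>p \<rho> \<sigma> \<tau>\<^sub>m\<^sub>a\<^sub>x"
    and "\<gamma> = - 1 / \<tau>\<^sub>m\<^sub>a\<^sub>x * ln (exp (- c * \<tau>\<^sub>m\<^sub>a\<^sub>x) * (1 - \<sigma> / \<sigma>\<^sub>1) + \<sigma> / \<sigma>\<^sub>1)"
  shows
    "(\<forall>t x. closed_loop_trajectory f g Q T x\<^sub>0 t x \<longrightarrow>
          (\<forall>k. t (Suc k) - t k \<ge> min \<tau>\<^sub>m\<^sub>a\<^sub>x (min (tau_min d\<^sub>1 d\<^sub>2 L\<^sub>o\<^sub>p \<rho> \<Gamma> \<sigma>) (tau_tilde_min d\<^sub>1 d\<^sub>2 \<kappa>))))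
       \<and> min \<tau>\<^sub>m\<^sub>a\<^sub>x (min (tau_min d\<^sub>1 d\<^sub>2 L\<^sub>o\<^sub>p \<rho> \<Gamma> \<sigma>) (tau_tilde_min d\<^sub>1 d\<^sub>2 \<kappa>)) > 0
     \<and>
     (\<exists>t x. closed_loop_trajectory f g Q T x\<^sub>0 t x \<and> (\<Union>k. {t k..<t (Suc k)}) = {0..} \<and>
         (\<forall>k. Q (x (t k)) \<in> norm_ball N\<^sub>c\<^sub>l R \<and>
              ivp_exists_uniquely (held_field f g (Q (x (t k)))) (Q (x (t k))) (t (Suc k) - t k)) \<and>
         (\<forall>t' x'. closed_loop_trajectory f g Q T x\<^sub>0 t' x' \<longrightarrow> t' = t \<and> (\<forall>s\<ge>0. x' s = x s)))
     \<and>
     (\<forall>t x. closed_loop_trajectory f g Q T x\<^sub>0 t x \<longrightarrow>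
          (\<forall>s\<ge>0. N\<^sub>c\<^sub>l (x s) \<le> exp (- \<gamma> * s) * N\<^sub>c\<^sub>l x\<^sub>0))
       \<and> \<gamma> > 0"
proof -
  note A1 = assms(4-8) and A2 = assms(9-15) and \<Gamma> = assms(16,17) and A3 = assms(19-21)
    and weights = assms(22-24) and cmp = assms(25-32) and A4 = assms(33-37)
    and param = assms(38-46) and loop = assms(47-51)
  have pos: "0 < R\<^sub>1" "0 < R\<^sub>2" "0 < \<Gamma>" "R = min R\<^sub>1 (R\<^sub>2 / ereal \<Gamma>)" by fact+
  have "0 < R\<^sub>2 / ereal \<Gamma>" using pos(2,3) by (cases R\<^sub>2) auto
  then have "0 < R" using pos(1,4) by simp
  define \<R> where "\<R> = real_of_ereal R"
  have R: "R = ereal \<R>" "0 < \<R>" using \<open>0 < R\<close> \<open>R \<noteq> \<infinity>\<close> by (cases R; simp add: \<R>_def)+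
  have R\<^sub>1: "ereal \<R> \<le> R\<^sub>1" using pos(4) R(1) by (metis min.cobounded1)
  have "ereal \<R> \<le> R\<^sub>2 / ereal \<Gamma>" using pos(4) R(1) by (metis min.cobounded2)
  then have R\<^sub>2: "ereal (\<Gamma> * \<R>) \<le> R\<^sub>2"
    using pos(2,3) by (cases R\<^sub>2) (auto simp: field_simps)
  have norms: "is_norm N\<^sub>c\<^sub>l" "is_norm N\<^sub>o\<^sub>p" by fact+
  define W where "W = weighted_norm \<infinity> \<theta>\<^sub>c\<^sub>l"
  have W: "L\<^sub>c\<^sub>l\<^sub>1 * W x \<le> N\<^sub>c\<^sub>l x" "N\<^sub>c\<^sub>l x \<le> L\<^sub>c\<^sub>l\<^sub>2 * W x" for x using cmp(5) by (auto simp: W_def)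
  have L_pos: "0 < L\<^sub>c\<^sub>l\<^sub>1" "0 < L\<^sub>c\<^sub>l\<^sub>2" "0 < L\<^sub>o\<^sub>p\<^sub>1" "0 < L\<^sub>o\<^sub>p\<^sub>2" "0 < L\<^sub>c\<^sub>l" "0 < L\<^sub>o\<^sub>p" using cmp by auto
  have "1 \<le> L\<^sub>c\<^sub>l"
  proof -
    obtain i :: 'n where True by blast
    have "0 < \<bar>\<theta>\<^sub>c\<^sub>l $ i * (1 :: real^'n) $ i\<bar>" using weights(1)[rule_format, of i] by simp
    also have "\<dots> \<le> W 1" unfolding W_def by (rule weighted_norm_inf_upper)
    finally have "0 < W 1" .
    moreover have "L\<^sub>c\<^sub>l\<^sub>1 * W 1 \<le> L\<^sub>c\<^sub>l\<^sub>2 * W 1" using W[of 1] by linarith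
    ultimately show ?thesis using L_pos cmp(7) by simp
  qed
  \<comment> \<open>On the ball of radius \<open>r\<^sub>0\<close> the weighted maximum norm is below \<open>\<R> / L\<^sub>c\<^sub>l\<^sub>2 \<le> \<chi>\<^sub>0\<close>, the range of
    the quantizer; \<open>k\<close> and \<open>\<beta>\<close> are the relative bounds of \<open>log_quant_bounds\<close> after passing from the weighted
    norms to the given ones.\<close>
  define r\<^sub>0 where "r\<^sub>0 = \<R> / L\<^sub>c\<^sub>l"
  define k where "k = L\<^sub>o\<^sub>p * (1 - \<rho>) / (1 + \<rho>)"
  define \<beta> where "\<beta> = L\<^sub>c\<^sub>l * (1 + \<rho>) / (2 * \<rho>)"
  define \<tau>\<^sub>l where "\<tau>\<^sub>l = min \<tau>\<^sub>m\<^sub>a\<^sub>x (min (tau_min d\<^sub>1 d\<^sub>2 L\<^sub>o\<^sub>p \<rho> \<Gamma> \<sigma>) (tau_tilde_min d\<^sub>1 d\<^sub>2 \<kappa>))"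
  have \<rho>: "0 < \<rho>" "\<rho> < 1" by fact+
  have \<kappa>_R: "(1 + \<rho>) / 2 * (L\<^sub>c\<^sub>l\<^sub>2 * \<chi>\<^sub>0) < \<kappa> * \<R>"
    using param(8) R(2) by (simp add: \<R>_def[symmetric] field_simps)
  have "0 < (1 + \<rho>) / 2 * (L\<^sub>c\<^sub>l\<^sub>2 * \<chi>\<^sub>0)" using \<rho> L_pos A4(3) by (intro mult_pos_pos) auto
  then have "0 < \<kappa> * \<R>" using \<kappa>_R by linarith
  then have \<kappa>: "0 < \<kappa>" "\<kappa> < 1" using R(2) param(9) by (auto simp: zero_less_mult_iff)
  have k_bounds: "0 \<le> L\<^sub>o\<^sub>p * (1 - \<rho>) / (1 + \<rho>)" "L\<^sub>o\<^sub>p * (1 - \<rho>) / (1 + \<rho>) < \<sigma> / \<Gamma>"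
    using \<rho> L_pos param(6) \<Gamma>(1) by (auto simp: pos_less_divide_eq mult_ac)
  have ratio: "\<alpha> * \<sigma> * \<beta> / c = \<sigma> / \<sigma>\<^sub>1"
    using \<rho> L_pos A3(1) A1(2) by (simp add: param(5) \<beta>_def field_simps)
  have "0 < \<sigma>\<^sub>1" using param(3,7) by linarith
  have in_op_ball: "x \<in> norm_ball N\<^sub>o\<^sub>p R\<^sub>2" if "N\<^sub>c\<^sub>l x < \<R>" for x
  proof -
    have "N\<^sub>o\<^sub>p x < \<Gamma> * \<R>" using \<Gamma>(2)[rule_format, of x] mult_strict_left_mono[OF that \<Gamma>(1)] by linarith
    then have "ereal (N\<^sub>o\<^sub>p x) < ereal (\<Gamma> * \<R>)" by simp
    also note R\<^sub>2
    finally show ?thesis by (simp add: norm_ball_def)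
  qed
  have op: "held_input f g N\<^sub>o\<^sub>p R\<^sub>2 d\<^sub>1 d\<^sub>2"
  proof
    fix q assume q: "q \<in> norm_ball N\<^sub>o\<^sub>p R\<^sub>2"
    show "one_sided_lipschitz N\<^sub>o\<^sub>p d\<^sub>1 (norm_ball N\<^sub>o\<^sub>p R\<^sub>2) (held_field f g q)"
      using A2(5,6) q
      by (intro one_sided_lipschitz_of_log_norm[OF norms(2) convex_norm_ball[OF norms(2)]])
         (auto simp: cont_differentiable_on_def)
  qed (use f_cont A2 in auto)
  have osl_cl: "one_sided_lipschitz N\<^sub>c\<^sub>l (- c) (norm_ball N\<^sub>c\<^sub>l R\<^sub>1) (\<lambda>y. pert_field f g y 0)"
    by (rule one_sided_lipschitz_of_log_norm_ae[OF norms(1) convex_norm_ball[OF norms(1)] open_norm_ball[OF norms(1)] A1(4,5)])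
  interpret cl: closed_loop f g N\<^sub>o\<^sub>p R\<^sub>2 d\<^sub>1 d\<^sub>2 N\<^sub>c\<^sub>l c \<alpha> \<sigma> \<R> r\<^sub>0 k \<beta> \<kappa> \<tau>\<^sub>l \<tau>\<^sub>m\<^sub>a\<^sub>x Q T
  proof (intro closed_loop.intro closed_loop_axioms.intro op)
    show "0 < \<beta>" using \<rho> L_pos by (simp add: \<beta>_def)
    show "r\<^sub>0 \<le> \<R>" using \<open>1 \<le> L\<^sub>c\<^sub>l\<close> R(2) by (simp add: r\<^sub>0_def pos_divide_le_eq)
    show "0 < \<tau>\<^sub>l"
      using tau_min_props(1)[OF A2(2,3) k_bounds] tau_tilde_min_props(1)[OF A2(2,3) \<kappa>] loop(2)
      by (simp add: \<tau>\<^sub>l_def)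
    show "\<alpha> * \<sigma> * \<beta> / c < 1" using param(7) \<open>0 < \<sigma>\<^sub>1\<close> by (simp add: ratio)
    show "\<xi> \<bullet> pert_field f g x 0 \<le> - c * N\<^sub>c\<^sub>l x" if "N\<^sub>c\<^sub>l x < \<R>" "norming N\<^sub>c\<^sub>l x \<xi>" for x \<xi>
    proof -
      have "ereal (N\<^sub>c\<^sub>l x) < ereal \<R>" using that by simp
      also note R\<^sub>1
      finally have "x \<in> norm_ball N\<^sub>c\<^sub>l R\<^sub>1" by (simp add: norm_ball_def)
      moreover have "0 \<in> norm_ball N\<^sub>c\<^sub>l R\<^sub>1"
        using pos(1) by (simp add: norm_ball_def is_norm_zero[OF norms(1)] zero_ereal_def)
      moreover have "pert_field f g 0 0 = 0" using equilibrium by (simp add: pert_field_def)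
      ultimately show ?thesis using one_sided_lipschitzD[OF osl_cl, of x 0 \<xi>] that by simp
    qed
    show "N\<^sub>c\<^sub>l (pert_field f g x e - pert_field f g x 0) \<le> \<alpha> * N\<^sub>o\<^sub>p e" if "N\<^sub>c\<^sub>l x < \<R>" "N\<^sub>o\<^sub>p e < \<sigma> * \<R>" for x e
    proof -
      have "\<sigma> * \<R> \<le> \<sigma>\<^sub>0 * \<R>" using param(4) R(2) by simp
      then show ?thesis using A3(3) that by (simp add: norm_ball_def R(1))
    qed
    have small: "weighted_norm \<infinity> \<theta>\<^sub>c\<^sub>l x < \<chi>\<^sub>0" if "N\<^sub>c\<^sub>l x < r\<^sub>0" for x
    proof -
      have "L\<^sub>c\<^sub>l\<^sub>1 * W x < \<R> / L\<^sub>c\<^sub>l" using W(1)[of x] that by (simp add: r\<^sub>0_def)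
      then have "W x < \<R> / L\<^sub>c\<^sub>l\<^sub>2" using L_pos by (simp add: cmp(7) field_simps)
      also have "\<R> / L\<^sub>c\<^sub>l\<^sub>2 \<le> \<chi>\<^sub>0" using A4(4) L_pos by (simp add: R(1))
      finally show ?thesis by (simp add: W_def)
    qed
    note quant = log_quant_bounds[OF \<rho> weights(1) A4(2) small, folded loop(3)]
    show "N\<^sub>c\<^sub>l (Q x) \<le> \<kappa> * \<R>" if x: "N\<^sub>c\<^sub>l x < r\<^sub>0" for x
    proof -
      have "N\<^sub>c\<^sub>l (Q x) \<le> L\<^sub>c\<^sub>l\<^sub>2 * W (Q x)" by (rule W)
      also have "\<dots> \<le> L\<^sub>c\<^sub>l\<^sub>2 * ((1 + \<rho>) / 2 * \<chi>\<^sub>0)"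
        using quant(1)[OF x] L_pos by (intro mult_left_mono) (auto simp: W_def)
      also have "\<dots> = (1 + \<rho>) / 2 * (L\<^sub>c\<^sub>l\<^sub>2 * \<chi>\<^sub>0)" by (rule mult.left_commute)
      finally show ?thesis using \<kappa>_R by linarith
    qed
    show "N\<^sub>o\<^sub>p (x - Q x) \<le> k * N\<^sub>o\<^sub>p (Q x)" if x: "N\<^sub>c\<^sub>l x < r\<^sub>0" for x
    proof -
      have "N\<^sub>o\<^sub>p (x - Q x) \<le> L\<^sub>o\<^sub>p\<^sub>2 * weighted_norm r \<theta>\<^sub>o\<^sub>p (x - Q x)" using cmp(6) by blast
      also have "\<dots> \<le> L\<^sub>o\<^sub>p\<^sub>2 * ((1 - \<rho>) / (1 + \<rho>) * weighted_norm r \<theta>\<^sub>o\<^sub>p (Q x))"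
        using quant(2)[OF x weights(3)] L_pos by (intro mult_left_mono) auto
      also have "\<dots> = k * (L\<^sub>o\<^sub>p\<^sub>1 * weighted_norm r \<theta>\<^sub>o\<^sub>p (Q x))"
        using L_pos by (simp add: k_def cmp(8))
      also have "\<dots> \<le> k * N\<^sub>o\<^sub>p (Q x)" using cmp(6) k_bounds by (intro mult_left_mono) (auto simp: k_def)
      finally show ?thesis .
    qed
    show "N\<^sub>c\<^sub>l (Q x) \<le> \<beta> * N\<^sub>c\<^sub>l x" if x: "N\<^sub>c\<^sub>l x < r\<^sub>0" for x
    proof -
      have "N\<^sub>c\<^sub>l (Q x) \<le> L\<^sub>c\<^sub>l\<^sub>2 * W (Q x)" by (rule W)
      also have "\<dots> \<le> L\<^sub>c\<^sub>l\<^sub>2 * ((1 + \<rho>) / (2 * \<rho>) * W x)"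
        using quant(3)[OF x, of \<infinity>] L_pos by (intro mult_left_mono) (auto simp: W_def)
      also have "\<dots> = \<beta> * (L\<^sub>c\<^sub>l\<^sub>1 * W x)" using L_pos by (simp add: \<beta>_def cmp(7))
      also have "\<dots> \<le> \<beta> * N\<^sub>c\<^sub>l x" using W(1) \<rho> L_pos by (intro mult_left_mono) (auto simp: \<beta>_def)
      finally show ?thesis .
    qed
    fix q assume q: "N\<^sub>c\<^sub>l q \<le> \<kappa> * \<R>"
    have "N\<^sub>o\<^sub>p q \<le> \<Gamma> * N\<^sub>c\<^sub>l q" using \<Gamma>(2) by blast
    moreover have "\<Gamma> * N\<^sub>c\<^sub>l q \<le> \<Gamma> * (\<kappa> * \<R>)" using q \<Gamma>(1) by simp
    ultimately have "N\<^sub>o\<^sub>p q \<le> \<kappa> * (\<Gamma> * \<R>)" by (simp add: mult.left_commute)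
    note interval = held_input.sampling_interval[where q = q and N\<^sub>c\<^sub>l = N\<^sub>c\<^sub>l, OF op loop(2) k_bounds \<Gamma>(1) \<open>N\<^sub>o\<^sub>p q \<le> \<Gamma> * N\<^sub>c\<^sub>l q\<close>
        param(3) \<kappa> mult_pos_pos[OF \<Gamma>(1) R(2)] R\<^sub>2 this]
    show "\<tau>\<^sub>l \<le> T q" using interval(1) by (simp add: \<tau>\<^sub>l_def loop(4))
    show "T q \<le> \<tau>\<^sub>m\<^sub>a\<^sub>x" using interval(2) by (simp add: loop(4))
    show "\<exists>y. ivp_solution (held_field f g q) q (T q) y
        \<and> (\<forall>s. 0 \<le> s \<longrightarrow> s < T q \<longrightarrow> y s \<in> norm_ball N\<^sub>o\<^sub>p R\<^sub>2)
        \<and> (\<forall>s. 0 < s \<longrightarrow> s < T q \<longrightarrow> k * exp (d\<^sub>1 * s) * N\<^sub>o\<^sub>p q + N\<^sub>o\<^sub>p (y s - q) \<le> \<sigma> * N\<^sub>c\<^sub>l q)"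
      using interval(3) by (simp add: k_def loop(4))
  qed (use norms A1 A3 param R in_op_ball in auto)
  have x\<^sub>0: "N\<^sub>c\<^sub>l x\<^sub>0 < r\<^sub>0" using loop(1) L_pos by (simp add: norm_ball_def R(1) r\<^sub>0_def)
  have \<gamma>: "\<gamma> = - 1 / \<tau>\<^sub>m\<^sub>a\<^sub>x * ln (cl.decay \<tau>\<^sub>m\<^sub>a\<^sub>x)"
    by (simp add: loop(5) cl.decay_def cl.gain_def ratio)
  obtain t x where traj: "closed_loop_trajectory f g Q T x\<^sub>0 t x" using cl.trajectory_exists[OF x\<^sub>0] by blast
  have "(\<Union>j. {t j..<t (Suc j)}) = {0..}"
  proof (intro equalityI subsetI)
    fix s assume "s \<in> (\<Union>j. {t j..<t (Suc j)})"
    then show "s \<in> {0..}" using cl.trajectory_at_sampling_times(3)[OF traj x\<^sub>0 \<gamma>] by (force intro: order_trans)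
  next
    fix s :: real assume "s \<in> {0..}"
    then show "s \<in> (\<Union>j. {t j..<t (Suc j)})" using cl.trajectory_covers[OF traj x\<^sub>0, of s] by auto
  qed
  moreover have "Q (x (t j)) \<in> norm_ball N\<^sub>c\<^sub>l R" for j
    using cl.trajectory_prediction_exists(1)[OF traj x\<^sub>0] by (simp add: norm_ball_def R(1))
  moreover note cl.trajectory_prediction_exists(2)[OF traj x\<^sub>0] cl.trajectory_unique[OF traj _ x\<^sub>0]
  ultimately have existence: "\<exists>t x. closed_loop_trajectory f g Q T x\<^sub>0 t x \<and> (\<Union>k. {t k..<t (Suc k)}) = {0..} \<and>
         (\<forall>k. Q (x (t k)) \<in> norm_ball N\<^sub>c\<^sub>l R \<and>
              ivp_exists_uniquely (held_field f g (Q (x (t k)))) (Q (x (t k))) (t (Suc k) - t k)) \<and>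
         (\<forall>t' x'. closed_loop_trajectory f g Q T x\<^sub>0 t' x' \<longrightarrow> t' = t \<and> (\<forall>s\<ge>0. x' s = x s))"
    using traj by blast
  have steps: "\<forall>t x. closed_loop_trajectory f g Q T x\<^sub>0 t x \<longrightarrow> (\<forall>k. t (Suc k) - t k \<ge> \<tau>\<^sub>l)"
    using cl.trajectory_step[OF _ x\<^sub>0] by blast
  have decay: "\<forall>t x. closed_loop_trajectory f g Q T x\<^sub>0 t x \<longrightarrow> (\<forall>s\<ge>0. N\<^sub>c\<^sub>l (x s) \<le> exp (- \<gamma> * s) * N\<^sub>c\<^sub>l x\<^sub>0)"
    using cl.trajectory_decay[OF _ x\<^sub>0 \<gamma>] by blast
  show ?thesis
    using steps cl.\<tau>\<^sub>l existence decay cl.rate_pos[OF loop(2) \<gamma>] unfolding \<tau>\<^sub>l_def by (intro conjI)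
qed

end
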